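(* Let $\tau$ be the twisted full toroidal Lie algebra described in the context. Let $V\in\mathcal{B}_\psi$ be an irreducible $\tau$-module and suppose that $K_0$ acts on $V$ by a scalar $C_0\neq 0$. Let $S=\{v\in V:\tau_+v=0\}$ and $T=\{v\in V:\tau^{+}v=0\}$. Let $M'(S)=U(\tau)\otimes_{U(\tau_+\oplus\tau_0)}S$, where $\tau_+$ acts on $S$ by zero, and $M(T)=U(\tau)\otimes_{U(\tau^+\oplus\tau^0)}T$, where $\tau^+$ acts on $T$ by zero. Let $L'(S)$ be the unique irreducible quotient of $M'(S)$ and let $L(T)$ be the unique irreducible quotient of $M(T)$. Then $V\cong L'(S)\cong L(T)$ as $\tau$-modules.
   Context: Everything is over $\mathbb{C}$. The algebra $\tau$. Let $\mathfrak{g}$ be a finite dimensional simple Lie algebra with a non-degenerate invariant symmetric bilinear form $(\cdot,\cdot)$; fix $n\ge 1$ and commuting automorphisms $\sigma_0,\dots,\sigma_n$ of $\mathfrak{g}$ of finite orders $m_0,\dots,m_n$. Put $\underline{m}=(m_1,\dots,m_n)$, $\Gamma=m_1\mathbb{Z}\oplus\cdots\oplus m_n\mathbb{Z}$, $\Gamma_0=m_0\mathbb{Z}$, $\Lambda=\mathbb{Z}^n/\Gamma$, $\Lambda_0=\mathbb{Z}/\Gamma_0$; bars denote images in $\Lambda$ or $\Lambda_0$. For $\underline{k}=(k_1,\dots,k_n)\in\mathbb{Z}^n$ write $t^{\underline{k}}=t_1^{k_1}\cdots t_n^{k_n}$. Let $\xi_i$ be a primitive $m_i$-th root of unity, and $\mathfrak{g}(\overline{k_0},\overline{k})=\{x\in\mathfrak{g}:\sigma_i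 x=\xi_i^{k_i}x,\ 0\le i\le n\}$. The multiloop algebra is $L(\mathfrak{g},\sigma)=\bigoplus_{(k_0,\underline{k})\in\mathbb{Z}^{n+1}}\mathfrak{g}(\overline{k_0},\overline{k})\otimes\mathbb{C}t_0^{k_0}t^{\underline{k}}$. Let $A(m_0,\underline{m})=\mathbb{C}[t_0^{\pm m_0},\dots,t_n^{\pm m_n}]$. Let $Z(m_0,\underline{m})$ be the space spanned by symbols $t_0^{r_0}t^{\underline{r}}K_i$ ($r_0\in\Gamma_0$, $\underline{r}\in\Gamma$, $0\le i\le n$) modulo the relations $\sum_{i=0}^n r_i t_0^{r_0}t^{\underline{r}}K_i=0$. Let $D(m_0,\underline{m})$ be the derivation algebra of $A(m_0,\underline{m})$, with basis $t_0^{r_0}t^{\underline{r}}d_i$, $d_i=t_i\frac{d}{dt_i}$ ($r_0\in\Gamma_0$, $\underline{r}\in\Gamma$, $0\le i\le n$). The twisted full toroidal Lie algebra is $\tau=L(\mathfrak{g},\sigma)\oplus Z(m_0,\underline{m})\oplus D(m_0,\underline{m})$ with brackets, for $X(k_0,\underline{k})=X\otimes t_0^{k_0}t^{\underline{k}}$ and $r_0,s_0\in\Gamma_0$, $\underline{r},\underline{s}\in\Gamma$, $0\le a,b\le n$: $[X(k_0,\underline{k}),Y(l_0,\underline{l})]=[X,Y](k_0+l_0,\underline{k}+\underline{l})+(X,Y)\sum_{i=0}^n k_i t_0^{k_0+l_0}t^{\underline{k}+\underline{l}}K_i$; $[L(\mathfrak{g},\sigma)\oplus Z(m_0,\underline{m}),Z(m_0,\underline{m})]=0$;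 $[t_0^{r_0}t^{\underline{r}}d_a,X(k_0,\underline{k})]=k_aX(k_0+r_0,\underline{k}+\underline{r})$; $[t_0^{r_0}t^{\underline{r}}d_a,t_0^{s_0}t^{\underline{s}}K_b]=s_at_0^{r_0+s_0}t^{\underline{r}+\underline{s}}K_b+\delta_{ab}\sum_{p=0}^n r_pt_0^{r_0+s_0}t^{\underline{r}+\underline{s}}K_p$; $[t_0^{r_0}t^{\underline{r}}d_a,t_0^{s_0}t^{\underline{s}}d_b]=s_at_0^{r_0+s_0}t^{\underline{r}+\underline{s}}d_b-r_bt_0^{r_0+s_0}t^{\underline{r}+\underline{s}}d_a+\phi(t_0^{r_0}t^{\underline{r}}d_a,t_0^{s_0}t^{\underline{s}}d_b)$, where $\phi$ is a fixed arbitrary linear combination of the cocycles $\phi_1(t_0^{r_0}t^{\underline{r}}d_a,t_0^{s_0}t^{\underline{s}}d_b)=-s_ar_b\sum_{p=0}^n r_pt_0^{r_0+s_0}t^{\underline{r}+\underline{s}}K_p$ and $\phi_2(t_0^{r_0}t^{\underline{r}}d_a,t_0^{s_0}t^{\underline{s}}d_b)=r_as_b\sum_{p=0}^n r_pt_0^{r_0+s_0}t^{\underline{r}+\underline{s}}K_p$. The centre $Z(\tau)$ is spanned by $K_0,\dots,K_n$. Standing assumptions. (i) $\mathfrak{g}(\overline{0},\overline{0})$ is a simple Lie algebra. (ii) Cartan subalgebras $\mathfrak{h}(\overline{0})$ of $\mathfrak{g}(\overline{0},\overline{0})$ and $\mathfrak{h}$ of $\mathfrak{g}$ are chosen with $\mathfrak{h}(\overline{0})\subseteq\mathfrak{h}$.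 (iii) Let $\Delta_0^\times$ be the set of non-zero roots of $\mathfrak{g}(\overline{0},\overline{0})$ with respect to $\mathfrak{h}(\overline{0})$ and $\Delta_{0,sh}^\times$ its short roots; let $\Delta_{0,en}^\times=\Delta_0^\times\cup 2\Delta_{0,sh}^\times$ if $\Delta_0^\times$ is of type $B_l$, and $\Delta_{0,en}^\times=\Delta_0^\times$ otherwise; $\Delta_{0,en}=\Delta_{0,en}^\times\cup\{0\}$. It is assumed that the set of weights (including $0$) of $\mathfrak{h}(\overline{0})$ on $\mathfrak{g}$ equals $\Delta_{0,en}$. Fix a choice of positive roots in $\Delta_{0,en}$. Triangular decompositions. (a) $\tau_q=\{X\in\tau:[d_0,X]=qX\}$, $\tau_\pm=\bigoplus_{\pm q>0}\tau_q$, so $\tau=\tau_-\oplus\tau_0\oplus\tau_+$, where $\tau_0$ is the $q=0$ part. (b) $\tau=\tau^-\oplus\tau^0\oplus\tau^+$, with $\tau^{\pm}$ the sum of root spaces for roots $\alpha+k_0\delta_0+\delta_{\underline{k}}$ (i.e. $\mathfrak{h}(\overline{0})$-weight $\alpha$, $d_0$-weight $k_0$, $(d_1,\dots,d_n)$-weight $\underline{k}$) with $\pm(\alpha+k_0\delta_0)>0$ in the affine root system $\{\alpha+k_0\delta_0:\alpha\in\Delta_{0,en},k_0\in\mathbb{Z}\}$ (positive means $k_0>0$, or $k_0=0$ and $\alpha>0$), and $\tau^0$ the part with $\alpha=0$, $k_0=0$. Category $\mathcal{B}_\psi$. For a linear map $\psi:Z(\tau)\to\mathbb{C}$, a $\tau$-module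 $V$ is in $\mathcal{B}_\psi$ if: $V=\bigoplus_{\underline{\lambda}\in\mathbb{C}^{n+1}}V_{\underline{\lambda}}$ with $V_{\underline{\lambda}}=\{v:d_iv=\lambda_iv,\ 0\le i\le n\}$; all $V_{\underline{\lambda}}$ are finite dimensional; $K_iv=\psi(K_i)v$ for all $v\in V$ and $0\le i\le n$; the real parts of the eigenvalues of $d_0$ on $V$ are bounded above. For such irreducible $V$, $S$ is an irreducible $\tau_0$-module and $T$ is an irreducible $\tau^0$-module. *)

theory Defs
  imports
    Complex_Main
    "HOL-Library.Poly_Mapping"
    "HOL-Library.Function_Algebras"
    "HOL-Library.Product_Plus"
begin

section \<open>Finitely supported functions as complex vector spaces, quotients\<close>

abbreviation "keys \<equiv> Poly_Mapping.keys"
abbreviation "lookup \<equiv> Poly_Mapping.lookup"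
abbreviation "single \<equiv> Poly_Mapping.single"

definition pscale :: "complex \<Rightarrow> ('k \<Rightarrow>\<^sub>0 complex) \<Rightarrow> ('k \<Rightarrow>\<^sub>0 complex)"
  where "pscale c f = Poly_Mapping.map ((*) c) f"

lemma lookup_pscale [simp]: "lookup (pscale c f) k = c * lookup f k"
  by (simp add: pscale_def map.rep_eq when_def)

lemma vector_space_pscale: "vector_space pscale"
  by unfold_locales (auto intro!: poly_mapping_eqI simp: lookup_add algebra_simps)

lemma pscale_single [simp]: "pscale c (single k a) = single k (c * a)"
  by (auto intro!: poly_mapping_eqI simp: lookup_single when_def)

definition coset :: "'a::ab_group_add set \<Rightarrow> 'a \<Rightarrow> 'a set"
  where "coset N x = {y. y - x \<in> N}"

definition lift1 :: "'a::ab_group_add set \<Rightarrow> ('a \<Rightarrow> 'a) \<Rightarrow> 'a set \<Rightarrow> 'a set"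
  where "lift1 N f A = (\<Union>x\<in>A. coset N (f x))"

definition lift2 :: "'a::ab_group_add set \<Rightarrow> ('a \<Rightarrow> 'a \<Rightarrow> 'a) \<Rightarrow> 'a set \<Rightarrow> 'a set \<Rightarrow> 'a set"
  where "lift2 N f A B = (\<Union>x\<in>A. \<Union>y\<in>B. coset N (f x y))"

definition fin_dim :: "(complex \<Rightarrow> 'a::ab_group_add \<Rightarrow> 'a) \<Rightarrow> 'a set \<Rightarrow> bool"
  where "fin_dim s W \<longleftrightarrow> (\<exists>B. finite B \<and> W \<subseteq> module.span s B)"

section \<open>Complex Lie algebras\<close>

text \<open>A Lie algebra lives on a subspace of an ambient vector space.\<close>

record 'a lie_algebra =
  lcarrier :: "'a set"
  lscale :: "complex \<Rightarrow> 'a \<Rightarrow> 'a"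
  lbracket :: "'a \<Rightarrow> 'a \<Rightarrow> 'a"

definition is_lie_algebra :: "'a::ab_group_add lie_algebra \<Rightarrow> bool"
  where "is_lie_algebra L \<longleftrightarrow>
    vector_space (lscale L) \<and> module.subspace (lscale L) (lcarrier L) \<and>
    (\<forall>x\<in>lcarrier L. \<forall>y\<in>lcarrier L. lbracket L x y \<in> lcarrier L) \<and>
    (\<forall>x\<in>lcarrier L. \<forall>y\<in>lcarrier L. \<forall>z\<in>lcarrier L.
       lbracket L (x + y) z = lbracket L x z + lbracket L y z \<and>
       lbracket L z (x + y) = lbracket L z x + lbracket L z y) \<and>
    (\<forall>c. \<forall>x\<in>lcarrier L. \<forall>y\<in>lcarrier L.
       lbracket L (lscale L c x) y = lscale L c (lbracket L x y) \<and>
       lbracket L x (lscale L c y) = lscale L c (lbracket L x y)) \<and>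
    (\<forall>x\<in>lcarrier L. lbracket L x x = 0) \<and>
    (\<forall>x\<in>lcarrier L. \<forall>y\<in>lcarrier L. \<forall>z\<in>lcarrier L.
       lbracket L x (lbracket L y z) + lbracket L y (lbracket L z x)
         + lbracket L z (lbracket L x y) = 0)"

definition lie_ideal :: "'a::ab_group_add lie_algebra \<Rightarrow> 'a set \<Rightarrow> bool"
  where "lie_ideal L I \<longleftrightarrow> I \<subseteq> lcarrier L \<and> module.subspace (lscale L) I \<and>
    (\<forall>x\<in>lcarrier L. \<forall>y\<in>I. lbracket L x y \<in> I)"

definition simple_lie :: "'a::ab_group_add lie_algebra \<Rightarrow> bool"
  where "simple_lie L \<longleftrightarrow> is_lie_algebra L \<and>
    (\<exists>x\<in>lcarrier L. \<exists>y\<in>lcarrier L. lbracket L x y \<noteq> 0) \<and>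
    (\<forall>I. lie_ideal L I \<longrightarrow> I = {0} \<or> I = lcarrier L)"

definition lie_centre :: "'a::ab_group_add lie_algebra \<Rightarrow> 'a set"
  where "lie_centre L = {z\<in>lcarrier L. \<forall>x\<in>lcarrier L. lbracket L x z = 0}"

definition lie_automorphism :: "'a::ab_group_add lie_algebra \<Rightarrow> ('a \<Rightarrow> 'a) \<Rightarrow> bool"
  where "lie_automorphism L f \<longleftrightarrow> bij_betw f (lcarrier L) (lcarrier L) \<and>
    (\<forall>x\<in>lcarrier L. \<forall>y\<in>lcarrier L. f (x + y) = f x + f y) \<and>
    (\<forall>c. \<forall>x\<in>lcarrier L. f (lscale L c x) = lscale L c (f x)) \<and>
    (\<forall>x\<in>lcarrier L. \<forall>y\<in>lcarrier L. f (lbracket L x y) = lbracket L (f x) (f y))"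

definition linear_form_on ::
    "(complex \<Rightarrow> 'a::ab_group_add \<Rightarrow> 'a) \<Rightarrow> 'a set \<Rightarrow> ('a \<Rightarrow> complex) \<Rightarrow> bool"
  where "linear_form_on s W f \<longleftrightarrow>
    (\<forall>x\<in>W. \<forall>y\<in>W. f (x + y) = f x + f y) \<and> (\<forall>c. \<forall>x\<in>W. f (s c x) = c * f x)"

definition invariant_form :: "'a::ab_group_add lie_algebra \<Rightarrow> ('a \<Rightarrow> 'a \<Rightarrow> complex) \<Rightarrow> bool"
  where "invariant_form L B \<longleftrightarrow>
    (\<forall>x\<in>lcarrier L. linear_form_on (lscale L) (lcarrier L) (B x)) \<and>
    (\<forall>x\<in>lcarrier L. \<forall>y\<in>lcarrier L. B x y = B y x) \<and>
    (\<forall>x\<in>lcarrier L. \<forall>y\<in>lcarrier L. \<forall>z\<in>lcarrier L.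
       B (lbracket L x y) z = B x (lbracket L y z)) \<and>
    (\<forall>x\<in>lcarrier L. (\<forall>y\<in>lcarrier L. B x y = 0) \<longrightarrow> x = 0)"

text \<open>For a complex semisimple Lie algebra: a self-centralising abelian subalgebra whose elements
  are ad-diagonalisable.\<close>

definition ad_diagonalisable :: "'a::ab_group_add lie_algebra \<Rightarrow> 'a \<Rightarrow> bool"
  where "ad_diagonalisable L h \<longleftrightarrow>
    lcarrier L = module.span (lscale L) {x\<in>lcarrier L. \<exists>c. lbracket L h x = lscale L c x}"

definition cartan_subalgebra :: "'a::ab_group_add lie_algebra \<Rightarrow> 'a set \<Rightarrow> bool"
  where "cartan_subalgebra L H \<longleftrightarrow> H \<subseteq> lcarrier L \<and> module.subspace (lscale L) H \<and>
    (\<forall>x\<in>H. \<forall>y\<in>H. lbracket L x y = 0) \<and>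
    (\<forall>x\<in>lcarrier L. (\<forall>h\<in>H. lbracket L h x = 0) \<longrightarrow> x \<in> H) \<and>
    (\<forall>h\<in>H. ad_diagonalisable L h)"

subsection \<open>Weights and roots\<close>

text \<open>A linear form on \<open>H\<close> is represented by the function which agrees with it on \<open>H\<close> and
  vanishes off \<open>H\<close>, so that equal forms are equal functions.\<close>

definition weights :: "'a::ab_group_add lie_algebra \<Rightarrow> 'a set \<Rightarrow> ('a \<Rightarrow> complex) set"
  where "weights L H = {\<alpha>. linear_form_on (lscale L) H \<alpha> \<and> (\<forall>x. x \<notin> H \<longrightarrow> \<alpha> x = 0) \<and>
    (\<exists>x\<in>lcarrier L. x \<noteq> 0 \<and> (\<forall>h\<in>H. lbracket L h x = lscale L (\<alpha> h) x))}"

text \<open>Squared length of \<open>\<alpha>\<close> for the canonical invariant form of the root system \<open>R\<close>, i.e. the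
  form on the dual of \<open>H\<close> induced by the restriction to \<open>H\<close> of the Killing form, which is
  \<open>\<Sum>\<beta>\<in>R. \<beta> h * \<beta> h'\<close> since root spaces are one-dimensional.\<close>

definition sq_length :: "'a set \<Rightarrow> ('a \<Rightarrow> complex) set \<Rightarrow> ('a \<Rightarrow> complex) \<Rightarrow> real"
  where "sq_length H R \<alpha> = Re (\<alpha> (THE t. t \<in> H \<and> (\<forall>h\<in>H. (\<Sum>\<beta>\<in>R. \<beta> t * \<beta> h) = \<alpha> h)))"

definition short_roots :: "'a set \<Rightarrow> ('a \<Rightarrow> complex) set \<Rightarrow> ('a \<Rightarrow> complex) set"
  where "short_roots H R = {\<alpha>\<in>R. \<forall>\<beta>\<in>R. sq_length H R \<alpha> \<le> sq_length H R \<beta>}"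

definition type_B :: "nat \<Rightarrow> ('a \<Rightarrow> complex) set \<Rightarrow> bool"
  where "type_B l R \<longleftrightarrow> (\<exists>e. (\<forall>c. (\<Sum>i<l. (\<lambda>x. c i * e i x)) = 0 \<longrightarrow> (\<forall>i<l. c i = (0::complex))) \<and>
    R = (\<Union>i<l. {e i, - e i}) \<union>
        (\<Union>j<l. \<Union>i<j. {e i + e j, e i - e j, - e i + e j, - e i - e j}))"

text \<open>\<open>b\<close> is the rank at which the series B is taken to start (see \<open>toroidal_datum\<close>).\<close>

definition enlarged_roots :: "nat \<Rightarrow> 'a set \<Rightarrow> ('a \<Rightarrow> complex) set \<Rightarrow> ('a \<Rightarrow> complex) set"
  where "enlarged_roots b H R =
    (if \<exists>l\<ge>b. type_B l R then R \<union> (\<lambda>\<alpha>. \<alpha> + \<alpha>) ` short_roots H R else R)"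

definition nat_comb :: "('a \<Rightarrow> complex) set \<Rightarrow> ('a \<Rightarrow> complex) set"
  where "nat_comb \<Pi> = {\<alpha>. \<exists>c :: _ \<Rightarrow> nat. \<alpha> = (\<lambda>x. \<Sum>\<beta>\<in>\<Pi>. of_nat (c \<beta>) * \<beta> x)}"

definition positive_roots :: "('a \<Rightarrow> complex) set \<Rightarrow> ('a \<Rightarrow> complex) set \<Rightarrow> bool"
  where "positive_roots R P \<longleftrightarrow> (\<exists>\<Pi>. finite \<Pi> \<and> \<Pi> \<subseteq> R \<and>
    (\<forall>c. (\<Sum>\<beta>\<in>\<Pi>. (\<lambda>x. c \<beta> * \<beta> x)) = 0 \<longrightarrow> (\<forall>\<beta>\<in>\<Pi>. c \<beta> = (0::complex))) \<and>
    (\<forall>\<alpha>\<in>R. \<alpha> \<in> nat_comb \<Pi> \<or> - \<alpha> \<in> nat_comb \<Pi>) \<and>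
    P = R \<inter> nat_comb \<Pi>)"

section \<open>Modules over a Lie algebra\<close>

definition lie_representation ::
    "'t::ab_group_add lie_algebra \<Rightarrow> (complex \<Rightarrow> 'v::ab_group_add \<Rightarrow> 'v) \<Rightarrow> ('t \<Rightarrow> 'v \<Rightarrow> 'v) \<Rightarrow> bool"
  where "lie_representation L s \<rho> \<longleftrightarrow> vector_space s \<and>
    (\<forall>x\<in>lcarrier L. Vector_Spaces.linear s s (\<rho> x)) \<and>
    (\<forall>x\<in>lcarrier L. \<forall>y\<in>lcarrier L. \<forall>v. \<rho> (x + y) v = \<rho> x v + \<rho> y v) \<and>
    (\<forall>c. \<forall>x\<in>lcarrier L. \<forall>v. \<rho> (lscale L c x) v = s c (\<rho> x v)) \<and>
    (\<forall>x\<in>lcarrier L. \<forall>y\<in>lcarrier L. \<forall>v. \<rho> (lbracket L x y) v = \<rho> x (\<rho> y v) - \<rho> y (\<rho> x v))"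

text \<open>Quotient modules do not live on types, hence a record of operations.\<close>

record ('t, 'm) lie_module =
  mcarrier :: "'m set"
  madd :: "'m \<Rightarrow> 'm \<Rightarrow> 'm"
  mzero :: "'m"
  mscale :: "complex \<Rightarrow> 'm \<Rightarrow> 'm"
  mact :: "'t \<Rightarrow> 'm \<Rightarrow> 'm"

definition module_of ::
    "(complex \<Rightarrow> 'v::ab_group_add \<Rightarrow> 'v) \<Rightarrow> ('t \<Rightarrow> 'v \<Rightarrow> 'v) \<Rightarrow> ('t, 'v) lie_module"
  where "module_of s \<rho> = \<lparr>mcarrier = UNIV, madd = (+), mzero = 0, mscale = s, mact = \<rho>\<rparr>"

definition lie_submodule :: "'t lie_algebra \<Rightarrow> ('t, 'm) lie_module \<Rightarrow> 'm set \<Rightarrow> bool"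
  where "lie_submodule L M N \<longleftrightarrow> N \<subseteq> mcarrier M \<and> mzero M \<in> N \<and>
    (\<forall>v\<in>N. \<forall>w\<in>N. madd M v w \<in> N) \<and> (\<forall>c. \<forall>v\<in>N. mscale M c v \<in> N) \<and>
    (\<forall>x\<in>lcarrier L. \<forall>v\<in>N. mact M x v \<in> N)"

definition irreducible_module :: "'t lie_algebra \<Rightarrow> ('t, 'm) lie_module \<Rightarrow> bool"
  where "irreducible_module L M \<longleftrightarrow> mcarrier M \<noteq> {mzero M} \<and>
    (\<forall>N. lie_submodule L M N \<longrightarrow> N = {mzero M} \<or> N = mcarrier M)"

definition mcoset :: "('t, 'm) lie_module \<Rightarrow> 'm set \<Rightarrow> 'm \<Rightarrow> 'm set"
  where "mcoset M N v = madd M v ` N"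

definition quotient_module :: "('t, 'm) lie_module \<Rightarrow> 'm set \<Rightarrow> ('t, 'm set) lie_module"
  where "quotient_module M N =
    \<lparr>mcarrier = mcoset M N ` mcarrier M,
     madd = (\<lambda>A B. \<Union>v\<in>A. \<Union>w\<in>B. mcoset M N (madd M v w)),
     mzero = mcoset M N (mzero M),
     mscale = (\<lambda>c A. \<Union>v\<in>A. mcoset M N (mscale M c v)),
     mact = (\<lambda>x A. \<Union>v\<in>A. mcoset M N (mact M x v))\<rparr>"

definition module_iso :: "'t lie_algebra \<Rightarrow> ('t, 'm) lie_module \<Rightarrow> ('t, 'k) lie_module \<Rightarrow> bool"
  where "module_iso L M M' \<longleftrightarrow> (\<exists>f. bij_betw f (mcarrier M) (mcarrier M') \<and>
    (\<forall>v\<in>mcarrier M. \<forall>w\<in>mcarrier M. f (madd M v w) = madd M' (f v) (f w)) \<and>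
    (\<forall>c. \<forall>v\<in>mcarrier M. f (mscale M c v) = mscale M' c (f v)) \<and>
    (\<forall>x\<in>lcarrier L. \<forall>v\<in>mcarrier M. f (mact M x v) = mact M' x (f v)))"

definition irreducible_quotient_by ::
    "'t lie_algebra \<Rightarrow> ('t, 'm) lie_module \<Rightarrow> 'm set \<Rightarrow> bool"
  where "irreducible_quotient_by L M N \<longleftrightarrow>
    lie_submodule L M N \<and> irreducible_module L (quotient_module M N)"

text \<open>Meaningful only when \<open>irreducible_quotient_by L M\<close> holds for exactly one submodule.\<close>

definition irreducible_quotient ::
    "'t lie_algebra \<Rightarrow> ('t, 'm) lie_module \<Rightarrow> ('t, 'm set) lie_module"
  where "irreducible_quotient L M = quotient_module M (THE N. irreducible_quotient_by L M N)"

section \<open>Universal enveloping algebra and induced modules\<close>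

text \<open>Words form a monoid under concatenation, so \<open>'t word \<Rightarrow>\<^sub>0 complex\<close> with its convolution
  product is the free associative unital algebra on \<open>'t\<close>.\<close>

datatype 'a word = Word (letters: "'a list")

instantiation word :: (type) monoid_add
begin

definition zero_word_def: "0 = Word []"

definition plus_word_def: "u + v = Word (letters u @ letters v)"

instance by standard (auto simp: zero_word_def plus_word_def)

end

definition free_algebra :: "'t set \<Rightarrow> ('t word \<Rightarrow>\<^sub>0 complex) set"
  where "free_algebra A = {f. \<forall>w\<in>keys f. set (letters w) \<subseteq> A}"

definition gen :: "'t \<Rightarrow> ('t word \<Rightarrow>\<^sub>0 complex)"
  where "gen x = single (Word [x]) 1"

definition env_relations :: "'t::ab_group_add lie_algebra \<Rightarrow> ('t word \<Rightarrow>\<^sub>0 complex) set"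
  where "env_relations L =
    {gen (x + y) - gen x - gen y | x y. x \<in> lcarrier L \<and> y \<in> lcarrier L} \<union>
    {gen (lscale L c x) - pscale c (gen x) | c x. x \<in> lcarrier L} \<union>
    {gen x * gen y - gen y * gen x - gen (lbracket L x y) | x y. x \<in> lcarrier L \<and> y \<in> lcarrier L}"

definition env_ideal :: "'t::ab_group_add lie_algebra \<Rightarrow> ('t word \<Rightarrow>\<^sub>0 complex) set"
  where "env_ideal L = module.span pscale
    {a * r * b | a r b. a \<in> free_algebra (lcarrier L) \<and> r \<in> env_relations L \<and>
                        b \<in> free_algebra (lcarrier L)}"

definition env_class ::
    "'t::ab_group_add lie_algebra \<Rightarrow> ('t word \<Rightarrow>\<^sub>0 complex) \<Rightarrow> ('t word \<Rightarrow>\<^sub>0 complex) set"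
  where "env_class L = coset (env_ideal L)"

definition enveloping_algebra :: "'t::ab_group_add lie_algebra \<Rightarrow> ('t word \<Rightarrow>\<^sub>0 complex) set set"
  where "enveloping_algebra L = env_class L ` free_algebra (lcarrier L)"

definition env_add where "env_add L = lift2 (env_ideal L) (+)"

definition env_scale where "env_scale L c = lift1 (env_ideal L) (pscale c)"

definition env_mult where "env_mult L = lift2 (env_ideal L) (*)"

definition free_act ::
    "(complex \<Rightarrow> 'v::ab_group_add \<Rightarrow> 'v) \<Rightarrow> ('t \<Rightarrow> 'v \<Rightarrow> 'v) \<Rightarrow> ('t word \<Rightarrow>\<^sub>0 complex) \<Rightarrow> 'v \<Rightarrow> 'v"
  where "free_act s \<rho> f v = (\<Sum>w\<in>keys f. s (lookup f w) (foldr \<rho> (letters w) v))"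

text \<open>Relations defining \<open>U(L) \<otimes> S\<close> over \<open>U(B)\<close> as a quotient of the complex vector space with
  basis \<open>U(L) \<times> S\<close>, for a subalgebra \<open>B\<close> of \<open>L\<close> and a \<open>B\<close>-module \<open>S\<close>. An element of \<open>U(B)\<close> is
  given by a representative \<open>f\<close> in the free algebra on \<open>B\<close>; it acts on \<open>U(L)\<close> from the right
  through the canonical map from \<open>U(B)\<close> to \<open>U(L)\<close>, and on \<open>S\<close> by \<open>free_act\<close>.\<close>

definition tensor_relations ::
    "'t::ab_group_add lie_algebra \<Rightarrow> 't set \<Rightarrow> (complex \<Rightarrow> 'v::ab_group_add \<Rightarrow> 'v) \<Rightarrow>
     ('t \<Rightarrow> 'v \<Rightarrow> 'v) \<Rightarrow> 'v set \<Rightarrow> (('t word \<Rightarrow>\<^sub>0 complex) set \<times> 'v \<Rightarrow>\<^sub>0 complex) set"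
  where "tensor_relations L B s \<rho> S =
    {single (env_add L u u', v) 1 - single (u, v) 1 - single (u', v) 1 | u u' v.
       u \<in> enveloping_algebra L \<and> u' \<in> enveloping_algebra L \<and> v \<in> S} \<union>
    {single (u, v + v') 1 - single (u, v) 1 - single (u, v') 1 | u v v'.
       u \<in> enveloping_algebra L \<and> v \<in> S \<and> v' \<in> S} \<union>
    {single (env_scale L c u, v) 1 - single (u, v) c | c u v.
       u \<in> enveloping_algebra L \<and> v \<in> S} \<union>
    {single (env_mult L u (env_class L f), v) 1 - single (u, free_act s \<rho> f v) 1 | u f v.
       u \<in> enveloping_algebra L \<and> f \<in> free_algebra B \<and> v \<in> S}"

definition tensor_ideal where
  "tensor_ideal L B s \<rho> S = module.span pscale (tensor_relations L B s \<rho> S)"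

definition left_mult ::
    "'t::ab_group_add lie_algebra \<Rightarrow> 't \<Rightarrow> (('t word \<Rightarrow>\<^sub>0 complex) set \<times> 'v \<Rightarrow>\<^sub>0 complex) \<Rightarrow>
     (('t word \<Rightarrow>\<^sub>0 complex) set \<times> 'v \<Rightarrow>\<^sub>0 complex)"
  where "left_mult L x f =
    (\<Sum>(u, v)\<in>keys f. single (env_mult L (env_class L (gen x)) u, v) (lookup f (u, v)))"

definition induced_module ::
    "'t::ab_group_add lie_algebra \<Rightarrow> 't set \<Rightarrow> (complex \<Rightarrow> 'v::ab_group_add \<Rightarrow> 'v) \<Rightarrow>
     ('t \<Rightarrow> 'v \<Rightarrow> 'v) \<Rightarrow> 'v set \<Rightarrow>
     ('t, (('t word \<Rightarrow>\<^sub>0 complex) set \<times> 'v \<Rightarrow>\<^sub>0 complex) set) lie_module"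
  where "induced_module L B s \<rho> S =
    (let R = tensor_ideal L B s \<rho> S in
     \<lparr>mcarrier = coset R ` {f. keys f \<subseteq> enveloping_algebra L \<times> S},
      madd = lift2 R (+),
      mzero = coset R 0,
      mscale = (\<lambda>c. lift1 R (pscale c)),
      mact = (\<lambda>x. lift1 R (left_mult L x))\<rparr>)"

section \<open>The twisted full toroidal Lie algebra\<close>

text \<open>The finite type \<open>'n\<close> indexes \<open>1, \<dots>, n\<close>; in \<open>'n option\<close> the additional index \<open>0\<close> is \<open>None\<close>.
  An exponent \<open>(k\<^sub>0, k)\<close> is a function on \<open>'n option\<close>.

  The relations defining the space of symbols \<open>t\<^sup>r K\<^sub>i\<close> are homogeneous in \<open>r\<close>. So it suffices to
  form one quotient, over all exponents \<open>r\<close>; the space \<open>Z(m\<^sub>0, m)\<close> is its subspace spanned by the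
  symbols with \<open>r\<close> in \<open>\<Gamma>\<^sub>0 \<oplus> \<Gamma>\<close>.\<close>

type_synonym 'n exponent = "'n option \<Rightarrow> int"

type_synonym 'n symbols = "'n exponent \<times> 'n option \<Rightarrow>\<^sub>0 complex"

definition K_relation :: "'n::finite exponent \<Rightarrow> 'n symbols"
  where "K_relation r = (\<Sum>i\<in>UNIV. single (r, i) (of_int (r i)))"

definition K_relations :: "'n::finite symbols set"
  where "K_relations = module.span pscale (range K_relation)"

definition K_equiv :: "'n::finite symbols \<Rightarrow> 'n symbols \<Rightarrow> bool"
  where "K_equiv f g \<longleftrightarrow> f - g \<in> K_relations"

interpretation pm: vector_space pscale by (rule vector_space_pscale)

lemma subspace_K_relations: "module.subspace pscale K_relations"
  by (simp add: K_relations_def)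

lemmas K_relations_closed =
  pm.subspace_0 [OF subspace_K_relations] pm.subspace_add [OF subspace_K_relations]
  pm.subspace_neg [OF subspace_K_relations] pm.subspace_diff [OF subspace_K_relations]
  pm.subspace_scale [OF subspace_K_relations]

quotient_type (overloaded) 'n K_space = "'n::finite symbols" / K_equiv
proof (rule equivpI)
  show "reflp K_equiv" by (auto simp: reflp_def K_equiv_def K_relations_closed)
  show "symp (K_equiv :: 'n symbols \<Rightarrow> _)"
  proof (rule sympI)
    fix f g :: "'n symbols"
    assume "K_equiv f g"
    then have "- (f - g) \<in> K_relations"
      unfolding K_equiv_def by (rule K_relations_closed)
    then show "K_equiv g f" by (simp add: K_equiv_def)
  qed
  show "transp (K_equiv :: 'n symbols \<Rightarrow> _)"
  proof (rule transpI)
    fix f g h :: "'n symbols"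
    assume "K_equiv f g" "K_equiv g h"
    then have "(f - g) + (g - h) \<in> K_relations"
      unfolding K_equiv_def by (rule K_relations_closed)
    then show "K_equiv f h" by (simp add: K_equiv_def)
  qed
qed

instantiation K_space :: (finite) ab_group_add
begin

lift_definition zero_K_space :: "'a K_space" is 0 .

lift_definition plus_K_space :: "'a K_space \<Rightarrow> 'a K_space \<Rightarrow> 'a K_space" is "(+)"
proof -
  fix f g f' g' :: "'a symbols"
  assume "K_equiv f g" "K_equiv f' g'"
  then have "(f - g) + (f' - g') \<in> K_relations"
    unfolding K_equiv_def by (rule K_relations_closed)
  then show "K_equiv (f + f') (g + g')" by (simp add: K_equiv_def algebra_simps)
qed

lift_definition minus_K_space :: "'a K_space \<Rightarrow> 'a K_space \<Rightarrow> 'a K_space" is "(-)"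
proof -
  fix f g f' g' :: "'a symbols"
  assume "K_equiv f g" "K_equiv f' g'"
  then have "(f - g) - (f' - g') \<in> K_relations"
    unfolding K_equiv_def by (rule K_relations_closed)
  then show "K_equiv (f - f') (g - g')" by (simp add: K_equiv_def algebra_simps)
qed

lift_definition uminus_K_space :: "'a K_space \<Rightarrow> 'a K_space" is uminus
proof -
  fix f g :: "'a symbols"
  assume "K_equiv f g"
  then have "- (f - g) \<in> K_relations"
    unfolding K_equiv_def by (rule K_relations_closed)
  then show "K_equiv (- f) (- g)" by (simp add: K_equiv_def algebra_simps)
qed

instance
  by standard (transfer; simp add: K_equiv_def K_relations_closed algebra_simps)+

end

lift_definition K_scale :: "complex \<Rightarrow> 'n::finite K_space \<Rightarrow> 'n K_space" is pscale
  by (simp add: K_equiv_def K_relations_closed flip: pm.scale_right_diff_distrib)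

lift_definition K_symbol :: "'n::finite exponent \<Rightarrow> 'n option \<Rightarrow> 'n K_space"
  is "\<lambda>r i. single (r, i) 1" .

text \<open>The brackets are extended bilinearly from basis elements. An element of \<open>D(m\<^sub>0, m)\<close> is the
  family \<open>d\<close> of its coefficients \<open>d (r, a)\<close> at \<open>t\<^sup>r d\<^sub>a\<close>.\<close>

definition der_symbols :: "'n::finite symbols \<Rightarrow> 'n symbols \<Rightarrow> 'n symbols"
  where "der_symbols d f = (\<Sum>(r, a)\<in>keys d. \<Sum>(s, b)\<in>keys f.
    pscale (lookup d (r, a) * lookup f (s, b))
      (single (r + s, b) (of_int (s a)) +
       (if a = b then \<Sum>p\<in>UNIV. single (r + s, p) (of_int (r p)) else 0)))"

lemma der_symbols_superset:
  assumes "finite A" "keys f \<subseteq> A"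
  shows "der_symbols d f = (\<Sum>(r, a)\<in>keys d. \<Sum>(s, b)\<in>A.
    pscale (lookup d (r, a) * lookup f (s, b))
      (single (r + s, b) (of_int (s a)) +
       (if a = b then \<Sum>p\<in>UNIV. single (r + s, p) (of_int (r p)) else 0)))"
  unfolding der_symbols_def
  by (intro sum.cong refl prod.case_cong sum.mono_neutral_left)
     (use assms in \<open>auto simp: in_keys_iff\<close>)

lemma der_symbols_add: "der_symbols d (f + g) = der_symbols d f + der_symbols d g"
proof -
  have "finite (keys f \<union> keys g)" by simp
  note sup = der_symbols_superset [OF this]
  show ?thesis
    by (subst (1 2 3) sup)
       (use keys_add [of f g] in
         \<open>auto simp: sum.distrib [symmetric] lookup_add distrib_left pm.scale_left_distrib
           intro!: sum.cong\<close>)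
qed

lemma der_symbols_scale: "der_symbols d (pscale c f) = pscale c (der_symbols d f)"
proof -
  have *: "keys (pscale c f) \<subseteq> keys f" by (auto simp: in_keys_iff)
  show ?thesis
    by (subst der_symbols_superset [OF _ *], simp)
       (simp add: der_symbols_def pm.scale_sum_right split_def mult.left_commute)
qed

lemma der_symbols_single:
  "der_symbols d (single (s, b) c) = (\<Sum>(r, a)\<in>keys d. pscale (lookup d (r, a) * c)
      (single (r + s, b) (of_int (s a)) +
       (if a = b then \<Sum>p\<in>UNIV. single (r + s, p) (of_int (r p)) else 0)))"
  by (subst der_symbols_superset [of "{(s, b)}"]) (auto intro!: sum.cong)

lemma der_symbols_sum: "der_symbols d (sum f A) = (\<Sum>i\<in>A. der_symbols d (f i))"
proof (induction A rule: infinite_finite_induct)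
  case (insert x F)
  then show ?case by (simp add: der_symbols_add)
qed (simp_all add: der_symbols_def)

lemma der_symbols_K_relation:
  "der_symbols d (K_relation s) =
    (\<Sum>(r, a)\<in>keys d. pscale (lookup d (r, a) * of_int (s a)) (K_relation (r + s)))"
proof -
  have *: "(\<Sum>b\<in>UNIV. pscale (c * of_int (s b)) (single (r + s, b) (of_int (s a)) +
       (if a = b then \<Sum>p\<in>UNIV. single (r + s, p) (of_int (r p)) else 0))) =
     pscale (c * of_int (s a)) (K_relation (r + s))" (is "?L = ?R") for c :: complex and r a
  proof -
    let ?Y = "\<Sum>p\<in>UNIV. single (r + s, p) (of_int (r p))"
    have "?L = (\<Sum>b\<in>UNIV. single (r + s, b) (c * of_int (s b) * of_int (s a))) +
        (\<Sum>b\<in>UNIV. if a = b then pscale (c * of_int (s b)) ?Y else 0)"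
      unfolding sum.distrib [symmetric]
      by (intro sum.cong refl) (simp add: pm.scale_right_distrib)
    also have "(\<Sum>b\<in>UNIV. if a = b then pscale (c * of_int (s b)) ?Y else 0) =
        (\<Sum>b\<in>UNIV. single (r + s, b) (c * of_int (s a) * of_int (r b)))"
      by (simp add: pm.scale_sum_right)
    also have "(\<Sum>b\<in>UNIV. single (r + s, b) (c * of_int (s b) * of_int (s a))) + \<dots> = ?R"
      unfolding K_relation_def pm.scale_sum_right sum.distrib [symmetric]
      by (intro sum.cong refl) (simp add: single_add [symmetric] algebra_simps)
    finally show ?thesis .
  qed
  show ?thesis
    unfolding K_relation_def [of s] der_symbols_sum der_symbols_single
    by (subst sum.swap) (simp add: split_def *)
qed

lemma der_symbols_closed:
  assumes "f \<in> K_relations" shows "der_symbols d f \<in> K_relations"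
  using assms unfolding K_relations_def
proof (induction rule: pm.span_induct_alt)
  case base
  then show ?case by (simp add: der_symbols_def pm.span_zero)
next
  case (step c x y)
  then obtain s where x: "x = K_relation s" by auto
  have "der_symbols d x \<in> pm.span (range K_relation)"
    unfolding x der_symbols_K_relation split_def
    by (intro pm.span_sum pm.span_scale) (simp add: pm.span_base)
  with step show ?case
    by (auto simp: der_symbols_add der_symbols_scale intro!: pm.span_add pm.span_scale)
qed

lift_definition der_K :: "'n::finite symbols \<Rightarrow> 'n K_space \<Rightarrow> 'n K_space" is der_symbols
proof -
  fix d f g :: "'n symbols"
  assume "K_equiv f g"
  then have "der_symbols d (f - g) \<in> K_relations"
    by (simp add: K_equiv_def der_symbols_closed)
  moreover have "der_symbols d (f - g) = der_symbols d f - der_symbols d g"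
    by (metis add_diff_cancel_right' der_symbols_add diff_add_cancel)
  ultimately show "K_equiv (der_symbols d f) (der_symbols d g)"
    by (simp add: K_equiv_def)
qed

definition der_der :: "'n::finite symbols \<Rightarrow> 'n symbols \<Rightarrow> 'n symbols"
  where "der_der d e = (\<Sum>(r, a)\<in>keys d. \<Sum>(s, b)\<in>keys e.
    pscale (lookup d (r, a) * lookup e (s, b))
      (single (r + s, b) (of_int (s a)) - single (r + s, a) (of_int (r b))))"

text \<open>The cocycle \<open>c1 \<phi>\<^sub>1 + c2 \<phi>\<^sub>2\<close>.\<close>

definition der_cocycle :: "complex \<Rightarrow> complex \<Rightarrow> 'n::finite symbols \<Rightarrow> 'n symbols \<Rightarrow> 'n K_space"
  where "der_cocycle c1 c2 d e = (\<Sum>(r, a)\<in>keys d. \<Sum>(s, b)\<in>keys e.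
    K_scale (lookup d (r, a) * lookup e (s, b) *
        (c1 * of_int (- (s a) * r b) + c2 * of_int (r a * s b)))
      (\<Sum>p\<in>UNIV. K_scale (of_int (r p)) (K_symbol (r + s) p)))"

definition loop_bracket ::
    "'g::ab_group_add lie_algebra \<Rightarrow> ('n exponent \<Rightarrow>\<^sub>0 'g) \<Rightarrow> ('n exponent \<Rightarrow>\<^sub>0 'g) \<Rightarrow> ('n exponent \<Rightarrow>\<^sub>0 'g)"
  where "loop_bracket L x y =
    (\<Sum>k\<in>keys x. \<Sum>l\<in>keys y. single (k + l) (lbracket L (lookup x k) (lookup y l)))"

definition loop_cocycle ::
    "('g::ab_group_add \<Rightarrow> 'g \<Rightarrow> complex) \<Rightarrow> ('n::finite exponent \<Rightarrow>\<^sub>0 'g) \<Rightarrow> ('n exponent \<Rightarrow>\<^sub>0 'g) \<Rightarrow> 'n K_space"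
  where "loop_cocycle B x y = (\<Sum>k\<in>keys x. \<Sum>l\<in>keys y.
    K_scale (B (lookup x k) (lookup y l))
      (\<Sum>i\<in>UNIV. K_scale (of_int (k i)) (K_symbol (k + l) i)))"

definition der_loop ::
    "'g::ab_group_add lie_algebra \<Rightarrow> 'n symbols \<Rightarrow> ('n exponent \<Rightarrow>\<^sub>0 'g) \<Rightarrow> ('n exponent \<Rightarrow>\<^sub>0 'g)"
  where "der_loop L d x = (\<Sum>(r, a)\<in>keys d. \<Sum>k\<in>keys x.
    single (k + r) (lscale L (lookup d (r, a) * of_int (k a)) (lookup x k)))"

type_synonym ('n, 'g) toroidal =
  "('n exponent \<Rightarrow>\<^sub>0 'g) \<times> 'n K_space \<times> 'n symbols"

text \<open>\<open>aut i\<close>, \<open>ord i\<close>, \<open>unity i\<close> are \<open>\<sigma>\<^sub>i\<close>, \<open>m\<^sub>i\<close>, \<open>\<xi>\<^sub>i\<close>; \<open>csa0\<close> and \<open>csa\<close> are the two Cartan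
  subalgebras; \<open>brank\<close> is the rank at which type B starts.\<close>

record ('n, 'g) toroidal_data =
  fin_alg :: "'g lie_algebra"
  form :: "'g \<Rightarrow> 'g \<Rightarrow> complex"
  aut :: "'n option \<Rightarrow> 'g \<Rightarrow> 'g"
  ord :: "'n option \<Rightarrow> nat"
  unity :: "'n option \<Rightarrow> complex"
  coc1 :: complex
  coc2 :: complex
  csa0 :: "'g set"
  csa :: "'g set"
  brank :: nat
  pos :: "('g \<Rightarrow> complex) set"

definition graded_part :: "('n, 'g) toroidal_data \<Rightarrow> 'n exponent \<Rightarrow> 'g set"
  where "graded_part D k = {x\<in>lcarrier (fin_alg D).
    \<forall>i. aut D i x = lscale (fin_alg D) (unity D i powi k i) x}"

definition fixed_alg :: "('n, 'g) toroidal_data \<Rightarrow> 'g lie_algebra"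
  where "fixed_alg D = (fin_alg D)\<lparr>lcarrier := graded_part D 0\<rparr>"

definition nonzero_roots0 :: "('n, 'g::ab_group_add) toroidal_data \<Rightarrow> ('g \<Rightarrow> complex) set"
  where "nonzero_roots0 D = weights (fixed_alg D) (csa0 D) - {0}"

definition roots_en :: "('n, 'g::ab_group_add) toroidal_data \<Rightarrow> ('g \<Rightarrow> complex) set"
  where "roots_en D = insert 0 (enlarged_roots (brank D) (csa0 D) (nonzero_roots0 D))"

text \<open>\<open>brank\<close> is unconstrained in \<open>{1, 2}\<close>: whether a root system of type \<open>A\<^sub>1\<close> is also counted as
  \<open>B\<^sub>1\<close> is a matter of convention.\<close>

definition toroidal_datum :: "('n::finite, 'g::ab_group_add) toroidal_data \<Rightarrow> bool"
  where "toroidal_datum D \<longleftrightarrow> (let L = fin_alg D; G = lcarrier L in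
    simple_lie L \<and> fin_dim (lscale L) G \<and> invariant_form L (form D) \<and>
    (\<forall>i. lie_automorphism L (aut D i)) \<and>
    (\<forall>i j. \<forall>x\<in>G. aut D i (aut D j x) = aut D j (aut D i x)) \<and>
    (\<forall>i. 0 < ord D i \<and> (\<forall>x\<in>G. (aut D i ^^ ord D i) x = x) \<and>
         (\<forall>q. 0 < q \<and> q < ord D i \<longrightarrow> (\<exists>x\<in>G. (aut D i ^^ q) x \<noteq> x))) \<and>
    (\<forall>i. unity D i ^ ord D i = 1 \<and>
         (\<forall>q. 0 < q \<and> q < ord D i \<longrightarrow> unity D i ^ q \<noteq> 1)) \<and>
    simple_lie (fixed_alg D) \<and>
    cartan_subalgebra (fixed_alg D) (csa0 D) \<and> cartan_subalgebra L (csa D) \<and>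
    csa0 D \<subseteq> csa D \<and>
    brank D \<in> {1, 2} \<and>
    weights L (csa0 D) = roots_en D \<and>
    positive_roots (roots_en D - {0}) (pos D))"

definition Gam :: "('n, 'g) toroidal_data \<Rightarrow> 'n exponent set"
  where "Gam D = {r. \<forall>i. int (ord D i) dvd r i}"

definition tau :: "('n::finite, 'g::ab_group_add) toroidal_data \<Rightarrow> ('n, 'g) toroidal lie_algebra"
  where "tau D = \<lparr>
    lcarrier = {x. \<forall>k. lookup x k \<in> graded_part D k} \<times>
               module.span K_scale {K_symbol r i | r i. r \<in> Gam D} \<times>
               {d. keys d \<subseteq> Gam D \<times> UNIV},
    lscale = (\<lambda>c (x, z, d). (Poly_Mapping.map (lscale (fin_alg D) c) x, K_scale c z, pscale c d)),
    lbracket = (\<lambda>(x, z, d) (y, w, e).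
      (loop_bracket (fin_alg D) x y + der_loop (fin_alg D) d y - der_loop (fin_alg D) e x,
       loop_cocycle (form D) x y + der_K d w - der_K e z + der_cocycle (coc1 D) (coc2 D) d e,
       der_der d e))\<rparr>"

definition d_elt :: "'n option \<Rightarrow> ('n::finite, 'g::ab_group_add) toroidal"
  where "d_elt i = (0, 0, single (0, i) 1)"

definition K_elt :: "'n option \<Rightarrow> ('n::finite, 'g::ab_group_add) toroidal"
  where "K_elt i = (0, K_symbol 0 i, 0)"

definition g_elt :: "'g \<Rightarrow> ('n::finite, 'g::ab_group_add) toroidal"
  where "g_elt x = (single 0 x, 0, 0)"

subsection \<open>Triangular decompositions\<close>

definition tau_deg ::
    "('n::finite, 'g::ab_group_add) toroidal_data \<Rightarrow> real \<Rightarrow> ('n, 'g) toroidal set"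
  where "tau_deg D q = {X\<in>lcarrier (tau D).
    lbracket (tau D) (d_elt None) X = lscale (tau D) (of_real q) X}"

definition tau_plus :: "('n::finite, 'g::ab_group_add) toroidal_data \<Rightarrow> ('n, 'g) toroidal set"
  where "tau_plus D = module.span (lscale (tau D)) (\<Union>q\<in>{0<..}. tau_deg D q)"

definition tau_zero :: "('n::finite, 'g::ab_group_add) toroidal_data \<Rightarrow> ('n, 'g) toroidal set"
  where "tau_zero D = tau_deg D 0"

definition root_space :: "('n::finite, 'g::ab_group_add) toroidal_data \<Rightarrow>
    ('g \<Rightarrow> complex) \<Rightarrow> 'n exponent \<Rightarrow> ('n, 'g) toroidal set"
  where "root_space D \<alpha> k = {X\<in>lcarrier (tau D).
    (\<forall>h\<in>csa0 D. lbracket (tau D) (g_elt h) X = lscale (tau D) (\<alpha> h) X) \<and>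
    (\<forall>i. lbracket (tau D) (d_elt i) X = lscale (tau D) (of_int (k i)) X)}"

definition tau_up :: "('n::finite, 'g::ab_group_add) toroidal_data \<Rightarrow> ('n, 'g) toroidal set"
  where "tau_up D = module.span (lscale (tau D))
    (\<Union>{root_space D \<alpha> k | \<alpha> k. \<alpha> \<in> roots_en D \<and> (0 < k None \<or> k None = 0 \<and> \<alpha> \<in> pos D)})"

definition tau_mid :: "('n::finite, 'g::ab_group_add) toroidal_data \<Rightarrow> ('n, 'g) toroidal set"
  where "tau_mid D = module.span (lscale (tau D)) (\<Union>{root_space D 0 k | k. k None = 0})"

definition subspace_sum :: "'a::ab_group_add set \<Rightarrow> 'a set \<Rightarrow> 'a set"
  where "subspace_sum A B = {x + y | x y. x \<in> A \<and> y \<in> B}"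

definition annihilated :: "('t \<Rightarrow> 'v::zero \<Rightarrow> 'v) \<Rightarrow> 't set \<Rightarrow> 'v set"
  where "annihilated \<rho> A = {v. \<forall>x\<in>A. \<rho> x v = 0}"

subsection \<open>The category \<open>B\<^sub>\<psi>\<close>\<close>

definition d_weight_space ::
    "(complex \<Rightarrow> 'v \<Rightarrow> 'v) \<Rightarrow> (('n::finite, 'g::ab_group_add) toroidal \<Rightarrow> 'v \<Rightarrow> 'v) \<Rightarrow>
     ('n option \<Rightarrow> complex) \<Rightarrow> 'v set"
  where "d_weight_space s \<rho> \<mu> = {v. \<forall>i. \<rho> (d_elt i) v = s (\<mu> i) v}"

definition in_category_B ::
    "('n::finite, 'g::ab_group_add) toroidal_data \<Rightarrow> (('n, 'g) toroidal \<Rightarrow> complex) \<Rightarrow>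
     (complex \<Rightarrow> 'v::ab_group_add \<Rightarrow> 'v) \<Rightarrow> (('n, 'g) toroidal \<Rightarrow> 'v \<Rightarrow> 'v) \<Rightarrow> bool"
  where "in_category_B D \<psi> s \<rho> \<longleftrightarrow> lie_representation (tau D) s \<rho> \<and>
    module.span s (\<Union>\<mu>. d_weight_space s \<rho> \<mu>) = UNIV \<and>
    (\<forall>\<mu>. fin_dim s (d_weight_space s \<rho> \<mu>)) \<and>
    (\<forall>i v. \<rho> (K_elt i) v = s (\<psi> (K_elt i)) v) \<and>
    (\<exists>b. \<forall>a v. v \<noteq> 0 \<and> \<rho> (d_elt None) v = s a v \<longrightarrow> Re a \<le> b)"

end

theory Submission
  imports Defs "HOL-Computational_Algebra.Fundamental_Theorem_Algebra"
begin

text \<open>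
  Both halves of the theorem are instances of one statement about a Lie algebra \<open>L\<close> that is spanned
  by eigenvectors of \<open>ad e\<close> with real eigenvalues, for some \<open>e\<close> in \<open>L\<close>. Let \<open>V\<close> be an irreducible
  \<open>L\<close>-module that contains an eigenvector of \<open>e\<close> killed by the positive part of \<open>L\<close>. Since products of
  elements of non-positive degree generate \<open>V\<close> from this vector, the real parts of the eigenvalues of
  \<open>e\<close> on \<open>V\<close> have a maximum, and the space \<open>S\<close> of all vectors killed by the positive part is the
  eigenspace that belongs to it (\<open>highest_component\<close>). The module \<open>M\<close> induced from \<open>S\<close> is the sum of
  the copy \<open>1 \<otimes> S\<close> of \<open>S\<close> and of eigenvectors with strictly lower eigenvalues (\<open>top_plus_lower\<close>), and
  \<open>u \<otimes> v \<mapsto> u v\<close> maps \<open>M\<close> onto \<open>V\<close> and \<open>1 \<otimes> S\<close> bijectively onto \<open>S\<close>. A submodule of \<open>M\<close> contains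
  the homogeneous components of its elements. If its image is not zero, then the image is \<open>V\<close>, so that
  the submodule contains \<open>1 \<otimes> S\<close>, which generates \<open>M\<close>. Hence the kernel of \<open>M \<rightarrow> V\<close> is the largest
  proper submodule, and \<open>V\<close> is the only irreducible quotient of \<open>M\<close>
  (\<open>induced_from_highest_component\<close>).

  For \<open>S\<close> and \<open>M'(S)\<close> one takes \<open>e = d\<^sub>0\<close>. For \<open>T\<close> and \<open>M(T)\<close> one takes \<open>e = d\<^sub>0 + h\<close> with a small
  dominant regular \<open>h\<close> in the Cartan subalgebra (\<open>root_grading\<close>). It remains to find the required
  eigenvectors in \<open>V\<close>. For \<open>d\<^sub>0\<close> this is immediate, because the real parts of its eigenvalues are
  bounded above. For \<open>d\<^sub>0 + h\<close> the set of eigenvalues of \<open>h\<close> on the top of \<open>V\<close> has to be bounded too,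
  and here \<open>C\<^sub>0 \<noteq> 0\<close> enters. The operators \<open>t\<^sup>r K\<^sub>0\<close> with \<open>r\<close> on a coordinate axis and \<open>r\<^sub>0 = 0\<close> commute
  with \<open>h\<close>. They are injective (\<open>z_injective\<close>): otherwise they would be locally nilpotent, and vectors of
  the form \<open>t\<^sub>0\<^sup>-\<^sup>m t\<^sup>k K\<^sub>a w\<close> would give more linearly independent elements of a weight space than
  its dimension allows. So the eigenvalues of \<open>h\<close> on the top weight spaces are periodic with
  respect to the lattice \<open>Gam\<close>, and there are only finitely many of them.

  That the brackets stay in \<open>tau\<close> at all rests on the invariance of the given form on the simple Lie
  algebra under automorphisms; the form is shown to be a multiple of the Killing form
  (\<open>killing_multiple_of_form\<close>).
\<close>

section \<open>Eigenvectors of operators on subspaces\<close>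

definition linear_endo_on :: "(complex \<Rightarrow> 'b::ab_group_add \<Rightarrow> 'b) \<Rightarrow> 'b set \<Rightarrow> ('b \<Rightarrow> 'b) \<Rightarrow> bool"
  where "linear_endo_on sc W f \<longleftrightarrow> f ` W \<subseteq> W \<and>
    (\<forall>x\<in>W. \<forall>y\<in>W. f (x + y) = f x + f y) \<and> (\<forall>c. \<forall>x\<in>W. f (sc c x) = sc c (f x))"

text \<open>The eigenspace modulo \<open>R\<close>; for \<open>R = {0}\<close> it is the usual eigenspace.\<close>

definition eig :: "(complex \<Rightarrow> 'b::ab_group_add \<Rightarrow> 'b) \<Rightarrow> 'b set \<Rightarrow> 'b set \<Rightarrow> ('b \<Rightarrow> 'b) \<Rightarrow> complex \<Rightarrow> 'b set"
  where "eig sc W R f c = {x\<in>W. f x - sc c x \<in> R}"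

locale complex_space = vector_space scale
  for scale :: "complex \<Rightarrow> 'b::ab_group_add \<Rightarrow> 'b" (infixr "*s" 75)
begin

lemma linear_endo_on_subset:
  assumes "linear_endo_on (*s) W f" "N \<subseteq> W" "f ` N \<subseteq> N"
  shows "linear_endo_on (*s) N f"
  using assms unfolding linear_endo_on_def by blast

context
  fixes W f
  assumes W: "subspace W" and f: "linear_endo_on (*s) W f"
begin

lemma endo_mem: "x \<in> W \<Longrightarrow> f x \<in> W"
  and endo_add: "x \<in> W \<Longrightarrow> y \<in> W \<Longrightarrow> f (x + y) = f x + f y"
  and endo_scale: "x \<in> W \<Longrightarrow> f (c *s x) = c *s f x"
  using f unfolding linear_endo_on_def by auto

lemma endo_0: "f 0 = 0"
  using endo_scale[OF subspace_0[OF W], of 0] by simp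

lemma endo_sum: "(\<And>i. i \<in> I \<Longrightarrow> g i \<in> W) \<Longrightarrow> f (sum g I) = (\<Sum>i\<in>I. f (g i))"
proof (induction I rule: infinite_finite_induct)
  case (insert x F)
  then show ?case
    by (simp add: endo_add subspace_sum[OF W])
qed (simp_all add: endo_0)

lemma endo_diff: "x \<in> W \<Longrightarrow> y \<in> W \<Longrightarrow> f (x - y) = f x - f y"
  using endo_add[of "x - y" y] subspace_diff[OF W, of x y] by (simp add: algebra_simps)

lemma funpow_mem: "x \<in> W \<Longrightarrow> (f ^^ n) x \<in> W"
  by (induction n) (auto intro: endo_mem)

lemma funpow_endo: "linear_endo_on (*s) W (f ^^ n)"
proof (induction n)
  case (Suc n)
  then show ?case
    using funpow_mem by (auto simp: linear_endo_on_def endo_add endo_scale endo_mem)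
qed (auto simp: linear_endo_on_def)

lemma subspace_eig: "subspace R \<Longrightarrow> subspace (eig (*s) W R f c)"
  unfolding eig_def
proof (rule subspaceI, goal_cases)
  case 1
  then show ?case by (simp add: subspace_0 W endo_0)
next
  case (2 x y)
  then have "f x - c *s x + (f y - c *s y) \<in> R" by (auto intro: subspace_add)
  with 2 show ?case by (simp add: subspace_add[OF W] endo_add algebra_simps)
next
  case (3 d x)
  then have "d *s (f x - c *s x) \<in> R" by (auto intro: subspace_scale)
  with 3 show ?case by (simp add: subspace_scale[OF W] endo_scale algebra_simps)
qed

text \<open>Applying \<open>f - c\<^sub>0\<close> removes the \<open>c\<^sub>0\<close>-component and multiplies the others by non-zero
  scalars, so that an induction on the number of components applies.\<close>

lemma eigen_components:
  assumes R: "subspace R" and N: "subspace N" "R \<subseteq> N" "f ` N \<subseteq> N"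
    and "finite C" "\<And>c. c \<in> C \<Longrightarrow> g c \<in> eig (*s) W R f c" "sum g C \<in> N" "c \<in> C"
  shows "g c \<in> N"
  using assms(5-)
proof (induction C arbitrary: g c rule: finite_induct)
  case (insert c0 C)
  have gW: "g c \<in> W" and gR: "f (g c) - c *s g c \<in> R" if "c \<in> insert c0 C" for c
    using insert.prems(1)[OF that] by (auto simp: eig_def)
  let ?v = "sum g (insert c0 C)"
  let ?r = "\<Sum>c\<in>insert c0 C. f (g c) - c *s g c"
  have "?r \<in> N" using gR N(2) by (intro subspace_sum N) auto
  moreover have "f ?v - c0 *s ?v \<in> N" using insert.prems(2) N by (intro subspace_diff subspace_scale) auto
  moreover have "f ?v - c0 *s ?v - ?r = (\<Sum>c\<in>insert c0 C. (c - c0) *s g c)"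
    using gW by (simp only: endo_sum scale_sum_right sum_subtractf[symmetric])
      (simp add: algebra_simps)
  ultimately have "(\<Sum>c\<in>insert c0 C. (c - c0) *s g c) \<in> N"
    using subspace_diff[OF N(1)] by metis
  then have sumN: "(\<Sum>c\<in>C. (c - c0) *s g c) \<in> N"
    using insert.hyps by simp
  have eigC: "(c - c0) *s g c \<in> eig (*s) W R f c" if "c \<in> C" for c
    using subspace_eig[OF R] insert.prems(1) that by (auto intro: subspace_scale)
  have inN: "g c \<in> N" if "c \<in> C" for c
  proof -
    have "(c - c0) *s g c \<in> N"
      using insert.IH[of "\<lambda>c. (c - c0) *s g c" c, OF eigC sumN that] .
    then have "(1 / (c - c0)) *s ((c - c0) *s g c) \<in> N" by (rule subspace_scale[OF N(1)])
    moreover have "c \<noteq> c0" using that insert.hyps by auto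
    ultimately show ?thesis by simp
  qed
  then have "sum g C \<in> N" by (intro subspace_sum N)
  then have "?v - sum g C \<in> N" using insert.prems(2) by (intro subspace_diff N)
  then have "g c0 \<in> N" using insert.hyps by simp
  with inN insert.prems(3) show ?case by auto
qed simp

lemma span_eig_sum:
  assumes R: "subspace R" and "x \<in> span (\<Union>c\<in>Q. eig (*s) W R f c)"
  obtains C g where "finite C" "C \<subseteq> Q" "\<And>c. c \<in> C \<Longrightarrow> g c \<in> eig (*s) W R f c" "x = sum g C"
proof -
  from assms(2) have "\<exists>C g. finite C \<and> C \<subseteq> Q \<and> (\<forall>c\<in>C. g c \<in> eig (*s) W R f c) \<and> x = sum g C"
  proof (induction rule: span_induct_alt)
    case base
    show ?case by (intro exI[of _ "{}"]) auto
  next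
    case (step a x y)
    from step obtain C g where C: "finite C" "C \<subseteq> Q" "\<forall>c\<in>C. g c \<in> eig (*s) W R f c" "y = sum g C"
      by blast
    from step obtain c where c: "c \<in> Q" "x \<in> eig (*s) W R f c" by blast
    let ?g = "\<lambda>b. (if b = c then a *s x else 0) + (if b \<in> C then g b else 0)"
    have "?g b \<in> eig (*s) W R f b" if "b \<in> insert c C" for b
      using that C c by (intro subspace_add subspace_eig R)
        (auto intro: subspace_scale subspace_0 subspace_eig R)
    moreover have "sum ?g (insert c C) = a *s x + y"
    proof -
      have "(\<Sum>b\<in>insert c C. if b \<in> C then g b else 0) = sum g C"
        using C(1) by (intro sum.mono_neutral_cong_right) auto
      then show ?thesis using C by (simp add: sum.distrib)
    qed
    ultimately show ?case using C c
      by (intro exI[of _ "insert c C"] exI[of _ ?g]) auto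
  qed
  with that show ?thesis by blast
qed

text \<open>If \<open>d\<close> were a further eigenvalue, then \<open>u\<close> and its components would be a relation between
  eigenvectors for distinct eigenvalues.\<close>

lemma eigenvalue_of_span:
  assumes u: "u \<in> span (\<Union>c\<in>Q. eig (*s) W {0} f c)" "u \<noteq> 0" "f u = d *s u"
  shows "d \<in> Q"
proof (rule ccontr)
  assume not: "d \<notin> Q"
  obtain C g where C: "finite C" "C \<subseteq> Q" "\<And>c. c \<in> C \<Longrightarrow> g c \<in> eig (*s) W {0} f c" "u = sum g C"
    using span_eig_sum[OF subspace_single_0 u(1)] by blast
  have uW: "u \<in> W" unfolding C(4) using C(3) by (intro subspace_sum[OF W]) (auto simp: eig_def)
  let ?g = "\<lambda>c. if c = d then - u else g c"
  have d: "d \<notin> C" using not C(2) by blast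
  then have "sum ?g C = sum g C" by (intro sum.cong) auto
  then have sum: "sum ?g (insert d C) \<in> {0}" using d C(1,4) by simp
  have "f (- u) = - f u" using endo_scale[OF uW, of "-1"] by simp
  then have eigs: "?g c \<in> eig (*s) W {0} f c" if "c \<in> insert d C" for c
    using that C(3) u(3) uW subspace_neg[OF W] by (auto simp: eig_def)
  have "?g d \<in> {0}"
    by (rule eigen_components[where C = "insert d C" and g = ?g, OF subspace_single_0 subspace_single_0 order_refl _ _ eigs sum])
      (use C(1) in \<open>auto simp: endo_0\<close>)
  with u(2) show False by simp
qed

text \<open>The eigencomponents of an element of an invariant subspace lie in this subspace.\<close>

lemma invariant_subspace_diagonalisable:
  assumes N: "subspace N" "N \<subseteq> W" "f ` N \<subseteq> N" and "W \<subseteq> span {x\<in>W. \<exists>c. f x = c *s x}"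
  shows "N \<subseteq> span {x\<in>N. \<exists>c. f x = c *s x}"
proof
  fix x assume x: "x \<in> N"
  have *: "{x\<in>W. \<exists>c. f x = c *s x} = (\<Union>c\<in>UNIV. eig (*s) W {0} f c)"
    by (auto simp: eig_def)
  have "x \<in> span (\<Union>c\<in>UNIV. eig (*s) W {0} f c)" using x N assms(4) unfolding * by auto
  then obtain C g where C: "finite C" "\<And>c. c \<in> C \<Longrightarrow> g c \<in> eig (*s) W {0} f c" "x = sum g C"
    using span_eig_sum[of "{0}"] by (metis subspace_single_0)
  have "g c \<in> N" if "c \<in> C" for c
    using eigen_components[of "{0}" N C g c] C N x that subspace_0[OF N(1)] by auto
  then show "x \<in> span {x\<in>N. \<exists>c. f x = c *s x}"
    unfolding C(3) using C(2) by (intro span_sum span_base) (auto simp: eig_def)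
qed

end

text \<open>Repetitions in the family are allowed: two equal members are a dependence as well.\<close>

lemma linearly_dependent_family:
  assumes "finite B" "\<And>i. i \<le> card B \<Longrightarrow> v i \<in> span B"
  shows "\<exists>c. (\<exists>i\<le>card B. c i \<noteq> 0) \<and> (\<Sum>i\<le>card B. c i *s v i) = 0"
proof (cases "inj_on v {..card B}")
  case True
  then have "card (v ` {..card B}) = Suc (card B)" by (simp add: card_image)
  moreover have "v ` {..card B} \<subseteq> span B" using assms(2) by blast
  ultimately have "dependent (v ` {..card B})"
    using independent_span_bound[OF assms(1), of "v ` {..card B}"] by (metis Suc_n_not_le_n)
  moreover have "finite (v ` {..card B})" by simp
  ultimately obtain u x where u: "x \<in> v ` {..card B}" "u x \<noteq> 0" "(\<Sum>x\<in>v ` {..card B}. u x *s x) = 0"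
    using dependent_finite[of "v ` {..card B}"] by blast
  have "(\<Sum>i\<le>card B. u (v i) *s v i) = 0"
    using u(3) unfolding sum.reindex[OF True] by (simp only: o_def)
  moreover obtain i where "i \<le> card B" "x = v i" using u(1) by auto
  ultimately show ?thesis using u(2) by (intro exI[of _ "\<lambda>i. u (v i)"]) auto
next
  case False
  then obtain i j where ij: "i \<le> card B" "j \<le> card B" "i \<noteq> j" "v i = v j"
    by (auto simp: inj_on_def)
  let ?c = "\<lambda>k. (if k = i then 1 else 0) - (if k = j then 1 else (0::complex))"
  have "(\<Sum>k\<le>card B. ?c k *s v k) = (\<Sum>k\<le>card B. if k = i then v k else 0) - (\<Sum>k\<le>card B. if k = j then v k else 0)"
    unfolding sum_subtractf[symmetric] by (intro sum.cong refl) (auto simp: scale_left_diff_distrib)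
  also have "\<dots> = v i - v j"
    using ij(1,2) unfolding sum.delta[OF finite_atMost] by simp
  also have "\<dots> = 0" using ij(4) by simp
  finally show ?thesis using ij(1,3) by (intro exI[of _ ?c]) auto
qed

lemma finite_eigenvalues:
  assumes W: "subspace W" and f: "linear_endo_on (*s) W f" and B: "finite B" "W \<subseteq> span B"
  shows "finite {c. \<exists>v\<in>W. v \<noteq> 0 \<and> f v = c *s v}" (is "finite ?E")
proof -
  have "card C \<le> card B" if C: "C \<subseteq> ?E" "finite C" for C
  proof (rule ccontr)
    assume "\<not> card C \<le> card B"
    then obtain C' where C': "C' \<subseteq> C" "card C' = Suc (card B)" "finite C'"
      using obtain_subset_with_card_n[of "Suc (card B)" C] by (metis not_less_eq_eq)
    obtain h where h: "bij_betw h {..card B} C'"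
      using C' by (metis finite_same_card_bij card_atMost finite_atMost)
    have "\<forall>c\<in>C'. \<exists>v. v \<in> W \<and> v \<noteq> 0 \<and> f v = c *s v" using C C' by blast
    then obtain v where v: "\<And>c. c \<in> C' \<Longrightarrow> v c \<in> W \<and> v c \<noteq> 0 \<and> f (v c) = c *s v c" by metis
    have "v (h i) \<in> span B" if "i \<le> card B" for i
      using v[of "h i"] that h B by (auto simp: bij_betw_def)
    then obtain a i where a: "i \<le> card B" "a i \<noteq> 0" "(\<Sum>i\<le>card B. a i *s v (h i)) = 0"
      using linearly_dependent_family[OF B(1), of "\<lambda>i. v (h i)"] by blast
    let ?k = "inv_into {..card B} h"
    have k: "?k (h i) = i" if "i \<le> card B" for i
      using h that by (auto simp: bij_betw_def)
    let ?g = "\<lambda>c. a (?k c) *s v c"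
    have "sum ?g C' = (\<Sum>i\<le>card B. a i *s v (h i))"
      using sum.reindex_bij_betw[OF h, of ?g] k by (auto intro!: sum.cong)
    then have "sum ?g C' \<in> {0}" using a by simp
    moreover have "?g c \<in> eig (*s) W {0} f c" if "c \<in> C'" for c
      using v[OF that] by (simp add: eig_def subspace_scale[OF W] endo_scale[OF W f] mult.commute)
    moreover have "h i \<in> C'" using h a by (auto simp: bij_betw_def)
    ultimately have "?g (h i) \<in> {0}"
      using W f C' by (intro eigen_components[of W f "{0}" "{0}" C' ?g "h i"])
         (auto simp: endo_0)
    with a v[of "h i"] \<open>h i \<in> C'\<close> k show False by auto
  qed
  then show ?thesis using finite_if_finite_subsets_card_bdd[of ?E "card B"] by blast
qed

text \<open>The image of a basis is independent and has as many elements as the basis.\<close>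

lemma injective_endo_surjective:
  assumes W: "subspace W" and f: "linear_endo_on (*s) W f" and B: "finite B" "W \<subseteq> span B"
    and inj: "\<And>x. x \<in> W \<Longrightarrow> f x = 0 \<Longrightarrow> x = 0"
  shows "f ` W = W"
proof -
  obtain C where C: "C \<subseteq> W" "independent C" "W \<subseteq> span C" using maximal_independent_subset by blast
  have fin: "finite C" using independent_span_bound[OF B(1) C(2)] C(1) B(2) by blast
  have spanC: "span C = W" using C W by (metis span_subspace)
  have inj': "inj_on f C"
  proof (rule inj_onI)
    fix x y assume xy: "x \<in> C" "y \<in> C" "f x = f y"
    then have "x \<in> W" "y \<in> W" using C by auto
    with xy have "f (x - y) = 0" "x - y \<in> W" by (simp_all add: endo_diff[OF W f] subspace_diff[OF W])
    then show "x = y" using inj by force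
  qed
  have "independent (f ` C)"
    unfolding independent_explicit_module
  proof (intro allI impI)
    fix t u v assume t: "finite t" "t \<subseteq> f ` C" "(\<Sum>v\<in>t. u v *s v) = 0" "v \<in> t"
    define t' where "t' = {x\<in>C. f x \<in> t}"
    have bij: "bij_betw f t' t"
      using t inj' by (auto simp: bij_betw_def t'_def inj_on_def)
    have t'C: "t' \<subseteq> C" by (auto simp: t'_def)
    have ft': "finite t'" using fin t'C finite_subset by blast
    have memW: "u (f x) *s x \<in> W" if "x \<in> t'" for x
      using that t'C C W by (auto intro: subspace_scale)
    have "0 = (\<Sum>x\<in>t'. u (f x) *s f x)"
      using sum.reindex_bij_betw[OF bij, of "\<lambda>v. u v *s v"] t by simp
    also have "\<dots> = f (\<Sum>x\<in>t'. u (f x) *s x)"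
    proof (subst endo_sum[OF W f])
      show "(\<Sum>x\<in>t'. u (f x) *s f x) = (\<Sum>x\<in>t'. f (u (f x) *s x))"
        using t'C C(1) by (intro sum.cong refl endo_scale[OF W f, symmetric]) auto
    qed (rule memW)
    finally have "(\<Sum>x\<in>t'. u (f x) *s x) = 0"
      using inj[OF subspace_sum[OF W memW]] by simp
    then have *: "\<forall>x\<in>t'. u (f x) = 0"
      using independentD[OF C(2) ft' t'C, of "\<lambda>x. u (f x)"] by blast
    obtain x where "x \<in> t'" "v = f x" using bij t(4) by (auto simp: bij_betw_def)
    with * show "u v = 0" by auto
  qed
  then have indep: "independent (f ` C)" .
  have sub: "f ` C \<subseteq> span C" unfolding spanC using C(1) f by (auto simp: linear_endo_on_def)
  have "W \<subseteq> span (f ` C)"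
  proof
    fix x assume x: "x \<in> W"
    show "x \<in> span (f ` C)"
    proof (rule ccontr)
      assume not: "x \<notin> span (f ` C)"
      have "independent (insert x (f ` C))" using independent_insertI[OF not indep] .
      moreover have "insert x (f ` C) \<subseteq> span C" using x sub spanC by simp
      ultimately have "card (insert x (f ` C)) \<le> card C" using independent_span_bound[OF fin] by blast
      moreover have "x \<notin> f ` C" using not span_base by blast
      ultimately show False using fin card_image[OF inj'] by simp
    qed
  qed
  moreover have "subspace (f ` W)"
  proof (rule subspaceI)
    show "0 \<in> f ` W" using endo_0[OF W f] subspace_0[OF W] by force
    show "x + y \<in> f ` W" if "x \<in> f ` W" "y \<in> f ` W" for x y
      using that endo_add[OF W f, symmetric] subspace_add[OF W] by auto
    show "c *s x \<in> f ` W" if "x \<in> f ` W" for c x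
      using that endo_scale[OF W f, symmetric] subspace_scale[OF W] by auto
  qed
  ultimately have "W \<subseteq> f ` W" using C(1) span_minimal[of "f ` C" "f ` W"] by blast
  then show ?thesis using f by (auto simp: linear_endo_on_def)
qed

text \<open>A root \<open>z\<close> of \<open>p\<close> gives \<open>p = (x - z) q\<close>. Either \<open>q(f) w\<close> is an eigenvector for \<open>z\<close>, or \<open>q\<close> is an
  annihilating polynomial of smaller degree.\<close>

lemma eigenvector_of_annihilating_poly:
  assumes W: "subspace W" and f: "linear_endo_on (*s) W f"
    and "degree p \<le> n" "p \<noteq> 0" "w \<in> W" "w \<noteq> 0" "(\<Sum>i\<le>n. coeff p i *s (f ^^ i) w) = 0"
  shows "\<exists>c v. v \<in> W \<and> v \<noteq> 0 \<and> f v = c *s v"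
  using assms(3-)
proof (induction n arbitrary: p)
  case 0
  then have "coeff p 0 \<noteq> 0" using leading_coeff_0_iff[of p] by simp
  with 0 show ?case by simp
next
  case (Suc n)
  show ?case
  proof (cases "degree p = 0")
    case True
    then have "coeff p i = 0" if "i > 0" for i using that by (simp add: coeff_eq_0)
    then have "(\<Sum>i\<le>Suc n. coeff p i *s (f ^^ i) w) = coeff p 0 *s w"
      by (subst sum.atMost_shift) simp
    moreover have "coeff p 0 \<noteq> 0" using True Suc.prems(2) by (metis leading_coeff_0_iff)
    ultimately show ?thesis using Suc.prems by simp
  next
    case False
    then obtain z where "poly p z = 0"
      using fundamental_theorem_of_algebra[of p] by (auto simp: constant_degree)
    then obtain q where q: "p = [:-z, 1:] * q" by (auto simp: poly_eq_0_iff_dvd dvd_def)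
    have q0: "q \<noteq> 0" using q Suc.prems by auto
    have "degree p = Suc (degree q)" unfolding q using q0 by (subst degree_mult_eq) auto
    then have dq: "degree q \<le> n" using Suc.prems by simp
    let ?u = "\<Sum>i\<le>n. coeff q i *s (f ^^ i) w"
    have mem: "coeff q i *s (f ^^ i) w \<in> W" for i
      using funpow_mem[OF W f] Suc.prems W by (auto intro: subspace_scale)
    have "f ?u = (\<Sum>i\<le>n. coeff q i *s (f ^^ Suc i) w)"
      using mem funpow_mem[OF W f] Suc.prems
      by (subst endo_sum[OF W f]) (auto intro!: sum.cong endo_scale[OF W f])
    also have "\<dots> = (\<Sum>i\<le>Suc n. (if i = 0 then 0 else coeff q (i - 1)) *s (f ^^ i) w)"
      by (subst sum.atMost_Suc_shift) simp
    finally have 1: "f ?u = \<dots>" .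
    have "z *s ?u = (\<Sum>i\<le>Suc n. (z * coeff q i) *s (f ^^ i) w)"
      using dq by (simp add: scale_sum_right coeff_eq_0)
    with 1 have "f ?u - z *s ?u = (\<Sum>i\<le>Suc n. coeff p i *s (f ^^ i) w)"
      unfolding q by (simp only: sum_subtractf[symmetric] scale_left_diff_distrib[symmetric])
        (intro sum.cong refl arg_cong2[where f="(*s)"], auto simp: coeff_pCons split: nat.splits)
    with Suc.prems have fu: "f ?u = z *s ?u" by simp
    show ?thesis
    proof (cases "?u = 0")
      case True
      with Suc.IH[of q] dq q0 Suc.prems show ?thesis by blast
    next
      case False
      with fu mem show ?thesis by (meson subspace_sum[OF W])
    qed
  qed
qed

lemma eigenvector_exists:
  assumes W: "subspace W" and f: "linear_endo_on (*s) W f" and B: "finite B" "W \<subseteq> span B"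
    and w: "w \<in> W" "w \<noteq> 0"
  obtains c v where "v \<in> W" "v \<noteq> 0" "f v = c *s v"
proof -
  have "(f ^^ i) w \<in> span B" for i using B funpow_mem[OF W f w(1)] by blast
  then obtain c i where c: "i \<le> card B" "c i \<noteq> 0" "(\<Sum>i\<le>card B. c i *s (f ^^ i) w) = 0"
    using linearly_dependent_family[OF B(1), of "\<lambda>i. (f ^^ i) w"] by blast
  define p where "p = (\<Sum>i\<le>card B. monom (c i) i)"
  have p: "coeff p i = (if i \<le> card B then c i else 0)" for i
    by (simp add: p_def coeff_sum)
  have "degree p \<le> card B" by (rule degree_le) (simp add: p)
  moreover have "p \<noteq> 0" using p[of i] c by auto
  moreover have "(\<Sum>i\<le>card B. coeff p i *s (f ^^ i) w) = 0" using c by (simp add: p)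
  ultimately show ?thesis using eigenvector_of_annihilating_poly[OF W f] w that by blast
qed

text \<open>One operator at a time: the simultaneous eigenvectors for given eigenvalues of the earlier operators
  form a subspace that is invariant under the next one.\<close>

lemma simultaneous_eigenvectors_span:
  assumes W: "subspace W" and A: "finite A"
    and endo: "\<And>h. h \<in> A \<Longrightarrow> linear_endo_on (*s) W (fam h)"
    and comm: "\<And>h h' x. h \<in> A \<Longrightarrow> h' \<in> A \<Longrightarrow> x \<in> W \<Longrightarrow> fam h (fam h' x) = fam h' (fam h x)"
    and diag: "\<And>h. h \<in> A \<Longrightarrow> W \<subseteq> span {x\<in>W. \<exists>c. fam h x = c *s x}"
    and N: "subspace N" "N \<subseteq> W" "\<And>h. h \<in> A \<Longrightarrow> fam h ` N \<subseteq> N"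
  shows "N \<subseteq> span {x\<in>N. \<forall>h\<in>A. \<exists>c. fam h x = c *s x}"
  using A endo comm diag N(3)
proof (induction A rule: finite_induct)
  case empty
  then show ?case by (simp add: span_superset)
next
  case (insert h A)
  let ?E = "\<lambda>A. {x\<in>N. \<forall>h\<in>A. \<exists>c. fam h x = c *s x}"
  have "?E A \<subseteq> span (?E (insert h A))"
  proof
    fix x assume x: "x \<in> ?E A"
    then obtain c where c: "\<And>k. k \<in> A \<Longrightarrow> fam k x = c k *s x" by (auto; metis)
    define M where "M = {y\<in>N. \<forall>k\<in>A. fam k y = c k *s y}"
    have MW: "M \<subseteq> W" using N by (auto simp: M_def)
    have "subspace M"
    proof (rule subspaceI)
      show "0 \<in> M" using insert.prems(1) N(1) by (auto simp: M_def subspace_0 endo_0[OF W])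
      show "y + z \<in> M" if "y \<in> M" "z \<in> M" for y z
      proof -
        have "y \<in> W" "z \<in> W" using that MW by auto
        then show ?thesis using that insert.prems(1) N(1)
          by (auto simp: M_def subspace_add endo_add[OF W] algebra_simps)
      qed
      show "d *s y \<in> M" if "y \<in> M" for d y
      proof -
        have "y \<in> W" using that MW by auto
        then show ?thesis using that insert.prems(1) N(1)
          by (auto simp: M_def subspace_scale endo_scale[OF W] mult.commute)
      qed
    qed
    moreover have "fam h ` M \<subseteq> M"
    proof clarify
      fix y assume y: "y \<in> M"
      then have "fam k (fam h y) = c k *s fam h y" if "k \<in> A" for k
        using that insert.prems(2)[of k h y] MW insert.prems(1)[of h]
        by (auto simp: M_def endo_scale[OF W])
      then show "fam h y \<in> M" using y insert.prems(4)[of h] by (auto simp: M_def)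
    qed
    ultimately have "M \<subseteq> span {y\<in>M. \<exists>c. fam h y = c *s y}"
      by (rule invariant_subspace_diagonalisable[OF W insert.prems(1)[OF insertI1] _ MW _ insert.prems(3)[OF insertI1]])
    also have "\<dots> \<subseteq> span (?E (insert h A))" by (rule span_mono) (auto simp: M_def)
    finally have "M \<subseteq> span (?E (insert h A))" .
    then show "x \<in> span (?E (insert h A))" using x c by (auto simp: M_def)
  qed
  then have "span (?E A) \<subseteq> span (?E (insert h A))" by (rule span_minimal[OF _ subspace_span])
  moreover have "N \<subseteq> span (?E A)"
    by (rule insert.IH) (use insert.prems in auto)
  ultimately show ?case by (rule order_trans[rotated])
qed

text \<open>If the last form vanished on the common kernel of the others it would be a linear
  combination of them; otherwise that kernel provides the correction of its value.\<close>

lemma prescribe_values_of_independent_forms: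
  fixes \<Pi> :: "('b \<Rightarrow> complex) set"
  assumes H: "subspace H" and "finite \<Pi>"
    and "\<And>\<beta>. \<beta> \<in> \<Pi> \<Longrightarrow> linear_form_on (*s) H \<beta>"
    and "\<And>c. (\<And>h. h \<in> H \<Longrightarrow> (\<Sum>\<beta>\<in>\<Pi>. c \<beta> * \<beta> h) = 0) \<Longrightarrow> \<forall>\<beta>\<in>\<Pi>. c \<beta> = 0"
  shows "\<exists>h\<in>H. \<forall>\<beta>\<in>\<Pi>. \<beta> h = t \<beta>"
  using assms(2-)
proof (induction \<Pi> arbitrary: t rule: finite_induct)
  case empty
  then show ?case using subspace_0[OF H] by auto
next
  case (insert \<gamma> \<Pi>)
  have lin: "\<beta> (x + y) = \<beta> x + \<beta> y" if "\<beta> \<in> insert \<gamma> \<Pi>" "x \<in> H" "y \<in> H" for \<beta> x y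
    using insert.prems(1)[OF that(1)] that(2,3) by (auto simp: linear_form_on_def)
  have lin': "\<beta> (c *s x) = c * \<beta> x" if "\<beta> \<in> insert \<gamma> \<Pi>" "x \<in> H" for \<beta> x c
    using insert.prems(1)[OF that(1)] that(2) by (auto simp: linear_form_on_def)
  have indep: "\<forall>\<beta>\<in>\<Pi>. c \<beta> = 0" if "\<And>h. h \<in> H \<Longrightarrow> (\<Sum>\<beta>\<in>\<Pi>. c \<beta> * \<beta> h) = 0" for c
  proof -
    have "(\<Sum>\<beta>\<in>insert \<gamma> \<Pi>. (c(\<gamma> := 0)) \<beta> * \<beta> h) = 0" if "h \<in> H" for h
    proof -
      have "(\<Sum>\<beta>\<in>\<Pi>. (c(\<gamma> := 0)) \<beta> * \<beta> h) = (\<Sum>\<beta>\<in>\<Pi>. c \<beta> * \<beta> h)"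
        using insert.hyps by (intro sum.cong) auto
      with insert.hyps \<open>\<And>h. h \<in> H \<Longrightarrow> (\<Sum>\<beta>\<in>\<Pi>. c \<beta> * \<beta> h) = 0\<close> that show ?thesis by simp
    qed
    then have "\<forall>\<beta>\<in>insert \<gamma> \<Pi>. (c(\<gamma> := 0)) \<beta> = 0" by (rule insert.prems(2))
    with insert.hyps show ?thesis by (metis fun_upd_other insertCI)
  qed
  have IH: "\<exists>h\<in>H. \<forall>\<beta>\<in>\<Pi>. \<beta> h = t \<beta>" for t
    by (rule insert.IH) (use insert.prems(1) indep in auto)
  have "\<exists>k\<in>H. (\<forall>\<beta>\<in>\<Pi>. \<beta> k = 0) \<and> \<gamma> k \<noteq> 0"
  proof (rule ccontr)
    assume no: "\<not> ?thesis"
    have "\<exists>h. h \<in> H \<and> (\<forall>\<beta>'\<in>\<Pi>. \<beta>' h = (if \<beta>' = \<beta> then 1 else 0))" for \<beta>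
      using IH[of "\<lambda>\<beta>'. if \<beta>' = \<beta> then 1 else 0"] unfolding Bex_def .
    then have "\<forall>\<beta>. \<exists>h. h \<in> H \<and> (\<forall>\<beta>'\<in>\<Pi>. \<beta>' h = (if \<beta>' = \<beta> then 1 else 0))" by (rule allI)
    from choice[OF this] obtain e
      where e0: "\<forall>\<beta>. e \<beta> \<in> H \<and> (\<forall>\<beta>'\<in>\<Pi>. \<beta>' (e \<beta>) = (if \<beta>' = \<beta> then 1 else 0))" by (rule exE)
    have e: "e \<beta> \<in> H" "\<beta>' \<in> \<Pi> \<Longrightarrow> \<beta>' (e \<beta>) = (if \<beta>' = \<beta> then 1 else 0)" for \<beta> \<beta>'
      using e0[rule_format, of \<beta>] by simp_all
    let ?c = "\<lambda>\<beta>. if \<beta> = \<gamma> then -1 else \<gamma> (e \<beta>)"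
    have "(\<Sum>\<beta>\<in>insert \<gamma> \<Pi>. ?c \<beta> * \<beta> h) = 0" if h: "h \<in> H" for h
    proof -
      let ?s = "\<lambda>B. \<Sum>\<beta>\<in>B. \<beta> h *s e \<beta>"
      have sH: "?s B \<in> H" for B using e(1) H by (intro subspace_sum subspace_scale)
      have app: "\<beta>' (?s B) = (\<Sum>\<beta>\<in>B. \<beta> h * \<beta>' (e \<beta>))" if "\<beta>' \<in> insert \<gamma> \<Pi>" "finite B" for \<beta>' B
        using that(2)
      proof (induction B rule: finite_induct)
        case empty
        then show ?case using lin'[OF that(1) h, of 0] by simp
      next
        case (insert b B)
        then show ?case using lin[OF that(1)] lin'[OF that(1)] sH e(1) H by (simp add: subspace_scale)
      qed
      let ?k = "h + (-1) *s ?s \<Pi>"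
      have kH: "?k \<in> H" using h sH H by (intro subspace_add subspace_scale)
      have "\<beta>' ?k = 0" if "\<beta>' \<in> \<Pi>" for \<beta>'
      proof -
        have "(\<Sum>\<beta>\<in>\<Pi>. \<beta> h * \<beta>' (e \<beta>)) = (\<Sum>\<beta>\<in>\<Pi>. if \<beta> = \<beta>' then \<beta> h else 0)"
          by (intro sum.cong refl) (auto simp: e(2)[OF that])
        also have "\<dots> = \<beta>' h" using insert.hyps(1) that by simp
        finally show ?thesis
          using lin[of \<beta>'] lin'[of \<beta>'] app[of \<beta>' \<Pi>] that h sH H insert.hyps by (simp add: subspace_scale del: scale_minus_left)
      qed
      with no kH have "\<gamma> ?k = 0" by auto
      then have "\<gamma> h = (\<Sum>\<beta>\<in>\<Pi>. \<beta> h * \<gamma> (e \<beta>))"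
        using lin[of \<gamma>] lin'[of \<gamma>] app[of \<gamma> \<Pi>] h sH H insert.hyps by (simp add: subspace_scale del: scale_minus_left)
      moreover have "(\<Sum>\<beta>\<in>\<Pi>. ?c \<beta> * \<beta> h) = (\<Sum>\<beta>\<in>\<Pi>. \<beta> h * \<gamma> (e \<beta>))"
        using insert.hyps by (intro sum.cong) auto
      ultimately show ?thesis using insert.hyps by simp
    qed
    then have "\<forall>\<beta>\<in>insert \<gamma> \<Pi>. ?c \<beta> = 0" by (rule insert.prems(2))
    then show False by simp
  qed
  then obtain k where k: "k \<in> H" "\<forall>\<beta>\<in>\<Pi>. \<beta> k = 0" "\<gamma> k \<noteq> 0" by blast
  obtain h where h: "h \<in> H" "\<forall>\<beta>\<in>\<Pi>. \<beta> h = t \<beta>" using IH by blast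
  let ?h = "h + ((t \<gamma> - \<gamma> h) / \<gamma> k) *s k"
  have kH: "c *s k \<in> H" for c using k H by (intro subspace_scale)
  have "?h \<in> H" using h kH H by (intro subspace_add)
  moreover have "\<forall>\<beta>\<in>insert \<gamma> \<Pi>. \<beta> ?h = t \<beta>"
  proof
    fix \<beta> assume \<beta>: "\<beta> \<in> insert \<gamma> \<Pi>"
    have "\<beta> ?h = \<beta> h + ((t \<gamma> - \<gamma> h) / \<gamma> k) * \<beta> k"
      unfolding lin[OF \<beta> h(1) kH] lin'[OF \<beta> k(1)] ..
    then show "\<beta> ?h = t \<beta>" using \<beta> h k by (cases "\<beta> = \<gamma>") auto
  qed
  ultimately show ?case by (rule bexI[rotated])
qed

end

section \<open>Presentations of modules as quotients\<close>

text \<open>Quotient modules consist of cosets, and their quotients of cosets of cosets. All computations take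
  place in one ambient space instead: \<open>\<kappa>\<close> is a surjection of \<open>F\<close> onto the carrier of \<open>X\<close> which
  carries the operators \<open>a x\<close> to the action and identifies elements that differ by an element of \<open>K\<close>.\<close>

definition presents :: "'t lie_algebra \<Rightarrow> 'f::ab_group_add set \<Rightarrow> (complex \<Rightarrow> 'f \<Rightarrow> 'f) \<Rightarrow>
    ('t \<Rightarrow> 'f \<Rightarrow> 'f) \<Rightarrow> ('t, 'm) lie_module \<Rightarrow> ('f \<Rightarrow> 'm) \<Rightarrow> 'f set \<Rightarrow> bool"
  where "presents L F sc a X \<kappa> K \<longleftrightarrow> mcarrier X = \<kappa> ` F \<and>
    (\<forall>f\<in>F. \<forall>g\<in>F. \<kappa> f = \<kappa> g \<longleftrightarrow> f - g \<in> K) \<and>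
    (\<forall>f\<in>F. \<forall>g\<in>F. madd X (\<kappa> f) (\<kappa> g) = \<kappa> (f + g)) \<and> mzero X = \<kappa> 0 \<and>
    (\<forall>c. \<forall>f\<in>F. mscale X c (\<kappa> f) = \<kappa> (sc c f)) \<and>
    (\<forall>x\<in>lcarrier L. \<forall>f\<in>F. mact X x (\<kappa> f) = \<kappa> (a x f))"

locale operator_space = complex_space scale
  for scale :: "complex \<Rightarrow> 'b::ab_group_add \<Rightarrow> 'b" (infixr "*s" 75) +
  fixes L :: "'t lie_algebra" and F :: "'b set" and a :: "'t \<Rightarrow> 'b \<Rightarrow> 'b"
  assumes subspace_F: "subspace F"
    and endo: "x \<in> lcarrier L \<Longrightarrow> linear_endo_on (*s) F (a x)"
begin

definition invariant :: "'b set \<Rightarrow> bool"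
  where "invariant N \<longleftrightarrow> subspace N \<and> N \<subseteq> F \<and> (\<forall>x\<in>lcarrier L. a x ` N \<subseteq> N)"

abbreviation presented :: "('t, 'm) lie_module \<Rightarrow> ('b \<Rightarrow> 'm) \<Rightarrow> 'b set \<Rightarrow> bool"
  where "presented \<equiv> presents L F (*s) a"

lemma F_closed:
  "0 \<in> F" "f \<in> F \<Longrightarrow> g \<in> F \<Longrightarrow> f + g \<in> F" "f \<in> F \<Longrightarrow> g \<in> F \<Longrightarrow> f - g \<in> F" "f \<in> F \<Longrightarrow> c *s f \<in> F"
  "x \<in> lcarrier L \<Longrightarrow> f \<in> F \<Longrightarrow> a x f \<in> F"
  using subspace_F endo_mem[OF subspace_F endo]
  by (auto simp: subspace_0 subspace_add subspace_diff subspace_scale)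

context
  fixes X :: "('t, 'm) lie_module" and \<kappa> K
  assumes X: "presented X \<kappa> K" and K: "invariant K"
begin

lemma presD:
  "mcarrier X = \<kappa> ` F"
  "f \<in> F \<Longrightarrow> g \<in> F \<Longrightarrow> \<kappa> f = \<kappa> g \<longleftrightarrow> f - g \<in> K"
  "f \<in> F \<Longrightarrow> g \<in> F \<Longrightarrow> madd X (\<kappa> f) (\<kappa> g) = \<kappa> (f + g)"
  "mzero X = \<kappa> 0"
  "f \<in> F \<Longrightarrow> mscale X c (\<kappa> f) = \<kappa> (c *s f)"
  "x \<in> lcarrier L \<Longrightarrow> f \<in> F \<Longrightarrow> mact X x (\<kappa> f) = \<kappa> (a x f)"
  using X unfolding presents_def by auto

lemma preimage_of_submodule:
  assumes N: "lie_submodule L X N"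
  shows "invariant {f\<in>F. \<kappa> f \<in> N}" "K \<subseteq> {f\<in>F. \<kappa> f \<in> N}" "\<kappa> ` {f\<in>F. \<kappa> f \<in> N} = N"
proof -
  have N': "N \<subseteq> \<kappa> ` F" "\<kappa> 0 \<in> N"
    and N_add: "\<And>v w. v \<in> N \<Longrightarrow> w \<in> N \<Longrightarrow> madd X v w \<in> N"
    and N_scale: "\<And>v c. v \<in> N \<Longrightarrow> mscale X c v \<in> N"
    and N_act: "\<And>x v. x \<in> lcarrier L \<Longrightarrow> v \<in> N \<Longrightarrow> mact X x v \<in> N"
    using N[unfolded lie_submodule_def presD(1,4)] by blast+
  have "subspace {f\<in>F. \<kappa> f \<in> N}"
  proof (rule subspaceI)
    show "0 \<in> {f\<in>F. \<kappa> f \<in> N}" using N' F_closed by auto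
    show "f + g \<in> {f\<in>F. \<kappa> f \<in> N}" if "f \<in> {f\<in>F. \<kappa> f \<in> N}" "g \<in> {f\<in>F. \<kappa> f \<in> N}" for f g
      using that N_add[of "\<kappa> f" "\<kappa> g"] by (auto simp: presD(3) F_closed)
    show "c *s f \<in> {f\<in>F. \<kappa> f \<in> N}" if "f \<in> {f\<in>F. \<kappa> f \<in> N}" for f c
      using that N_scale[of "\<kappa> f" c] by (auto simp: presD(5) F_closed)
  qed
  moreover have "a x f \<in> {f\<in>F. \<kappa> f \<in> N}" if "x \<in> lcarrier L" "f \<in> {f\<in>F. \<kappa> f \<in> N}" for x f
    using that N_act[of x "\<kappa> f"] by (auto simp: presD(6) F_closed)
  ultimately show "invariant {f\<in>F. \<kappa> f \<in> N}" unfolding invariant_def by blast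
  show "K \<subseteq> {f\<in>F. \<kappa> f \<in> N}"
  proof
    fix k assume k: "k \<in> K"
    then have kF: "k \<in> F" using K by (auto simp: invariant_def)
    then have "\<kappa> k = \<kappa> 0" using k presD(2)[of k 0] F_closed by simp
    with N' kF show "k \<in> {f\<in>F. \<kappa> f \<in> N}" by auto
  qed
  show "\<kappa> ` {f\<in>F. \<kappa> f \<in> N} = N" using N' by auto
qed

lemma image_of_invariant:
  assumes N: "invariant N" "K \<subseteq> N"
  shows "lie_submodule L X (\<kappa> ` N)" "{f\<in>F. \<kappa> f \<in> \<kappa> ` N} = N"
proof -
  have N': "subspace N" "N \<subseteq> F" "\<And>x f. x \<in> lcarrier L \<Longrightarrow> f \<in> N \<Longrightarrow> a x f \<in> N"
    using N unfolding invariant_def by blast+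
  show "lie_submodule L X (\<kappa> ` N)"
    unfolding lie_submodule_def presD(1,4)
  proof (intro conjI ballI allI)
    show "\<kappa> ` N \<subseteq> \<kappa> ` F" using N' by auto
    show "\<kappa> 0 \<in> \<kappa> ` N" using N' by (auto simp: subspace_0)
    show "madd X v w \<in> \<kappa> ` N" if "v \<in> \<kappa> ` N" "w \<in> \<kappa> ` N" for v w
      using that N'(2) subspace_add[OF N'(1)] by (auto simp: presD(3) subsetD)
    show "mscale X c v \<in> \<kappa> ` N" if "v \<in> \<kappa> ` N" for v c
      using that N'(2) subspace_scale[OF N'(1)] by (auto simp: presD(5) subsetD)
    show "mact X x v \<in> \<kappa> ` N" if "x \<in> lcarrier L" "v \<in> \<kappa> ` N" for x v
      using that N'(2,3) by (auto simp: presD(6) subsetD)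
  qed
  show "{f\<in>F. \<kappa> f \<in> \<kappa> ` N} = N"
  proof
    show "{f\<in>F. \<kappa> f \<in> \<kappa> ` N} \<subseteq> N"
    proof clarify
      fix f g assume "f \<in> F" "g \<in> N" "\<kappa> f = \<kappa> g"
      then have "f - g \<in> N" "g \<in> N" using N N' presD(2)[of f g] by auto
      then have "f - g + g \<in> N" using N' by (blast intro: subspace_add)
      then show "f \<in> N" by simp
    qed
  qed (use N' in auto)
qed

lemma irreducible_presented_iff:
  "irreducible_module L X \<longleftrightarrow> K \<noteq> F \<and> (\<forall>N. invariant N \<and> K \<subseteq> N \<longrightarrow> N = K \<or> N = F)"
proof -
  have K': "K \<subseteq> F" "subspace K" using K by (auto simp: invariant_def)
  have sub: "{f\<in>F. \<kappa> f \<in> {\<kappa> 0}} = K" using presD(2)[of _ 0] F_closed K' by auto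
  have "\<kappa> k = \<kappa> 0" if "k \<in> K" for k using sub that by blast
  then have zero: "\<kappa> ` K = {\<kappa> 0}" using subspace_0[OF K'(2)] by blast
  have inv_F: "invariant F" unfolding invariant_def using subspace_F F_closed(5) by blast
  have eq: "\<kappa> ` N = \<kappa> ` N' \<longleftrightarrow> N = N'" if "invariant N" "K \<subseteq> N" "invariant N'" "K \<subseteq> N'" for N N'
  proof
    assume *: "\<kappa> ` N = \<kappa> ` N'"
    show "N = N'"
      using image_of_invariant(2)[OF that(1,2)] image_of_invariant(2)[OF that(3,4)] unfolding * by (rule trans[OF sym])
  qed simp
  have *: "(\<forall>N. lie_submodule L X N \<longrightarrow> Q N) \<longleftrightarrow> (\<forall>N. invariant N \<and> K \<subseteq> N \<longrightarrow> Q (\<kappa> ` N))" for Q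
  proof safe
    fix N assume all: "\<forall>N. invariant N \<and> K \<subseteq> N \<longrightarrow> Q (\<kappa> ` N)" and N: "lie_submodule L X N"
    from all have "Q (\<kappa> ` {f\<in>F. \<kappa> f \<in> N})" using preimage_of_submodule(1,2)[OF N] by blast
    then show "Q N" unfolding preimage_of_submodule(3)[OF N] .
  qed (use image_of_invariant(1) in blast)
  have 1: "\<kappa> ` F \<noteq> \<kappa> ` K \<longleftrightarrow> K \<noteq> F" using eq[OF inv_F K'(1) K order_refl] by auto
  have "\<kappa> ` N = \<kappa> ` K \<or> \<kappa> ` N = \<kappa> ` F \<longleftrightarrow> N = K \<or> N = F" if "invariant N" "K \<subseteq> N" for N
    using eq[OF that K order_refl] eq[OF that inv_F K'(1)] by simp
  then have "(\<forall>N. invariant N \<and> K \<subseteq> N \<longrightarrow> \<kappa> ` N = \<kappa> ` K \<or> \<kappa> ` N = \<kappa> ` F) \<longleftrightarrow>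
      (\<forall>N. invariant N \<and> K \<subseteq> N \<longrightarrow> N = K \<or> N = F)"
    by (intro arg_cong[where f=All] ext) blast
  with 1 show ?thesis unfolding irreducible_module_def * presD(1,4) zero[symmetric] by (rule arg_cong2)
qed

lemma mcoset_presented:
  assumes N: "lie_submodule L X N" and f: "f \<in> F"
  shows "mcoset X N (\<kappa> f) = {\<kappa> g | g. g \<in> F \<and> \<kappa> (g - f) \<in> N}"
proof -
  note pre = preimage_of_submodule[OF N]
  have "madd X (\<kappa> f) (\<kappa> g) = \<kappa> (f + g)" if "g \<in> F" for g using presD(3) f that .
  then have "mcoset X N (\<kappa> f) = (\<lambda>g. \<kappa> (f + g)) ` {g\<in>F. \<kappa> g \<in> N}"
    unfolding mcoset_def by (subst pre(3)[symmetric]) (auto simp: image_image)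
  also have "\<dots> = {\<kappa> g | g. g \<in> F \<and> \<kappa> (g - f) \<in> N}"
  proof safe
    fix g assume "g \<in> F" "\<kappa> g \<in> N"
    then show "\<exists>h. \<kappa> (f + g) = \<kappa> h \<and> h \<in> F \<and> \<kappa> (h - f) \<in> N"
      using f F_closed(2) by (intro exI[of _ "f + g"]) auto
  next
    fix g assume "g \<in> F" "\<kappa> (g - f) \<in> N"
    then show "\<kappa> g \<in> (\<lambda>g. \<kappa> (f + g)) ` {g\<in>F. \<kappa> g \<in> N}"
      using f F_closed(3) by (intro image_eqI[of _ _ "g - f"]) auto
  qed
  finally show ?thesis .
qed

lemma quotient_presented:
  assumes N: "lie_submodule L X N"
  shows "presented (quotient_module X N) (\<lambda>f. mcoset X N (\<kappa> f)) {f\<in>F. \<kappa> f \<in> N}"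
proof -
  let ?Q = "\<lambda>f. mcoset X N (\<kappa> f)" and ?N = "{f\<in>F. \<kappa> f \<in> N}"
  note pre = preimage_of_submodule[OF N]
  have sN: "subspace ?N" and aN: "\<And>x f. x \<in> lcarrier L \<Longrightarrow> f \<in> ?N \<Longrightarrow> a x f \<in> ?N"
    using pre(1) unfolding invariant_def by blast+
  have Q: "?Q f = {\<kappa> g | g. g \<in> F \<and> g - f \<in> ?N}" if "f \<in> F" for f
    unfolding mcoset_presented[OF N that] using that F_closed(3) by blast
  have selfQ: "\<kappa> f \<in> ?Q f" if "f \<in> F" for f
    using subspace_0[OF sN] that by (auto simp: Q)
  have Qeq: "?Q f = ?Q g \<longleftrightarrow> f - g \<in> ?N" if fg: "f \<in> F" "g \<in> F" for f g
  proof
    assume "?Q f = ?Q g"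
    then have "\<kappa> f \<in> ?Q g" using selfQ[OF fg(1)] by simp
    then obtain h where h: "h \<in> F" "h - g \<in> ?N" "\<kappa> f = \<kappa> h" unfolding Q[OF fg(2)] by blast
    then have "f - h \<in> ?N" using presD(2) fg pre(2) by blast
    from subspace_add[OF sN this h(2)] show "f - g \<in> ?N" by simp
  next
    assume d: "f - g \<in> ?N"
    have "h - f \<in> ?N \<longleftrightarrow> h - g \<in> ?N" for h
    proof
      show "h - f \<in> ?N \<Longrightarrow> h - g \<in> ?N" using subspace_add[OF sN _ d, of "h - f"] by (simp only: diff_add_eq) simp
      show "h - g \<in> ?N \<Longrightarrow> h - f \<in> ?N" using subspace_diff[OF sN _ d, of "h - g"] by (simp only:) simp
    qed
    then show "?Q f = ?Q g" unfolding Q[OF fg(1)] Q[OF fg(2)] by simp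
  qed
  have ex: "\<exists>g\<in>F. v = \<kappa> g \<and> g - f \<in> ?N" if "v \<in> ?Q f" "f \<in> F" for v f
    using that Q by blast
  show ?thesis
    unfolding presents_def quotient_module_def lie_module.simps
  proof (intro conjI ballI allI)
    show "mcoset X N ` mcarrier X = ?Q ` F" by (auto simp: presD(1))
    show "?Q f = ?Q g \<longleftrightarrow> f - g \<in> ?N" if "f \<in> F" "g \<in> F" for f g using Qeq that .
    show "mcoset X N (mzero X) = ?Q 0" by (simp add: presD(4))
    show "(\<Union>v\<in>?Q f. \<Union>w\<in>?Q g. mcoset X N (madd X v w)) = ?Q (f + g)" if fg: "f \<in> F" "g \<in> F" for f g
    proof -
      have "mcoset X N (madd X v w) = ?Q (f + g)" if vw: "v \<in> ?Q f" "w \<in> ?Q g" for v w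
      proof -
        obtain f' g' where *: "f' \<in> F" "v = \<kappa> f'" "f' - f \<in> ?N" "g' \<in> F" "w = \<kappa> g'" "g' - g \<in> ?N"
          using ex[OF vw(1) fg(1)] ex[OF vw(2) fg(2)] by (elim bexE conjE) (rule that)
        have "f' + g' - (f + g) \<in> ?N" using subspace_add[OF sN *(3,6)] by (simp only: add_diff_add)
        then have "?Q (f' + g') = ?Q (f + g)" using Qeq[of "f' + g'" "f + g"] * fg F_closed(2) by blast
        then show ?thesis unfolding *(2,5) presD(3)[OF *(1,4)] .
      qed
      then show ?thesis using selfQ fg by blast
    qed
    show "(\<Union>v\<in>?Q f. mcoset X N (mscale X c v)) = ?Q (c *s f)" if f: "f \<in> F" for f c
    proof -
      have "mcoset X N (mscale X c v) = ?Q (c *s f)" if v: "v \<in> ?Q f" for v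
      proof -
        obtain f' where *: "f' \<in> F" "v = \<kappa> f'" "f' - f \<in> ?N" using ex[OF v f] by (elim bexE conjE) (rule that)
        have "c *s f' - c *s f \<in> ?N" using subspace_scale[OF sN *(3)] by (simp only: scale_right_diff_distrib)
        then have "?Q (c *s f') = ?Q (c *s f)" using Qeq[of "c *s f'" "c *s f"] * f F_closed(4) by blast
        then show ?thesis unfolding *(2) presD(5)[OF *(1)] .
      qed
      then show ?thesis using selfQ f by blast
    qed
    show "(\<Union>v\<in>?Q f. mcoset X N (mact X x v)) = ?Q (a x f)" if f: "f \<in> F" and x: "x \<in> lcarrier L" for f x
    proof -
      have "mcoset X N (mact X x v) = ?Q (a x f)" if v: "v \<in> ?Q f" for v
      proof -
        obtain f' where *: "f' \<in> F" "v = \<kappa> f'" "f' - f \<in> ?N" using ex[OF v f] by (elim bexE conjE) (rule that)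
        have "a x f' - a x f \<in> ?N" using aN[OF x *(3)] endo_diff[OF subspace_F endo[OF x] *(1) f] by simp
        then have "?Q (a x f') = ?Q (a x f)" using Qeq[of "a x f'" "a x f"] * f F_closed(5)[OF x] by blast
        then show ?thesis unfolding *(2) presD(6)[OF x *(1)] .
      qed
      then show ?thesis using selfQ f by blast
    qed
  qed
qed

end

lemma module_iso_if_same_presentation:
  assumes X: "presented X \<kappa> K" and Y: "presented Y \<kappa>' K"
  shows "module_iso L X Y"
proof -
  have eq: "\<kappa> f = \<kappa> g \<longleftrightarrow> \<kappa>' f = \<kappa>' g" if "f \<in> F" "g \<in> F" for f g
    using X Y that unfolding presents_def by blast
  define \<phi> where "\<phi> v = \<kappa>' (SOME f. f \<in> F \<and> \<kappa> f = v)" for v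
  have \<phi>: "\<phi> (\<kappa> f) = \<kappa>' f" if "f \<in> F" for f
  proof -
    have "\<exists>g. g \<in> F \<and> \<kappa> g = \<kappa> f" using that by blast
    then have "(SOME g. g \<in> F \<and> \<kappa> g = \<kappa> f) \<in> F \<and> \<kappa> (SOME g. g \<in> F \<and> \<kappa> g = \<kappa> f) = \<kappa> f" by (rule someI_ex)
    then show ?thesis unfolding \<phi>_def using eq that by blast
  qed
  have "bij_betw \<phi> (\<kappa> ` F) (\<kappa>' ` F)"
    by (rule bij_betw_imageI) (auto simp: inj_on_def \<phi> eq image_image)
  then show ?thesis
    unfolding module_iso_def using X Y
    by (intro exI[of _ \<phi>]) (auto simp: presents_def \<phi> F_closed)
qed

text \<open>Submodules of \<open>X\<close> are the images of the invariant subspaces between \<open>R\<close> and \<open>F\<close>, and irreducible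
  quotients belong to the maximal ones. If all proper ones lie in \<open>K\<close>, the only maximal one is \<open>K\<close>.\<close>

lemma unique_irreducible_quotient:
  assumes X: "presented X \<kappa> R" "invariant R" and Y: "presented Y \<kappa>' K" "invariant K"
    and "irreducible_module L Y" "R \<subseteq> K"
    and below: "\<And>N. invariant N \<Longrightarrow> R \<subseteq> N \<Longrightarrow> N \<noteq> F \<Longrightarrow> N \<subseteq> K"
  shows "(\<exists>!N. irreducible_quotient_by L X N) \<and> module_iso L Y (irreducible_quotient L X)"
proof -
  have Kmax: "K \<noteq> F" "\<And>N. invariant N \<Longrightarrow> K \<subseteq> N \<Longrightarrow> N = K \<or> N = F"
    using irreducible_presented_iff[OF Y] assms(5) by blast+
  have iff: "irreducible_quotient_by L X N \<longleftrightarrow> N = \<kappa> ` K" for N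
  proof
    assume N: "irreducible_quotient_by L X N"
    then have sub: "lie_submodule L X N" by (simp add: irreducible_quotient_by_def)
    note pre = preimage_of_submodule[OF X sub]
    from N have "{f\<in>F. \<kappa> f \<in> N} \<noteq> F" "\<And>M. invariant M \<Longrightarrow> {f\<in>F. \<kappa> f \<in> N} \<subseteq> M \<Longrightarrow> M = {f\<in>F. \<kappa> f \<in> N} \<or> M = F"
      using irreducible_presented_iff[OF quotient_presented[OF X sub] pre(1)]
      unfolding irreducible_quotient_by_def by blast+
    then have "{f\<in>F. \<kappa> f \<in> N} = K" using below[OF pre(1,2)] Y(2) Kmax(1) by blast
    with pre(3) show "N = \<kappa> ` K" by simp
  next
    assume N: "N = \<kappa> ` K"
    note im = image_of_invariant[OF X Y(2) \<open>R \<subseteq> K\<close>]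
    have "irreducible_module L (quotient_module X (\<kappa> ` K))"
      using irreducible_presented_iff[OF quotient_presented[OF X im(1)]] im(2) Y(2) Kmax by simp
    then show "irreducible_quotient_by L X N" unfolding irreducible_quotient_by_def N using im(1) by simp
  qed
  then have the: "(THE N. irreducible_quotient_by L X N) = \<kappa> ` K" by simp
  note im = image_of_invariant[OF X Y(2) \<open>R \<subseteq> K\<close>]
  have "presented (quotient_module X (\<kappa> ` K)) (\<lambda>f. mcoset X (\<kappa> ` K) (\<kappa> f)) K"
    using quotient_presented[OF X im(1)] im(2) by simp
  then have "module_iso L Y (quotient_module X (\<kappa> ` K))"
    using module_iso_if_same_presentation[OF Y(1)] by blast
  then show ?thesis unfolding irreducible_quotient_def the using iff by auto
qed

end

section \<open>Actions of a graded Lie algebra\<close>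

text \<open>Only the elements of the spanning set are homogeneous: the degree of an element of \<open>P\<close>, \<open>Z\<close> or \<open>N\<close> is
  its eigenvalue for \<open>ad e\<close>, which is positive, zero or negative.\<close>

definition graded_by ::
    "'t::ab_group_add lie_algebra \<Rightarrow> 't \<Rightarrow> 't set \<Rightarrow> 't set \<Rightarrow> 't set \<Rightarrow> bool"
  where "graded_by L e P Z N \<longleftrightarrow> vector_space (lscale L) \<and> module.subspace (lscale L) (lcarrier L) \<and>
    (\<forall>x\<in>lcarrier L. \<forall>y\<in>lcarrier L. lbracket L x y \<in> lcarrier L) \<and>
    e \<in> lcarrier L \<and> P \<union> Z \<union> N \<subseteq> lcarrier L \<and>
    lcarrier L \<subseteq> module.span (lscale L) (P \<union> Z \<union> N) \<and>
    (\<forall>x\<in>P. \<exists>q>0. lbracket L e x = lscale L (of_real q) x) \<and>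
    (\<forall>x\<in>Z. lbracket L e x = lscale L (of_real 0) x) \<and>
    (\<forall>x\<in>N. \<exists>q<0. lbracket L e x = lscale L (of_real q) x)"

inductive_set orbit :: "('t \<Rightarrow> 'f \<Rightarrow> 'f) \<Rightarrow> 't set \<Rightarrow> 'f set \<Rightarrow> 'f set" for a A I
  where base: "i \<in> I \<Longrightarrow> i \<in> orbit a A I"
  | step: "y \<in> A \<Longrightarrow> f \<in> orbit a A I \<Longrightarrow> a y f \<in> orbit a A I"

text \<open>In the free vector space over \<open>U(L) \<times> S\<close> the relations of a Lie algebra action hold only modulo
  the tensor relations, so the action is axiomatised modulo a subspace \<open>R\<close>.\<close>

locale graded_action = operator_space scale L F a
  for scale :: "complex \<Rightarrow> 'b::ab_group_add \<Rightarrow> 'b" (infixr "*s" 75)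
    and L :: "'t::ab_group_add lie_algebra" and F a +
  fixes R :: "'b set" and e :: 't and P Z N :: "'t set"
  assumes R: "invariant R"
    and graded: "graded_by L e P Z N"
    and act_add: "x \<in> lcarrier L \<Longrightarrow> y \<in> lcarrier L \<Longrightarrow> f \<in> F \<Longrightarrow> a (x + y) f - (a x f + a y f) \<in> R"
    and act_scale: "x \<in> lcarrier L \<Longrightarrow> f \<in> F \<Longrightarrow> a (lscale L c x) f - c *s a x f \<in> R"
    and act_bracket: "x \<in> lcarrier L \<Longrightarrow> y \<in> lcarrier L \<Longrightarrow> f \<in> F \<Longrightarrow>
      a (lbracket L x y) f - (a x (a y f) - a y (a x f)) \<in> R"
begin

lemma R': "subspace R" "R \<subseteq> F" "x \<in> lcarrier L \<Longrightarrow> r \<in> R \<Longrightarrow> a x r \<in> R"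
  using R unfolding invariant_def by blast+

lemma graded':
  "e \<in> lcarrier L" "P \<subseteq> lcarrier L" "Z \<subseteq> lcarrier L" "N \<subseteq> lcarrier L"
  "x \<in> lcarrier L \<Longrightarrow> y \<in> lcarrier L \<Longrightarrow> lbracket L x y \<in> lcarrier L"
  using graded unfolding graded_by_def by blast+

sublocale L: complex_space "lscale L"
  using graded unfolding graded_by_def complex_space_def by blast

lemma subspace_L: "L.subspace (lcarrier L)"
  using graded unfolding graded_by_def by blast

abbreviation E where "E c \<equiv> eig (*s) F R (a e) c"

lemma subspace_E: "subspace (E c)"
  by (intro subspace_eig[OF subspace_F endo[OF graded'(1)]] R')

lemma R_subset_E: "R \<subseteq> E c"
  using R' subspace_diff[OF R'(1)] subspace_scale[OF R'(1)] graded'(1) by (auto simp: eig_def)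

lemma act_shifts_eigenvalue:
  assumes y: "y \<in> lcarrier L" "lbracket L e y = lscale L (of_real q) y" and f: "f \<in> E c"
  shows "a y f \<in> E (c + of_real q)"
proof -
  have fF: "f \<in> F" and fR: "a e f - c *s f \<in> R" using f by (auto simp: eig_def)
  note e = graded'(1)
  have 1: "a (lbracket L e y) f - (a e (a y f) - a y (a e f)) \<in> R" by (rule act_bracket[OF e y(1) fF])
  have 2: "a (lbracket L e y) f - of_real q *s a y f \<in> R" unfolding y(2) by (rule act_scale[OF y(1) fF])
  have "a y (a e f - c *s f) \<in> R" by (rule R'(3)[OF y(1) fR])
  moreover have "a y (a e f - c *s f) = a y (a e f) - c *s a y f"
    using F_closed e fF by (simp add: endo_diff[OF subspace_F endo[OF y(1)]] endo_scale[OF subspace_F endo[OF y(1)]])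
  ultimately have 3: "a y (a e f) - c *s a y f \<in> R" by simp
  have "(a (lbracket L e y) f - of_real q *s a y f) + (a y (a e f) - c *s a y f) -
      (a (lbracket L e y) f - (a e (a y f) - a y (a e f))) \<in> R"
    by (intro subspace_diff[OF R'(1)] subspace_add[OF R'(1)] 1 2 3)
  then show ?thesis using F_closed(5)[OF y(1) fF] by (simp add: eig_def algebra_simps)
qed

text \<open>The elements \<open>x\<close> with \<open>a x f\<close> in \<open>Y\<close> form a subspace of the Lie algebra.\<close>

lemma act_mem_of_generators:
  assumes Y: "subspace Y" "R \<subseteq> Y" and f: "f \<in> F"
    and gen: "\<And>x. x \<in> P \<union> Z \<union> N \<Longrightarrow> a x f \<in> Y" and x: "x \<in> lcarrier L"
  shows "a x f \<in> Y"
proof -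
  let ?U = "{x\<in>lcarrier L. a x f \<in> Y}"
  have mod: "g \<in> Y" if "g - h \<in> R" "h \<in> Y" for g h
    using subspace_add[OF Y(1), of "g - h" h] that Y(2) by auto
  have "L.subspace ?U"
  proof (rule L.subspaceI)
    have "0 *s a 0 f \<in> Y" using subspace_0[OF Y(1)] by simp
    then show "0 \<in> ?U" using mod[OF act_scale[OF x f, of 0]] L.subspace_0[OF subspace_L] subspace_0[OF Y(1)] by simp
    show "x + y \<in> ?U" if "x \<in> ?U" "y \<in> ?U" for x y
      using that mod[OF act_add] f subspace_add[OF Y(1)] L.subspace_add[OF subspace_L] by simp
    show "lscale L c x \<in> ?U" if "x \<in> ?U" for c x
      using that mod[OF act_scale] f subspace_scale[OF Y(1)] L.subspace_scale[OF subspace_L] by simp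
  qed
  moreover have "P \<union> Z \<union> N \<subseteq> ?U" using gen graded' by auto
  ultimately have "L.span (P \<union> Z \<union> N) \<subseteq> ?U" by (intro L.span_minimal)
  moreover have "x \<in> L.span (P \<union> Z \<union> N)" using graded x unfolding graded_by_def by blast
  ultimately show ?thesis by blast
qed

lemma orbit_subset: "I \<subseteq> F \<Longrightarrow> A \<subseteq> lcarrier L \<Longrightarrow> orbit a A I \<subseteq> F"
proof
  fix f assume I: "I \<subseteq> F" and A: "A \<subseteq> lcarrier L" and "f \<in> orbit a A I"
  from this(3) show "f \<in> F"
    by induction (use I A F_closed(5) in auto)
qed

text \<open>Commuting \<open>x\<close> past the first factor of a product of lowering elements leads to a shorter
  product, acted upon by \<open>x\<close> and by a bracket with \<open>x\<close>. So induction on the length of the product,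
  for all \<open>x\<close> at once, shows that the span of the products is stable.\<close>

lemma span_orbit_invariant:
  assumes I: "I \<subseteq> F" and top: "\<And>x i. x \<in> P \<Longrightarrow> i \<in> I \<Longrightarrow> a x i \<in> R"
  shows "invariant (span (R \<union> orbit a (Z \<union> N) I))" (is "invariant ?Y")
proof -
  have ZN: "Z \<union> N \<subseteq> lcarrier L" using graded' by auto
  note OF = orbit_subset[OF I ZN]
  have Y: "subspace ?Y" "R \<subseteq> ?Y" "orbit a (Z \<union> N) I \<subseteq> ?Y"
    using span_superset[of "R \<union> orbit a (Z \<union> N) I"] by auto
  have YF: "?Y \<subseteq> F" using OF R' by (intro span_minimal subspace_F) auto
  have pre: "a x g \<in> ?Y" if x: "x \<in> lcarrier L" and o: "\<And>f. f \<in> orbit a (Z \<union> N) I \<Longrightarrow> a x f \<in> ?Y" and g: "g \<in> ?Y" for x g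
  proof -
    let ?U = "{g\<in>F. a x g \<in> ?Y}"
    note lin = endo_add[OF subspace_F endo[OF x]] endo_scale[OF subspace_F endo[OF x]] endo_0[OF subspace_F endo[OF x]]
    have "subspace ?U"
      by (rule subspaceI) (auto simp: lin F_closed intro: span_zero span_add span_scale)
    moreover have "R \<union> orbit a (Z \<union> N) I \<subseteq> ?U" using OF R'(2) R'(3)[OF x] Y o by auto
    ultimately have "?Y \<subseteq> ?U" by (intro span_minimal)
    with g show ?thesis by blast
  qed
  have low: "a y g \<in> ?Y" if y: "y \<in> Z \<union> N" and g: "g \<in> ?Y" for y g
  proof (rule pre[OF _ _ g])
    show "y \<in> lcarrier L" using y ZN by blast
    show "a y f \<in> ?Y" if "f \<in> orbit a (Z \<union> N) I" for f using orbit.step[OF y that] Y(3) by blast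
  qed
  have "\<forall>x\<in>lcarrier L. a x f \<in> ?Y" if "f \<in> orbit a (Z \<union> N) I" for f
    using that
  proof induction
    case (base i)
    have "a x i \<in> ?Y" if "x \<in> P \<union> Z \<union> N" for x
    proof (cases "x \<in> P")
      case True
      then show ?thesis using top base Y by blast
    next
      case False
      then show ?thesis using that base Y(3) by (auto intro: orbit.intros)
    qed
    then show ?case using act_mem_of_generators[OF Y(1,2)] I base by blast
  next
    case (step y f)
    then have y: "y \<in> lcarrier L" and f: "f \<in> F" using ZN OF by auto
    show ?case
    proof
      fix x assume x: "x \<in> lcarrier L"
      have "a (lbracket L x y) f - (a x (a y f) - a y (a x f)) \<in> ?Y"
        using act_bracket[OF x y f] Y(2) by blast
      moreover have "a (lbracket L x y) f \<in> ?Y" using step.IH graded'(5)[OF x y] by blast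
      moreover have "a y (a x f) \<in> ?Y" using step.IH x low step.hyps(1) by blast
      ultimately have "a (lbracket L x y) f + a y (a x f) - (a (lbracket L x y) f - (a x (a y f) - a y (a x f))) \<in> ?Y"
        by (rule span_diff[OF span_add, rotated 2])
      then show "a x (a y f) \<in> ?Y" by (simp add: algebra_simps)
    qed
  qed
  then have "a x g \<in> ?Y" if "x \<in> lcarrier L" "g \<in> ?Y" for x g using pre that by blast
  with YF show ?thesis unfolding invariant_def by auto
qed

end

section \<open>The highest component of an irreducible module\<close>

locale irreducible_graded_rep =
  fixes L :: "'t::ab_group_add lie_algebra" and s :: "complex \<Rightarrow> 'v::ab_group_add \<Rightarrow> 'v"
    and \<rho> :: "'t \<Rightarrow> 'v \<Rightarrow> 'v" and e :: 't and P Z N :: "'t set" and b :: complex and v\<^sub>0 :: 'v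
  assumes grading: "graded_by L e P Z N"
    and rep: "lie_representation L s \<rho>"
    and irr: "irreducible_module L (module_of s \<rho>)"
    and v\<^sub>0: "v\<^sub>0 \<noteq> 0" "v\<^sub>0 \<in> annihilated \<rho> P" "\<rho> e v\<^sub>0 = s b v\<^sub>0"
begin

sublocale V: complex_space s
  using rep by (simp add: lie_representation_def complex_space_def)

lemma \<rho>_add: "x \<in> lcarrier L \<Longrightarrow> \<rho> x (u + w) = \<rho> x u + \<rho> x w"
  and \<rho>_scale: "x \<in> lcarrier L \<Longrightarrow> \<rho> x (s c w) = s c (\<rho> x w)"
  using rep unfolding lie_representation_def Vector_Spaces.linear_iff by blast+

sublocale V: graded_action s L UNIV \<rho> "{0}" e P Z N
proof
  have rep0: "\<rho> x 0 = 0" if "x \<in> lcarrier L" for x using \<rho>_add[OF that, of 0 0] by simp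
  show "V.subspace UNIV" by simp
  show "linear_endo_on s UNIV (\<rho> x)" if "x \<in> lcarrier L" for x
    using that by (simp add: linear_endo_on_def \<rho>_add \<rho>_scale)
  show "graded_by L e P Z N" by (rule grading)
  show "\<rho> (x + y) f - (\<rho> x f + \<rho> y f) \<in> {0}" if "x \<in> lcarrier L" "y \<in> lcarrier L" for x y f
    using that rep by (simp add: lie_representation_def)
  show "\<rho> (lscale L c x) f - s c (\<rho> x f) \<in> {0}" if "x \<in> lcarrier L" for x f c
    using that rep by (simp add: lie_representation_def)
  show "\<rho> (lbracket L x y) f - (\<rho> x (\<rho> y f) - \<rho> y (\<rho> x f)) \<in> {0}"
    if "x \<in> lcarrier L" "y \<in> lcarrier L" for x y f
    using that rep by (simp add: lie_representation_def)
  interpret o: operator_space s L UNIV \<rho>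
    by unfold_locales fact+
  show "o.invariant {0}" using rep0 by (auto simp: o.invariant_def)
qed

lemma invariant_cases:
  assumes "V.invariant W" shows "W = {0} \<or> W = UNIV"
proof -
  have "lie_submodule L (module_of s \<rho>) W"
    using assms by (auto simp: V.invariant_def lie_submodule_def module_of_def
        V.subspace_0 V.subspace_add V.subspace_scale)
  with irr show ?thesis by (simp add: irreducible_module_def module_of_def)
qed

lemma E_iff: "w \<in> V.E c \<longleftrightarrow> \<rho> e w = s c w"
  by (simp add: eig_def)

lemma orbit_eigenvectors:
  assumes "w \<in> V.E c" "u \<in> orbit \<rho> (Z \<union> N) {w}"
  shows "\<exists>q\<le>0. u \<in> V.E (c + of_real q)"
  using assms(2)
proof induction
  case (base i)
  with assms(1) show ?case by (intro exI[of _ 0]) auto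
next
  case (step y f)
  then obtain q where q: "q \<le> 0" "f \<in> V.E (c + of_real q)" by blast
  obtain p where p: "p \<le> 0" "lbracket L e y = lscale L (of_real p) y"
    using step.hyps(1) grading unfolding graded_by_def by (metis UnE less_imp_le order_refl)
  have "y \<in> lcarrier L" using step.hyps(1) V.graded' by blast
  from V.act_shifts_eigenvalue[OF this p(2) q(2)] p q show ?case
    by (intro exI[of _ "q + p"]) (auto simp: add.assoc)
qed

text \<open>The products of elements of non-positive degree applied to \<open>w\<close> span a submodule.\<close>

lemma spanned_below_highest_vector:
  assumes w: "w \<noteq> 0" "w \<in> annihilated \<rho> P" "w \<in> V.E c"
  shows "V.span (\<Union>d\<in>{c + of_real q | q. q \<le> 0}. V.E d) = UNIV"
proof -
  let ?Y = "V.span ({0} \<union> orbit \<rho> (Z \<union> N) {w})"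
  have "V.invariant ?Y"
    by (rule V.span_orbit_invariant) (use w in \<open>auto simp: annihilated_def\<close>)
  moreover have "w \<in> ?Y" by (intro V.span_base) (auto intro: orbit.base)
  ultimately have "?Y = UNIV" using invariant_cases w(1) by blast
  moreover have "{0} \<union> orbit \<rho> (Z \<union> N) {w} \<subseteq> V.span (\<Union>d\<in>{c + of_real q | q. q \<le> 0}. V.E d)"
  proof
    fix u assume "u \<in> {0} \<union> orbit \<rho> (Z \<union> N) {w}"
    then show "u \<in> V.span (\<Union>d\<in>{c + of_real q | q. q \<le> 0}. V.E d)"
    proof
      assume "u \<in> orbit \<rho> (Z \<union> N) {w}"
      from orbit_eigenvectors[OF w(3) this] obtain q where "q \<le> 0" "u \<in> V.E (c + of_real q)" by blast
      then show ?thesis by (intro V.span_base) blast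
    qed (simp add: V.span_zero)
  qed
  ultimately show ?thesis using V.span_minimal[OF _ V.subspace_span] by blast
qed

lemma eigenvalue_below_highest:
  assumes w: "w \<noteq> 0" "w \<in> annihilated \<rho> P" "w \<in> V.E c" and u: "u \<noteq> 0" "u \<in> V.E d"
  shows "\<exists>q\<le>0. d = c + of_real q"
proof -
  have "u \<in> V.span (\<Union>d\<in>{c + of_real q | q. q \<le> 0}. V.E d)"
    unfolding spanned_below_highest_vector[OF w] by simp
  then have "d \<in> {c + of_real q | q. q \<le> 0}"
    by (rule V.eigenvalue_of_span[OF V.subspace_F V.endo[OF V.graded'(1)]]) (use u in \<open>simp_all add: E_iff\<close>)
  then show ?thesis by blast
qed

text \<open>The annihilator of \<open>P\<close> is stable under \<open>e\<close>, so it is the sum of its eigenspaces. The eigenvalue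
  of any eigenvector in it dominates all eigenvalues on \<open>V\<close>; by symmetry all these eigenvalues agree.
  Conversely, an element of \<open>P\<close> would raise the top eigenvalue.\<close>

lemma highest_component: "annihilated \<rho> P = V.E b"
proof
  have v0: "v\<^sub>0 \<in> V.E b" using v\<^sub>0 by (simp add: E_iff)
  note below = eigenvalue_below_highest[OF v\<^sub>0(1,2) v0]
  have sub: "V.subspace (annihilated \<rho> P)"
  proof -
    have P: "\<And>x. x \<in> P \<Longrightarrow> x \<in> lcarrier L" using V.graded' by blast
    show ?thesis
      by (rule V.subspaceI) (auto simp: annihilated_def \<rho>_add[OF P] \<rho>_scale[OF P]
          V.endo_0[OF V.subspace_F V.endo[OF P]])
  qed
  have stable: "\<rho> e ` annihilated \<rho> P \<subseteq> annihilated \<rho> P"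
  proof -
    have "\<rho> x (\<rho> e w) = 0" if w: "w \<in> annihilated \<rho> P" and x: "x \<in> P" for w x
    proof -
      have xL: "x \<in> lcarrier L" and e: "e \<in> lcarrier L" using x V.graded' by blast+
      obtain q where "lbracket L e x = lscale L (of_real q) x" using x grading unfolding graded_by_def by blast
      then have "\<rho> e (\<rho> x w) - \<rho> x (\<rho> e w) = s (of_real q) (\<rho> x w)"
        using V.act_bracket[OF e xL, of w] V.act_scale[OF xL, of w "of_real q"] by simp
      with w x show ?thesis using V.endo_0[OF V.subspace_F V.endo[OF e]] by (simp add: annihilated_def)
    qed
    then show ?thesis by (auto simp: annihilated_def)
  qed
  show "annihilated \<rho> P \<subseteq> V.E b"
  proof
    fix w assume w: "w \<in> annihilated \<rho> P"
    have "w \<in> V.span (\<Union>d\<in>{b + of_real q | q. q \<le> 0}. V.E d)"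
      unfolding spanned_below_highest_vector[OF v\<^sub>0(1,2) v0] by simp
    then obtain C g where C: "finite C" "\<And>k. k \<in> C \<Longrightarrow> g k \<in> V.E k" "w = sum g C"
      by (rule V.span_eig_sum[OF V.subspace_F V.endo[OF V.graded'(1)] V.R'(1)]) blast
    have "g k \<in> V.E b" if k: "k \<in> C" for k
    proof (cases "g k = 0")
      case False
      have ann: "g k \<in> annihilated \<rho> P"
        using w C(3)
        by (intro V.eigen_components[OF V.subspace_F V.endo[OF V.graded'(1)] V.R'(1) sub _ stable C(1,2) _ k])
           (auto simp: V.subspace_0[OF sub])
      obtain q where q: "q \<le> 0" "k = b + of_real q" using below[OF False C(2)[OF k]] by blast
      obtain p where p: "p \<le> 0" "b = k + of_real p"
        using eigenvalue_below_highest[OF False ann C(2)[OF k] v\<^sub>0(1) v0] by blast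
      have "complex_of_real (q + p) = 0" using q p by (simp add: add.commute)
      then have "q + p = 0" by (simp only: of_real_eq_0_iff)
      with q p have "k = b" by simp
      then show ?thesis using C(2)[OF k] by simp
    qed (simp add: V.subspace_0[OF V.subspace_E])
    then show "w \<in> V.E b" unfolding C(3) by (intro V.subspace_sum[OF V.subspace_E])
  qed
  show "V.E b \<subseteq> annihilated \<rho> P"
  proof
    fix w assume w: "w \<in> V.E b"
    have "\<rho> x w = 0" if x: "x \<in> P" for x
    proof (rule ccontr)
      assume n: "\<rho> x w \<noteq> 0"
      have xL: "x \<in> lcarrier L" using x V.graded' by blast
      obtain q where q: "q > 0" "lbracket L e x = lscale L (of_real q) x"
        using x grading unfolding graded_by_def by blast
      obtain p where p: "p \<le> 0" "b + of_real q = b + of_real p"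
        using below[OF n V.act_shifts_eigenvalue[OF xL q(2) w]] by blast
      then have "q = p" by simp
      with p q show False by simp
    qed
    then show "w \<in> annihilated \<rho> P" by (simp add: annihilated_def)
  qed
qed

lemma degree_0_stable: "x \<in> Z \<Longrightarrow> w \<in> annihilated \<rho> P \<Longrightarrow> \<rho> x w \<in> annihilated \<rho> P"
proof -
  assume x: "x \<in> Z" and w: "w \<in> annihilated \<rho> P"
  have "lbracket L e x = lscale L (of_real 0) x" using x grading unfolding graded_by_def by blast
  moreover have "x \<in> lcarrier L" using x V.graded' by blast
  ultimately show ?thesis
    using V.act_shifts_eigenvalue[of x 0 w b] w unfolding highest_component by simp
qed

end

text \<open>The properties of an induced module that determine its maximal submodules: \<open>F\<close> modulo \<open>R\<close> is
  generated by the image under \<open>\<iota>\<close> of the highest component, on which the non-negative part acts as on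
  \<open>V\<close>, and \<open>\<pi>\<close> is a homomorphism to \<open>V\<close> with \<open>\<pi> (\<iota> w) = w\<close>.\<close>

locale highest_cover = irreducible_graded_rep L s \<rho> e P Z N b v\<^sub>0 +
  M: graded_action scale L F a R e P Z N
  for L :: "'t::ab_group_add lie_algebra" and s :: "complex \<Rightarrow> 'v::ab_group_add \<Rightarrow> 'v"
    and \<rho> e P Z N b v\<^sub>0 and scale :: "complex \<Rightarrow> 'f::ab_group_add \<Rightarrow> 'f" and F a R +
  fixes \<iota> :: "'v \<Rightarrow> 'f" and \<pi> :: "'f \<Rightarrow> 'v"
  assumes \<iota>_mem: "w \<in> annihilated \<rho> P \<Longrightarrow> \<iota> w \<in> F"
    and \<iota>_add: "u \<in> annihilated \<rho> P \<Longrightarrow> w \<in> annihilated \<rho> P \<Longrightarrow> \<iota> (u + w) - (\<iota> u + \<iota> w) \<in> R"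
    and \<iota>_scale: "w \<in> annihilated \<rho> P \<Longrightarrow> \<iota> (s c w) - scale c (\<iota> w) \<in> R"
    and \<iota>_act: "w \<in> annihilated \<rho> P \<Longrightarrow> x \<in> insert e (P \<union> Z) \<Longrightarrow> a x (\<iota> w) - \<iota> (\<rho> x w) \<in> R"
    and \<pi>_add: "f \<in> F \<Longrightarrow> g \<in> F \<Longrightarrow> \<pi> (f + g) = \<pi> f + \<pi> g"
    and \<pi>_scale: "f \<in> F \<Longrightarrow> \<pi> (scale c f) = s c (\<pi> f)"
    and \<pi>_R: "r \<in> R \<Longrightarrow> \<pi> r = 0"
    and \<pi>_act: "x \<in> lcarrier L \<Longrightarrow> f \<in> F \<Longrightarrow> \<pi> (a x f) = \<rho> x (\<pi> f)"
    and \<pi>_\<iota>: "w \<in> annihilated \<rho> P \<Longrightarrow> \<pi> (\<iota> w) = w"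
    and generated: "M.invariant W \<Longrightarrow> R \<subseteq> W \<Longrightarrow> \<iota> ` annihilated \<rho> P \<subseteq> W \<Longrightarrow> W = F"
begin

abbreviation "S \<equiv> annihilated \<rho> P"

lemma subspace_S: "V.subspace S"
  unfolding highest_component by (rule V.subspace_E)

lemma \<iota>_0: "\<iota> 0 \<in> R"
  using \<iota>_scale[OF V.subspace_0[OF subspace_S], of 0] by simp

lemma \<iota>_eigenvector: "w \<in> S \<Longrightarrow> \<iota> w \<in> M.E b"
proof -
  assume w: "w \<in> S"
  then have "\<rho> e w = s b w" unfolding highest_component E_iff .
  then have "(a e (\<iota> w) - \<iota> (s b w)) + (\<iota> (s b w) - scale b (\<iota> w)) \<in> R"
    using \<iota>_act[OF w, of e] \<iota>_scale[OF w, of b] by (intro M.subspace_add[OF M.R'(1)]) auto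
  then show ?thesis using \<iota>_mem[OF w] by (simp add: eig_def)
qed

definition "lower = M.span (\<Union>c\<in>{b + of_real q | q. q < 0}. M.E c)"

lemma E_subset_lower: "q < 0 \<Longrightarrow> M.E (b + of_real q) \<subseteq> lower"
  unfolding lower_def by (intro subsetI M.span_base) blast

lemma R_subset_lower: "R \<subseteq> lower"
  using M.R_subset_E E_subset_lower[of "-1"] by auto

text \<open>A product that contains a factor of negative degree has a lower eigenvalue; the other products stay in
  the copy of the highest component.\<close>

lemma orbit_top_or_lower:
  assumes "f \<in> orbit a (Z \<union> N) (\<iota> ` S)"
  shows "(\<exists>w\<in>S. f - \<iota> w \<in> R) \<or> (\<exists>q<0. f \<in> M.E (b + of_real q))"
  using assms
proof induction
  case (base i)
  then obtain w where "w \<in> S" "i = \<iota> w" by blast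
  then show ?case using M.subspace_0[OF M.R'(1)] by (intro disjI1 bexI[of _ w]) simp_all
next
  case (step y f)
  have y: "y \<in> lcarrier L" using step.hyps(1) M.graded' by blast
  obtain p where p: "p \<le> 0" "lbracket L e y = lscale L (of_real p) y" "y \<in> N \<Longrightarrow> p < 0 \<or> y \<in> Z"
    using step.hyps(1) grading unfolding graded_by_def by (metis UnE less_imp_le order_refl)
  from step.IH show ?case
  proof (elim disjE bexE exE conjE)
    fix q assume "q < 0" "f \<in> M.E (b + of_real q)"
    with M.act_shifts_eigenvalue[OF y p(2) this(2)] p(1) show ?thesis
      by (intro disjI2 exI[of _ "q + p"]) (auto simp: add.assoc)
  next
    fix w assume w: "w \<in> S" "f - \<iota> w \<in> R"
    have \<iota>F: "\<iota> w \<in> F" using w \<iota>_mem by blast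
    have "f - \<iota> w + \<iota> w \<in> F" using M.R'(2) w(2) \<iota>F by (intro M.F_closed(2)) auto
    then have fF: "f \<in> F" by simp
    have 1: "a y f - a y (\<iota> w) \<in> R"
      using M.R'(3)[OF y w(2)] M.endo_diff[OF M.subspace_F M.endo[OF y] fF \<iota>F] by simp
    show ?thesis
    proof (cases "y \<in> Z")
      case True
      have "(a y f - a y (\<iota> w)) + (a y (\<iota> w) - \<iota> (\<rho> y w)) \<in> R"
        using 1 \<iota>_act[OF w(1), of y] True by (intro M.subspace_add[OF M.R'(1)]) auto
      then show ?thesis using degree_0_stable[OF True w(1)] by auto
    next
      case False
      then have "p < 0" using p(3) step.hyps(1) by blast
      have "f - \<iota> w + \<iota> w \<in> M.E b"
        using M.R_subset_E w \<iota>_eigenvector by (intro M.subspace_add[OF M.subspace_E]) auto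
      then have "a y f \<in> M.E (b + of_real p)" using M.act_shifts_eigenvalue[OF y p(2)] by simp
      with \<open>p < 0\<close> show ?thesis by blast
    qed
  qed
qed

lemma top_plus_lower:
  assumes "f \<in> F" shows "\<exists>w\<in>S. f - \<iota> w \<in> lower"
proof -
  let ?I = "\<iota> ` S"
  let ?U = "{f\<in>F. \<exists>w\<in>S. f - \<iota> w \<in> lower}"
  let ?Y = "M.span (R \<union> orbit a (Z \<union> N) ?I)"
  have IF: "?I \<subseteq> F" using \<iota>_mem by blast
  have ZN: "Z \<union> N \<subseteq> lcarrier L" using M.graded' by blast
  have low: "M.subspace lower" unfolding lower_def by simp
  have "M.invariant ?Y"
  proof (rule M.span_orbit_invariant[OF IF])
    fix x i assume x: "x \<in> P" and "i \<in> ?I"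
    then obtain w where w: "w \<in> S" "i = \<iota> w" by blast
    have "\<rho> x w = 0" using w x by (simp add: annihilated_def)
    then have "(a x (\<iota> w) - \<iota> (\<rho> x w)) + \<iota> 0 = a x i" using w by simp
    moreover have "(a x (\<iota> w) - \<iota> (\<rho> x w)) + \<iota> 0 \<in> R"
      using \<iota>_act[OF w(1), of x] x \<iota>_0 by (intro M.subspace_add[OF M.R'(1)]) auto
    ultimately show "a x i \<in> R" by simp
  qed
  moreover have "R \<subseteq> ?Y" "?I \<subseteq> ?Y" using M.span_superset[of "R \<union> orbit a (Z \<union> N) ?I"] orbit.base[of _ ?I] by blast+
  ultimately have "?Y = F" by (rule generated)
  moreover have "M.subspace ?U"
  proof (rule M.subspaceI)
    have "0 - \<iota> 0 \<in> lower" using M.subspace_diff[OF low M.subspace_0[OF low]] \<iota>_0 R_subset_lower by blast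
    then show "0 \<in> ?U" using M.F_closed(1) V.subspace_0[OF subspace_S] by blast
  next
    fix f g assume "f \<in> ?U" "g \<in> ?U"
    then obtain u w where *: "f \<in> F" "g \<in> F" "u \<in> S" "w \<in> S" "f - \<iota> u \<in> lower" "g - \<iota> w \<in> lower" by blast
    have "(f - \<iota> u) + (g - \<iota> w) - (\<iota> (u + w) - (\<iota> u + \<iota> w)) \<in> lower"
      by (rule M.subspace_diff[OF low M.subspace_add[OF low *(5,6)] subsetD[OF R_subset_lower \<iota>_add[OF *(3,4)]]])
    then have "f + g - \<iota> (u + w) \<in> lower" by (simp add: algebra_simps)
    then show "f + g \<in> ?U" using * M.F_closed(2) V.subspace_add[OF subspace_S] by blast
  next
    fix f c assume "f \<in> ?U"
    then obtain u where *: "f \<in> F" "u \<in> S" "f - \<iota> u \<in> lower" by blast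
    have "scale c (f - \<iota> u) - (\<iota> (s c u) - scale c (\<iota> u)) \<in> lower"
      by (rule M.subspace_diff[OF low M.subspace_scale[OF low *(3)] subsetD[OF R_subset_lower \<iota>_scale[OF *(2)]]])
    then have "scale c f - \<iota> (s c u) \<in> lower" by (simp add: algebra_simps)
    then show "scale c f \<in> ?U" using * M.F_closed(4) V.subspace_scale[OF subspace_S] by blast
  qed
  moreover have "R \<union> orbit a (Z \<union> N) ?I \<subseteq> ?U"
  proof
    fix f assume f: "f \<in> R \<union> orbit a (Z \<union> N) ?I"
    then have "f \<in> F" using M.R'(2) M.orbit_subset[OF IF ZN] by blast
    moreover have "(\<exists>w\<in>S. f - \<iota> w \<in> lower) \<or> f \<in> lower"
      using f orbit_top_or_lower E_subset_lower R_subset_lower by blast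
    moreover have "f - \<iota> 0 \<in> lower" if "f \<in> lower"
      using M.subspace_diff[OF low that] \<iota>_0 R_subset_lower by blast
    ultimately show "f \<in> ?U" using V.subspace_0[OF subspace_S] by blast
  qed
  ultimately have "F \<subseteq> ?U" using M.span_minimal[of "R \<union> orbit a (Z \<union> N) ?I" ?U] by simp
  with assms show ?thesis by blast
qed

lemma invariant_image:
  assumes W: "M.invariant W" shows "V.invariant (\<pi> ` W)"
proof -
  have W': "M.subspace W" "W \<subseteq> F" "\<And>x f. x \<in> lcarrier L \<Longrightarrow> f \<in> W \<Longrightarrow> a x f \<in> W"
    using W unfolding M.invariant_def by blast+
  have "V.subspace (\<pi> ` W)"
  proof (rule V.subspaceI)
    show "0 \<in> \<pi> ` W" using \<pi>_R[OF M.subspace_0[OF M.R'(1)]] M.subspace_0[OF W'(1)] by force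
    show "u + w \<in> \<pi> ` W" if uw: "u \<in> \<pi> ` W" "w \<in> \<pi> ` W" for u w
    proof -
      obtain f g where fg: "f \<in> W" "g \<in> W" "u = \<pi> f" "w = \<pi> g" using uw by blast
      moreover have "f \<in> F" "g \<in> F" using fg W'(2) by blast+
      ultimately have "u + w = \<pi> (f + g)" by (simp add: \<pi>_add)
      then show ?thesis using M.subspace_add[OF W'(1) fg(1,2)] by blast
    qed
    show "s c u \<in> \<pi> ` W" if u: "u \<in> \<pi> ` W" for c u
    proof -
      obtain f where f: "f \<in> W" "u = \<pi> f" using u by blast
      then have "s c u = \<pi> (scale c f)" using \<pi>_scale W'(2) by auto
      then show ?thesis using M.subspace_scale[OF W'(1) f(1)] by blast
    qed
  qed
  moreover have "\<rho> x u \<in> \<pi> ` W" if x: "x \<in> lcarrier L" and u: "u \<in> \<pi> ` W" for x u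
  proof -
    obtain f where f: "f \<in> W" "u = \<pi> f" using u by blast
    then have "\<rho> x u = \<pi> (a x f)" using \<pi>_act[OF x] W'(2) by auto
    then show ?thesis using W'(3)[OF x f(1)] by blast
  qed
  ultimately show ?thesis unfolding V.invariant_def by blast
qed

definition "eval_kernel = {f\<in>F. \<pi> f = 0}"

lemma kernel_invariant: "M.invariant eval_kernel"
proof -
  have "\<pi> 0 = 0" using \<pi>_R[OF M.subspace_0[OF M.R'(1)]] .
  then have "M.subspace eval_kernel"
    unfolding eval_kernel_def by (intro M.subspaceI) (auto simp: \<pi>_add \<pi>_scale M.F_closed)
  moreover have "a x f \<in> eval_kernel" if "x \<in> lcarrier L" "f \<in> eval_kernel" for x f
    using that V.endo_0[OF V.subspace_F V.endo[OF that(1)]] by (simp add: eval_kernel_def \<pi>_act M.F_closed)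
  ultimately show ?thesis unfolding M.invariant_def eval_kernel_def by blast
qed

lemma surjective: "\<pi> ` F = UNIV"
proof -
  have "M.invariant F" unfolding M.invariant_def using M.subspace_F M.F_closed(5) by blast
  moreover have "v\<^sub>0 \<in> \<pi> ` F" using \<pi>_\<iota>[OF v\<^sub>0(2)] \<iota>_mem[OF v\<^sub>0(2)] by force
  ultimately show ?thesis using invariant_cases[OF invariant_image] v\<^sub>0(1) by blast
qed

lemma module_presented: "M.presented (module_of s \<rho>) \<pi> eval_kernel"
proof -
  have "\<pi> (f - g) = \<pi> f - \<pi> g" if "f \<in> F" "g \<in> F" for f g
    using \<pi>_add[of "f - g" g] M.F_closed(3)[OF that] that by (simp add: algebra_simps)
  then show ?thesis
    unfolding presents_def using surjective \<pi>_R[OF M.subspace_0[OF M.R'(1)]]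
    by (auto simp: eval_kernel_def module_of_def \<pi>_add \<pi>_scale \<pi>_act M.F_closed)
qed

text \<open>If \<open>W\<close> maps onto \<open>V\<close>, then every \<open>v\<close> in the highest component is the image of some \<open>f\<close> in \<open>W\<close>. The
  top component of \<open>f\<close> is \<open>\<iota> w\<close> for some \<open>w\<close>, and it lies in \<open>W\<close>. Comparing top components in \<open>V\<close> gives
  \<open>w = v\<close>. So \<open>W\<close> contains the copy of the highest component, which generates everything.\<close>

lemma proper_invariant_subset_kernel:
  assumes W: "M.invariant W" "R \<subseteq> W" "W \<noteq> F"
  shows "W \<subseteq> eval_kernel"
proof (rule ccontr)
  assume "\<not> W \<subseteq> eval_kernel"
  then obtain f0 where "f0 \<in> W" "\<pi> f0 \<noteq> 0" using W(1) unfolding eval_kernel_def M.invariant_def by blast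
  then have onto: "\<pi> ` W = UNIV" using invariant_cases[OF invariant_image[OF W(1)]] by blast
  have W': "M.subspace W" "W \<subseteq> F" "a e ` W \<subseteq> W" using W M.graded'(1) unfolding M.invariant_def by blast+
  note e = M.graded'(1)
  have "\<iota> v \<in> W" if v: "v \<in> S" for v
  proof -
    obtain f where f: "f \<in> W" "\<pi> f = v" using onto by (metis UNIV_I imageE)
    then have fF: "f \<in> F" using W' by blast
    obtain w where w: "w \<in> S" "f - \<iota> w \<in> lower" using top_plus_lower[OF fF] by blast
    from w(2)[unfolded lower_def] obtain C g where C: "finite C" "C \<subseteq> {b + of_real q | q. q < 0}"
      "\<And>k. k \<in> C \<Longrightarrow> g k \<in> M.E k" "f - \<iota> w = sum g C"
      by (rule M.span_eig_sum[OF M.subspace_F M.endo[OF e] M.R'(1)]) blast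
    have b: "b \<notin> C" using C(2) by auto
    let ?g = "g(b := \<iota> w)"
    have gE: "?g k \<in> M.E k" if "k \<in> insert b C" for k
      using that C(3) \<iota>_eigenvector[OF w(1)] by auto
    have sum: "sum ?g (insert b C) = f"
    proof -
      have "sum ?g C = sum g C" using b by (intro sum.cong) auto
      then show ?thesis using b C(1) C(4)[symmetric] by simp
    qed
    have "?g b \<in> W"
      by (rule M.eigen_components[where C = "insert b C", OF M.subspace_F M.endo[OF e] M.R'(1) W'(1) W(2) W'(3) _ gE])
         (use C(1) sum f in auto)
    then have \<iota>w: "\<iota> w \<in> W" by simp
    have \<pi>sum: "\<pi> (sum h A) = (\<Sum>k\<in>A. \<pi> (h k))" if "finite A" "\<And>k. k \<in> A \<Longrightarrow> h k \<in> F" for h and A :: "complex set"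
      using that
    proof (induction A rule: finite_induct)
      case empty
      then show ?case using \<pi>_R[OF M.subspace_0[OF M.R'(1)]] by simp
    next
      case (insert k A)
      then show ?case by (simp add: \<pi>_add M.subspace_sum[OF M.subspace_F])
    qed
    \<comment> \<open>The components of \<open>\<pi> f - v = 0\<close>.\<close>
    let ?h = "\<lambda>k. if k = b then w - v else \<pi> (g k)"
    have hE: "?h k \<in> V.E k" if k: "k \<in> insert b C" for k
    proof (cases "k = b")
      case True
      then show ?thesis using w v V.subspace_diff[OF V.subspace_E] unfolding highest_component by simp
    next
      case False
      then have "g k \<in> F" "a e (g k) - scale k (g k) \<in> R" using C(3) k by (auto simp: eig_def)
      then have "\<pi> (a e (g k) - scale k (g k)) = 0" "a e (g k) \<in> F" "scale k (g k) \<in> F"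
        using \<pi>_R M.F_closed e by auto
      then have "\<pi> (a e (g k)) = \<pi> (scale k (g k))"
        using \<pi>_add[of "a e (g k) - scale k (g k)" "scale k (g k)"] M.F_closed(3) by simp
      then show ?thesis using False \<open>g k \<in> F\<close> e by (simp add: E_iff \<pi>_act \<pi>_scale)
    qed
    have gF: "g k \<in> F" if "k \<in> C" for k using C(3)[OF that] by (simp add: eig_def)
    have "v = \<pi> (sum g C + \<iota> w)" using f(2) C(4) by (metis diff_add_cancel)
    also have "\<dots> = (\<Sum>k\<in>C. \<pi> (g k)) + w"
      using \<pi>_add[of "sum g C" "\<iota> w"] \<pi>sum[OF C(1), of g] gF \<iota>_mem[OF w(1)] \<pi>_\<iota>[OF w(1)]
      by (simp add: M.subspace_sum[OF M.subspace_F])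
    finally have "(\<Sum>k\<in>C. \<pi> (g k)) + w - v = 0" by simp
    moreover have "(\<Sum>k\<in>C. ?h k) = (\<Sum>k\<in>C. \<pi> (g k))" using b by (intro sum.cong) auto
    ultimately have sum0: "sum ?h (insert b C) \<in> {0}" using b C(1) by (simp add: algebra_simps)
    have "?h b \<in> {0}"
      by (rule V.eigen_components[where C = "insert b C" and g = ?h, OF V.subspace_F V.endo[OF e] V.R'(1) V.R'(1) order_refl _ _ hE sum0])
         (use C(1) V.R'(3)[OF e] in auto)
    then have "w = v" by simp
    with \<iota>w show ?thesis by simp
  qed
  then have "W = F" using generated[OF W(1,2)] by blast
  with W(3) show False by blast
qed

lemma unique_irreducible_quotient_of_cover:
  assumes X: "M.presented X \<kappa> R"
  shows "(\<exists>!N. irreducible_quotient_by L X N) \<and>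
    module_iso L (module_of s \<rho>) (irreducible_quotient L X)"
proof (rule M.unique_irreducible_quotient[OF X M.R module_presented kernel_invariant irr])
  show "R \<subseteq> eval_kernel" using M.R'(2) \<pi>_R by (auto simp: eval_kernel_def)
qed (rule proper_invariant_subset_kernel)

end

section \<open>Free modules and enveloping algebras\<close>

interpretation pm: complex_space pscale
  by (rule complex_space.intro) (rule vector_space_pscale)

context complex_space
begin

text \<open>The linear extension of \<open>h\<close> to the vector space with basis \<open>'k\<close>. The action of the free algebra,
  the left multiplications and the evaluation map are all of this form.\<close>

definition linext :: "('k \<Rightarrow> 'b) \<Rightarrow> ('k \<Rightarrow>\<^sub>0 complex) \<Rightarrow> 'b"
  where "linext h f = (\<Sum>k\<in>keys f. lookup f k *s h k)"

lemma linext_superset: "finite A \<Longrightarrow> keys f \<subseteq> A \<Longrightarrow> linext h f = (\<Sum>k\<in>A. lookup f k *s h k)"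
  unfolding linext_def by (rule sum.mono_neutral_left) (auto simp: in_keys_iff)

lemma linext_add: "linext h (f + g) = linext h f + linext h g"
proof -
  let ?A = "keys f \<union> keys g"
  have "keys (f + g) \<subseteq> ?A" by (rule keys_add)
  then show ?thesis
    by (simp add: linext_superset[of ?A] lookup_add scale_left_distrib sum.distrib)
qed

lemma linext_scale: "linext h (pscale c f) = c *s linext h f"
  by (subst linext_superset[of "keys f"]) (auto simp: in_keys_iff linext_def scale_sum_right)

lemma linext_single: "linext h (single k c) = c *s h k"
  by (subst linext_superset[of "{k}"]) auto

lemma linext_0: "linext h 0 = 0"
  by (simp add: linext_def)

lemma linext_diff: "linext h (f - g) = linext h f - linext h g"
  using linext_add[of h "f - g" g] by simp

end

lemma keys_pscale: "keys (pscale c f) \<subseteq> keys f"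
  by (auto simp: in_keys_iff)

lemma subspace_keys_subset: "pm.subspace {f. keys f \<subseteq> A}"
  by (rule pm.subspaceI) (use keys_add keys_pscale in \<open>force+\<close>)

lemma keys_subset_eq_span: "{f. keys f \<subseteq> A} = pm.span ((\<lambda>k. single k 1) ` A)"
proof
  show "pm.span ((\<lambda>k. single k 1) ` A) \<subseteq> {f. keys f \<subseteq> A}"
    by (rule pm.span_minimal[OF _ subspace_keys_subset]) auto
  have "f = pm.linext (\<lambda>k. single k 1) f" for f :: "'a \<Rightarrow>\<^sub>0 complex"
    by (rule poly_mapping_eqI)
      (auto simp: pm.linext_def lookup_sum lookup_single when_def in_keys_iff if_distrib cong: if_cong)
  then have eq: "f = (\<Sum>k\<in>keys f. pscale (lookup f k) (single k 1))" for f :: "'a \<Rightarrow>\<^sub>0 complex"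
    unfolding pm.linext_def .
  show "{f. keys f \<subseteq> A} \<subseteq> pm.span ((\<lambda>k. single k 1) ` A)"
  proof clarify
    fix f :: "'a \<Rightarrow>\<^sub>0 complex" assume "keys f \<subseteq> A"
    then show "f \<in> pm.span ((\<lambda>k. single k 1) ` A)"
      by (subst eq, intro pm.span_sum pm.span_scale pm.span_base) blast
  qed
qed

lemma keys_subset_induct [consumes 1, case_names base step]:
  assumes "keys f \<subseteq> A" and "Q 0"
    and "\<And>c k g. k \<in> A \<Longrightarrow> keys g \<subseteq> A \<Longrightarrow> Q g \<Longrightarrow> Q (pscale c (single k 1) + g)"
  shows "Q f"
proof -
  have "f \<in> pm.span ((\<lambda>k. single k 1) ` A)" using assms(1) keys_subset_eq_span by blast
  then have "keys f \<subseteq> A \<and> Q f"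
  proof (induction rule: pm.span_induct_alt)
    case base
    then show ?case using assms(2) by simp
  next
    case (step c x y)
    then obtain k where k: "k \<in> A" "x = single k 1" by blast
    have "pscale c x + y \<in> {f. keys f \<subseteq> A}"
      using step k pm.subspace_add[OF subspace_keys_subset[of A]] pm.subspace_scale[OF subspace_keys_subset[of A]]
      by (simp del: pscale_single)
    with k step show ?case using assms(3) by auto
  qed
  then show ?thesis by simp
qed

lemma pscale_eq_mult: "pscale c f = single 0 c * f" "pscale c f = f * single 0 c"
  for f :: "'a::monoid_add \<Rightarrow>\<^sub>0 complex"
proof -
  have "keys f \<subseteq> UNIV" by simp
  then have "pscale c f = single 0 c * f \<and> pscale c f = f * single 0 c"
    by (induction rule: keys_subset_induct)
      (auto simp: mult_single pm.scale_right_distrib distrib_left distrib_right mult.commute)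
  then show "pscale c f = single 0 c * f" "pscale c f = f * single 0 c" by auto
qed

lemma pscale_mult_left: "pscale c f * g = pscale c (f * g)"
  for f g :: "'a::monoid_add \<Rightarrow>\<^sub>0 complex"
  by (simp only: pscale_eq_mult(1) mult.assoc)

lemma pscale_mult_right: "f * pscale c g = pscale c (f * g)"
  for f g :: "'a::monoid_add \<Rightarrow>\<^sub>0 complex"
  by (simp only: pscale_mult_left[symmetric]) (simp only: pscale_eq_mult(2)[of c f] pscale_eq_mult(1)[of c g] mult.assoc)

lemma coset_eq_iff:
  assumes "module.subspace pscale N"
  shows "coset N f = coset N g \<longleftrightarrow> f - g \<in> N"
proof
  assume "coset N f = coset N g"
  moreover have "f \<in> coset N f" using pm.subspace_0[OF assms] by (simp add: coset_def)
  ultimately show "f - g \<in> N" by (simp add: coset_def)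
next
  assume d: "f - g \<in> N"
  have "y - f \<in> N \<longleftrightarrow> y - g \<in> N" for y
    using pm.subspace_add[OF assms _ d, of "y - f"] pm.subspace_diff[OF assms _ d, of "y - g"] by auto
  then show "coset N f = coset N g" by (simp add: coset_def)
qed

text \<open>The lifted operations are unions over representatives; they are cosets if the operation respects
  the subspace.\<close>

lemma lift1_coset:
  assumes N: "module.subspace pscale N" and "\<And>x. x - f \<in> N \<Longrightarrow> h x - h f \<in> N"
  shows "lift1 N h (coset N f) = coset N (h f)"
proof -
  have "coset N (h x) = coset N (h f)" if "x \<in> coset N f" for x
    using assms(2)[of x] that coset_eq_iff[OF N] by (simp add: coset_def)
  moreover have "f \<in> coset N f" using pm.subspace_0[OF N] by (simp add: coset_def)
  ultimately show ?thesis unfolding lift1_def by blast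
qed

lemma lift2_coset:
  assumes N: "module.subspace pscale N"
    and "\<And>x y. x - f \<in> N \<Longrightarrow> y - g \<in> N \<Longrightarrow> h x y - h f g \<in> N"
  shows "lift2 N h (coset N f) (coset N g) = coset N (h f g)"
proof -
  have "coset N (h x y) = coset N (h f g)" if "x \<in> coset N f" "y \<in> coset N g" for x y
    using assms(2)[of x y] that coset_eq_iff[OF N] by (simp add: coset_def)
  moreover have "f \<in> coset N f" "g \<in> coset N g" using pm.subspace_0[OF N] by (simp_all add: coset_def)
  ultimately show ?thesis unfolding lift2_def by blast
qed

lemma lift2_add_coset: "module.subspace pscale N \<Longrightarrow> lift2 N (+) (coset N f) (coset N g) = coset N (f + g)"
proof (rule lift2_coset)
  fix x y assume N: "module.subspace pscale N" and "x - f \<in> N" "y - g \<in> N"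
  then have "(x - f) + (y - g) \<in> N" by (blast intro: pm.subspace_add)
  then show "x + y - (f + g) \<in> N" by (simp add: algebra_simps)
qed

lemma lift1_scale_coset: "module.subspace pscale N \<Longrightarrow> lift1 N (pscale c) (coset N f) = coset N (pscale c f)"
proof (rule lift1_coset)
  fix x assume N: "module.subspace pscale N" and "x - f \<in> N"
  then have "pscale c (x - f) \<in> N" by (blast intro: pm.subspace_scale)
  then show "pscale c x - pscale c f \<in> N" by (simp add: pm.scale_right_diff_distrib)
qed

lemma free_algebra_eq: "free_algebra A = {f. keys f \<subseteq> {w. set (letters w) \<subseteq> A}}"
  by (auto simp: free_algebra_def)

lemma subspace_free_algebra: "pm.subspace (free_algebra A)"
  unfolding free_algebra_eq by (rule subspace_keys_subset)

lemma free_algebra_mult: "f \<in> free_algebra A \<Longrightarrow> g \<in> free_algebra A \<Longrightarrow> f * g \<in> free_algebra A"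
proof -
  assume *: "f \<in> free_algebra A" "g \<in> free_algebra A"
  have "set (letters w) \<subseteq> A" if w: "w \<in> keys (f * g)" for w
  proof -
    obtain u v where "u \<in> keys f" "v \<in> keys g" "w = u + v" using keys_mult[of f g] w by blast
    with * show ?thesis by (auto simp: free_algebra_def plus_word_def)
  qed
  then show ?thesis by (auto simp: free_algebra_def)
qed

lemma free_algebra_one: "1 \<in> free_algebra A"
  by (simp add: free_algebra_def zero_word_def)

lemma free_algebra_single: "set (letters w) \<subseteq> A \<Longrightarrow> single w c \<in> free_algebra A"
  by (simp add: free_algebra_def)

lemma free_algebra_gen: "x \<in> A \<Longrightarrow> gen x \<in> free_algebra A"
  by (simp add: free_algebra_def gen_def)

lemma free_algebra_mono: "A \<subseteq> B \<Longrightarrow> free_algebra A \<subseteq> free_algebra B"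
  by (auto simp: free_algebra_def)

locale lie_rep =
  fixes L :: "'t::ab_group_add lie_algebra" and s :: "complex \<Rightarrow> 'v::ab_group_add \<Rightarrow> 'v" and \<rho> :: "'t \<Rightarrow> 'v \<Rightarrow> 'v"
  assumes L: "vector_space (lscale L)" "module.subspace (lscale L) (lcarrier L)"
      "\<And>x y. x \<in> lcarrier L \<Longrightarrow> y \<in> lcarrier L \<Longrightarrow> lbracket L x y \<in> lcarrier L"
    and rep: "lie_representation L s \<rho>"
begin

sublocale L: complex_space "lscale L"
  using L(1) by (rule complex_space.intro)

sublocale V: complex_space s
  using rep by (simp add: lie_representation_def complex_space_def)

abbreviation "FA \<equiv> free_algebra (lcarrier L)"
abbreviation "U \<equiv> enveloping_algebra L"
abbreviation "cl \<equiv> env_class L"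

lemma \<rho>_add: "x \<in> lcarrier L \<Longrightarrow> \<rho> x (u + w) = \<rho> x u + \<rho> x w"
  and \<rho>_scale: "x \<in> lcarrier L \<Longrightarrow> \<rho> x (s c w) = s c (\<rho> x w)"
  using rep unfolding lie_representation_def Vector_Spaces.linear_iff by blast+

lemma FA_closed:
  "f \<in> FA \<Longrightarrow> g \<in> FA \<Longrightarrow> f + g \<in> FA" "f \<in> FA \<Longrightarrow> g \<in> FA \<Longrightarrow> f - g \<in> FA"
  "f \<in> FA \<Longrightarrow> pscale c f \<in> FA" "f \<in> FA \<Longrightarrow> g \<in> FA \<Longrightarrow> f * g \<in> FA" "1 \<in> FA" "0 \<in> FA"
  "x \<in> lcarrier L \<Longrightarrow> gen x \<in> FA"
  by (fact pm.subspace_add[OF subspace_free_algebra] pm.subspace_diff[OF subspace_free_algebra]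
    pm.subspace_scale[OF subspace_free_algebra] free_algebra_mult free_algebra_one free_algebra_gen
    pm.subspace_0[OF subspace_free_algebra])+

lemma L_closed: "x \<in> lcarrier L \<Longrightarrow> y \<in> lcarrier L \<Longrightarrow> x + y \<in> lcarrier L"
  "x \<in> lcarrier L \<Longrightarrow> lscale L c x \<in> lcarrier L"
  using L.subspace_add[OF L(2)] L.subspace_scale[OF L(2)] by blast+

lemma env_relations_subset: "env_relations L \<subseteq> FA"
  unfolding env_relations_def using L(3) L_closed by (auto intro!: FA_closed)

lemma subspace_J: "pm.subspace (env_ideal L)"
  by (simp add: env_ideal_def)

lemma env_ideal_subset: "env_ideal L \<subseteq> FA"
  unfolding env_ideal_def
  by (rule pm.span_minimal[OF _ subspace_free_algebra]) (use env_relations_subset FA_closed(4) in blast)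

lemma env_ideal_mult:
  assumes "x \<in> env_ideal L" "f \<in> FA"
  shows "f * x \<in> env_ideal L" "x * f \<in> env_ideal L"
proof -
  let ?G = "{a * r * b | a r b. a \<in> FA \<and> r \<in> env_relations L \<and> b \<in> FA}"
  have "f * x \<in> pm.span ?G \<and> x * f \<in> pm.span ?G"
    using assms(1) unfolding env_ideal_def
  proof (induction rule: pm.span_induct_alt)
    case base
    then show ?case by (simp add: pm.span_zero)
  next
    case (step c x y)
    then obtain a r b where x: "x = a * r * b" "a \<in> FA" "r \<in> env_relations L" "b \<in> FA" by blast
    have "f * x = (f * a) * r * b" "x * f = a * r * (b * f)" by (simp_all add: x mult.assoc)
    then have G: "f * x \<in> ?G" "x * f \<in> ?G" using x assms(2) FA_closed(4) by blast+
    from step.IH pm.span_base[OF G(1)] pm.span_base[OF G(2)] show ?case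
      unfolding distrib_left distrib_right pscale_mult_left pscale_mult_right
      by (intro conjI pm.span_add pm.span_scale) simp_all
  qed
  then show "f * x \<in> env_ideal L" "x * f \<in> env_ideal L" by (auto simp: env_ideal_def)
qed

lemma cl_eq_iff: "cl f = cl g \<longleftrightarrow> f - g \<in> env_ideal L"
  unfolding env_class_def by (rule coset_eq_iff[OF subspace_J])

lemma cl_in_U: "f \<in> FA \<Longrightarrow> cl f \<in> U"
  by (auto simp: enveloping_algebra_def)

lemma env_add_cl: "env_add L (cl f) (cl g) = cl (f + g)"
  unfolding env_add_def env_class_def by (rule lift2_add_coset[OF subspace_J])

lemma env_scale_cl: "env_scale L c (cl f) = cl (pscale c f)"
  unfolding env_scale_def env_class_def by (rule lift1_scale_coset[OF subspace_J])

lemma env_mult_cl: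
  assumes f: "f \<in> FA" and g: "g \<in> FA"
  shows "env_mult L (cl f) (cl g) = cl (f * g)"
  unfolding env_mult_def env_class_def
proof (rule lift2_coset[OF subspace_J])
  fix x y assume x: "x - f \<in> env_ideal L" and y: "y - g \<in> env_ideal L"
  have "(y - g) + g \<in> FA" using y env_ideal_subset g by (intro FA_closed(1)) auto
  then have "(x - f) * y + f * (y - g) \<in> env_ideal L"
    using env_ideal_mult[OF x, of y] env_ideal_mult[OF y f] by (intro pm.subspace_add[OF subspace_J]) auto
  then show "x * y - f * g \<in> env_ideal L" by (simp add: algebra_simps)
qed

lemma free_act_eq: "free_act s \<rho> f v = V.linext (\<lambda>w. foldr \<rho> (letters w) v) f"
  by (simp add: free_act_def V.linext_def)

lemma foldr_linear:
  assumes "set xs \<subseteq> lcarrier L"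
  shows "foldr \<rho> xs (u + w) = foldr \<rho> xs u + foldr \<rho> xs w" "foldr \<rho> xs (s c w) = s c (foldr \<rho> xs w)"
    "foldr \<rho> xs 0 = 0"
proof -
  have *: "\<rho> x 0 = 0" if "x \<in> lcarrier L" for x using \<rho>_add[OF that, of 0 0] by simp
  show "foldr \<rho> xs (u + w) = foldr \<rho> xs u + foldr \<rho> xs w" "foldr \<rho> xs (s c w) = s c (foldr \<rho> xs w)"
    "foldr \<rho> xs 0 = 0"
    using assms by (induction xs) (auto simp: \<rho>_add \<rho>_scale *)
qed

lemma free_act_linear:
  "free_act s \<rho> (f + g) v = free_act s \<rho> f v + free_act s \<rho> g v"
  "free_act s \<rho> (f - g) v = free_act s \<rho> f v - free_act s \<rho> g v"
  "free_act s \<rho> (pscale c f) v = s c (free_act s \<rho> f v)"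
  "free_act s \<rho> 0 v = 0"
  "free_act s \<rho> 1 v = v"
  "free_act s \<rho> (gen x) v = \<rho> x v"
  using V.linext_single[of "\<lambda>w. foldr \<rho> (letters w) v" "0::'t word" 1]
  by (auto simp: free_act_eq V.linext_add V.linext_diff V.linext_scale V.linext_0 gen_def V.linext_single zero_word_def
      simp flip: single_one)

lemma free_act_vector:
  assumes f: "f \<in> FA"
  shows "free_act s \<rho> f (u + w) = free_act s \<rho> f u + free_act s \<rho> f w"
    "free_act s \<rho> f (s c w) = s c (free_act s \<rho> f w)" "free_act s \<rho> f 0 = 0"
  using f unfolding free_act_def
  by (simp_all add: free_algebra_def foldr_linear V.scale_right_distrib sum.distrib V.scale_sum_right mult.commute)

lemma free_act_mult:
  assumes "f \<in> FA"
  shows "free_act s \<rho> (f * g) v = free_act s \<rho> f (free_act s \<rho> g v)"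
  using assms unfolding free_algebra_eq mem_Collect_eq
proof (induction rule: keys_subset_induct)
  case base
  show ?case by (simp add: free_act_linear)
next
  case (step c k f)
  have "free_act s \<rho> (single k 1 * g) v = foldr \<rho> (letters k) (free_act s \<rho> g v)"
  proof -
    have "keys g \<subseteq> UNIV" by simp
    then show ?thesis
    proof (induction rule: keys_subset_induct)
      case base
      show ?case using foldr_linear(3) step.hyps by (simp add: free_act_linear)
    next
      case (step d l g)
      have "free_act s \<rho> (single k 1 * single l 1) v = foldr \<rho> (letters k) (free_act s \<rho> (single l 1) v)"
        by (simp add: mult_single free_act_eq V.linext_single plus_word_def)
      with step \<open>k \<in> {w. set (letters w) \<subseteq> lcarrier L}\<close> show ?case
        by (simp del: pscale_single add: distrib_left pscale_mult_right free_act_linear foldr_linear)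
    qed
  qed
  moreover have "free_act s \<rho> (single k 1) u = foldr \<rho> (letters k) u" for u
    by (simp add: free_act_eq V.linext_single)
  ultimately show ?case using step
    by (simp del: pscale_single add: distrib_right pscale_mult_left free_act_linear)
qed

text \<open>The relations of the enveloping algebra hold for the operators \<open>\<rho> x\<close>.\<close>

lemma free_act_env_ideal:
  assumes "x \<in> env_ideal L" shows "free_act s \<rho> x v = 0"
  using assms unfolding env_ideal_def
proof (induction rule: pm.span_induct_alt)
  case base
  show ?case by (simp add: free_act_linear)
next
  case (step c x y)
  then obtain a r b where x: "x = a * r * b" "a \<in> FA" "r \<in> env_relations L" "b \<in> FA" by blast
  have "free_act s \<rho> r w = 0" for w
    using x(3) rep unfolding env_relations_def
    by (auto simp: free_act_linear free_act_mult FA_closed lie_representation_def)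
  moreover have "a * r \<in> FA" using FA_closed(4)[OF x(2)] x(3) env_relations_subset by blast
  ultimately have "free_act s \<rho> x v = 0" using x by (simp add: free_act_mult free_act_vector)
  with step show ?case by (simp add: free_act_linear)
qed

definition env_act :: "('t word \<Rightarrow>\<^sub>0 complex) set \<Rightarrow> 'v \<Rightarrow> 'v"
  where "env_act u v = free_act s \<rho> (SOME f. f \<in> FA \<and> cl f = u) v"

text \<open>Two representatives of a class differ by an element of the ideal, which acts as zero.\<close>

lemma env_act_cl: "f \<in> FA \<Longrightarrow> env_act (cl f) v = free_act s \<rho> f v"
proof -
  assume f: "f \<in> FA"
  define g where "g = (SOME g. g \<in> FA \<and> cl g = cl f)"
  have "g \<in> FA \<and> cl g = cl f" unfolding g_def by (rule someI[of _ f]) (use f in simp)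
  then have "g - f \<in> env_ideal L" using cl_eq_iff by blast
  then have "free_act s \<rho> (g - f) v = 0" by (rule free_act_env_ideal)
  then show ?thesis unfolding env_act_def g_def[symmetric] by (simp add: free_act_linear)
qed

end

section \<open>Induced modules\<close>

locale induced = lie_rep L s \<rho>
  for L :: "'t::ab_group_add lie_algebra" and s :: "complex \<Rightarrow> 'v::ab_group_add \<Rightarrow> 'v" and \<rho> +
  fixes B :: "'t set" and S :: "'v set"
  assumes B: "B \<subseteq> lcarrier L" and S: "V.subspace S" and stable: "\<And>x v. x \<in> B \<Longrightarrow> v \<in> S \<Longrightarrow> \<rho> x v \<in> S"
begin

abbreviation "F \<equiv> {f :: ('t word \<Rightarrow>\<^sub>0 complex) set \<times> 'v \<Rightarrow>\<^sub>0 complex. keys f \<subseteq> U \<times> S}"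
abbreviation "R \<equiv> tensor_ideal L B s \<rho> S"

lemma S_closed: "v \<in> S \<Longrightarrow> w \<in> S \<Longrightarrow> v + w \<in> S" "v \<in> S \<Longrightarrow> s c v \<in> S" "0 \<in> S"
  using V.subspace_add[OF S] V.subspace_scale[OF S] V.subspace_0[OF S] by blast+

lemma U_cases: "u \<in> U \<Longrightarrow> (\<And>f. f \<in> FA \<Longrightarrow> u = cl f \<Longrightarrow> Q) \<Longrightarrow> Q"
  by (auto simp: enveloping_algebra_def)

lemma free_B_subset: "f \<in> free_algebra B \<Longrightarrow> f \<in> FA"
  using free_algebra_mono[OF B] by blast

lemma U_closed: "u \<in> U \<Longrightarrow> u' \<in> U \<Longrightarrow> env_add L u u' \<in> U" "u \<in> U \<Longrightarrow> env_scale L c u \<in> U"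
  "u \<in> U \<Longrightarrow> f \<in> FA \<Longrightarrow> env_mult L u (cl f) \<in> U" "u \<in> U \<Longrightarrow> f \<in> FA \<Longrightarrow> env_mult L (cl f) u \<in> U"
  by (auto elim!: U_cases simp: env_add_cl env_scale_cl env_mult_cl intro!: cl_in_U FA_closed)

lemma free_act_S: "f \<in> free_algebra B \<Longrightarrow> v \<in> S \<Longrightarrow> free_act s \<rho> f v \<in> S"
proof -
  assume f: "f \<in> free_algebra B" and v: "v \<in> S"
  have "set xs \<subseteq> B \<Longrightarrow> foldr \<rho> xs v \<in> S" for xs
    by (induction xs) (auto simp: v stable)
  with f show ?thesis unfolding free_act_def free_algebra_def by (auto intro!: V.subspace_sum[OF S] S_closed)
qed

lemma subspace_R: "pm.subspace R"
  by (simp add: tensor_ideal_def)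

lemma
  shows tensor_add_left: "u \<in> U \<Longrightarrow> u' \<in> U \<Longrightarrow> v \<in> S \<Longrightarrow> single (env_add L u u', v) 1 - single (u, v) 1 - single (u', v) 1 \<in> R"
    and tensor_add_right: "u \<in> U \<Longrightarrow> v \<in> S \<Longrightarrow> w \<in> S \<Longrightarrow> single (u, v + w) 1 - single (u, v) 1 - single (u, w) 1 \<in> R"
    and tensor_scale_left: "u \<in> U \<Longrightarrow> v \<in> S \<Longrightarrow> single (env_scale L c u, v) 1 - single (u, v) c \<in> R"
    and tensor_balanced: "u \<in> U \<Longrightarrow> f \<in> free_algebra B \<Longrightarrow> v \<in> S \<Longrightarrow>
      single (env_mult L u (cl f), v) 1 - single (u, free_act s \<rho> f v) 1 \<in> R"
  unfolding tensor_ideal_def tensor_relations_def by (rule pm.span_base; blast)+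

lemma subspace_F: "pm.subspace F"
  by (rule subspace_keys_subset)

lemma single_F: "u \<in> U \<Longrightarrow> v \<in> S \<Longrightarrow> single (u, v) c \<in> F"
  by auto

lemma R_induct [consumes 1, case_names zero add_left add_right scale_left balanced step]:
  assumes "r \<in> R" and "Q 0"
    and "\<And>u u' v. u \<in> U \<Longrightarrow> u' \<in> U \<Longrightarrow> v \<in> S \<Longrightarrow> Q (single (env_add L u u', v) 1 - single (u, v) 1 - single (u', v) 1)"
    and "\<And>u v w. u \<in> U \<Longrightarrow> v \<in> S \<Longrightarrow> w \<in> S \<Longrightarrow> Q (single (u, v + w) 1 - single (u, v) 1 - single (u, w) 1)"
    and "\<And>c u v. u \<in> U \<Longrightarrow> v \<in> S \<Longrightarrow> Q (single (env_scale L c u, v) 1 - single (u, v) c)"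
    and "\<And>u f v. u \<in> U \<Longrightarrow> f \<in> free_algebra B \<Longrightarrow> v \<in> S \<Longrightarrow>
      Q (single (env_mult L u (cl f), v) 1 - single (u, free_act s \<rho> f v) 1)"
    and "\<And>c x y. Q x \<Longrightarrow> Q y \<Longrightarrow> Q (pscale c x + y)"
  shows "Q r"
  using assms(1) unfolding tensor_ideal_def
proof (induction rule: pm.span_induct_alt)
  case (step c x y)
  have "Q x" using step.hyps(1) unfolding tensor_relations_def
    by (elim UnE CollectE exE conjE) (simp_all only: assms(3-6))
  then show ?case using step.IH by (rule assms(7))
qed (rule assms(2))

lemma R_subset_F: "R \<subseteq> F"
proof
  fix r assume "r \<in> R"
  then show "r \<in> F"
  proof (induction rule: R_induct)
    case zero
    show ?case by (rule pm.subspace_0[OF subspace_F])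
  next
    case (step c x y)
    then show ?case using pm.subspace_add[OF subspace_F] pm.subspace_scale[OF subspace_F] by blast
  qed (intro pm.subspace_diff[OF subspace_F] single_F U_closed S_closed free_act_S free_B_subset; assumption)+
qed

lemma left_mult_eq: "left_mult L x = pm.linext (\<lambda>(u, v). single (env_mult L (cl (gen x)) u, v) 1)"
  by (rule ext) (simp add: left_mult_def pm.linext_def split_def)

lemma left_mult_single: "left_mult L x (single (u, v) c) = single (env_mult L (cl (gen x)) u, v) c"
  by (simp add: left_mult_eq pm.linext_single)

lemma left_mult_linear: "left_mult L x (f + g) = left_mult L x f + left_mult L x g"
  "left_mult L x (f - g) = left_mult L x f - left_mult L x g"
  "left_mult L x (pscale c f) = pscale c (left_mult L x f)" "left_mult L x 0 = 0"
  by (simp_all add: left_mult_eq pm.linext_add pm.linext_diff pm.linext_scale pm.linext_0)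

lemma F_induct [consumes 1, case_names zero step]:
  assumes "f \<in> F" "Q 0"
    and "\<And>c h v g. h \<in> FA \<Longrightarrow> v \<in> S \<Longrightarrow> g \<in> F \<Longrightarrow> Q g \<Longrightarrow> Q (pscale c (single (cl h, v) 1) + g)"
  shows "Q f"
  using assms(1) unfolding mem_Collect_eq
proof (induction rule: keys_subset_induct)
  case (step c k g)
  then obtain u v where k: "k = (u, v)" "u \<in> U" "v \<in> S" by auto
  then obtain h where "h \<in> FA" "u = cl h" by (auto elim: U_cases)
  with step k show ?case using assms(3) by simp
qed (rule assms(2))

lemma left_mult_F: "x \<in> lcarrier L \<Longrightarrow> f \<in> F \<Longrightarrow> left_mult L x f \<in> F"
proof -
  assume x: "x \<in> lcarrier L" and "f \<in> F"
  from this(2) show ?thesis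
  proof (induction rule: F_induct)
    case zero
    show ?case using pm.subspace_0[OF subspace_F] by (simp add: left_mult_linear)
  next
    case (step c h v g)
    have "single (env_mult L (cl (gen x)) (cl h), v) 1 \<in> F"
      using step x by (intro single_F U_closed cl_in_U FA_closed)
    with step.IH show ?case
      unfolding left_mult_linear left_mult_single
      by (intro pm.subspace_add[OF subspace_F] pm.subspace_scale[OF subspace_F])
  qed
qed

text \<open>Left multiplication commutes with each of the four kinds of tensor relations.\<close>

lemma left_mult_R: "x \<in> lcarrier L \<Longrightarrow> r \<in> R \<Longrightarrow> left_mult L x r \<in> R"
proof -
  assume x: "x \<in> lcarrier L" and "r \<in> R"
  note gx = FA_closed(7)[OF x]
  let ?m = "\<lambda>u. env_mult L (cl (gen x)) u"
  have m: "u \<in> U \<Longrightarrow> ?m u \<in> U" for u using U_closed(4) gx by blast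
  from \<open>r \<in> R\<close> show ?thesis
  proof (induction rule: R_induct)
    case zero
    show ?case using pm.subspace_0[OF subspace_R] by (simp add: left_mult_linear)
  next
    case (add_left u u' v)
    have "?m (env_add L u u') = env_add L (?m u) (?m u')"
      using add_left gx by (auto elim!: U_cases simp: env_add_cl env_mult_cl FA_closed distrib_left)
    then show ?case using tensor_add_left[OF m m] add_left by (simp add: left_mult_linear left_mult_single)
  next
    case (add_right u v w)
    then show ?case using tensor_add_right[OF m] by (simp add: left_mult_linear left_mult_single)
  next
    case (scale_left c u v)
    have "?m (env_scale L c u) = env_scale L c (?m u)"
      using scale_left gx by (auto elim!: U_cases simp: env_scale_cl env_mult_cl FA_closed pscale_mult_right)
    then show ?case using tensor_scale_left[OF m] scale_left by (simp add: left_mult_linear left_mult_single)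
  next
    case (balanced u f v)
    have "?m (env_mult L u (cl f)) = env_mult L (?m u) (cl f)"
      using balanced gx free_B_subset by (auto elim!: U_cases simp: env_mult_cl FA_closed mult.assoc)
    then show ?case using tensor_balanced[OF m] balanced by (simp add: left_mult_linear left_mult_single)
  next
    case (step c x y)
    then show ?case using pm.subspace_add[OF subspace_R] pm.subspace_scale[OF subspace_R]
      by (simp add: left_mult_linear)
  qed
qed

sublocale M: operator_space pscale L F "left_mult L"
proof
  show "pm.subspace F" by (rule subspace_F)
  show "linear_endo_on pscale F (left_mult L x)" if "x \<in> lcarrier L" for x
    unfolding linear_endo_on_def using left_mult_F[OF that] left_mult_linear by blast
qed

lemma R_invariant: "M.invariant R"
  unfolding M.invariant_def using subspace_R R_subset_F left_mult_R by blast

text \<open>The relations of the enveloping algebra become relations between the left multiplications once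
  sums and multiples in the left tensor factor are expanded, that is, modulo \<open>R\<close>.\<close>

lemma left_mult_mod_R:
  assumes f: "f \<in> F"
  shows "x \<in> lcarrier L \<Longrightarrow> y \<in> lcarrier L \<Longrightarrow> left_mult L (x + y) f - (left_mult L x f + left_mult L y f) \<in> R"
    and "x \<in> lcarrier L \<Longrightarrow> left_mult L (lscale L c x) f - pscale c (left_mult L x f) \<in> R"
    and "x \<in> lcarrier L \<Longrightarrow> y \<in> lcarrier L \<Longrightarrow> left_mult L (lbracket L x y) f -
      (left_mult L x (left_mult L y f) - left_mult L y (left_mult L x f)) \<in> R"
proof -
  have lin: "D f \<in> R" if D: "\<And>f g. D (f + g) = D f + D g" "\<And>c f. D (pscale c f) = pscale c (D f)"
    and gen: "\<And>h v. h \<in> FA \<Longrightarrow> v \<in> S \<Longrightarrow> D (single (cl h, v) 1) \<in> R" for D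
    using f
  proof (induction rule: F_induct)
    case zero
    have "D (pscale 0 0) = 0" unfolding D by simp
    then show ?case using pm.subspace_0[OF subspace_R] by simp
  next
    case (step c h v g)
    then show ?case unfolding D using gen by (intro pm.subspace_add[OF subspace_R] pm.subspace_scale[OF subspace_R])
  qed
  have rel: "r \<in> env_relations L \<Longrightarrow> h \<in> FA \<Longrightarrow> r * h \<in> env_ideal L" for r h
  proof -
    assume "r \<in> env_relations L" "h \<in> FA"
    then have "1 * r * h \<in> env_ideal L" unfolding env_ideal_def using FA_closed(5) by (intro pm.span_base) blast
    then show ?thesis by simp
  qed
  have add1: "single (cl (g + h), v) 1 - (single (cl g, v) 1 + single (cl h, v) 1) \<in> R" if "g \<in> FA" "h \<in> FA" "v \<in> S" for g h v
    using tensor_add_left[OF cl_in_U cl_in_U that(3), OF that(1,2)] by (simp add: env_add_cl diff_diff_eq)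
  have sc1: "single (cl (pscale c h), v) 1 - pscale c (single (cl h, v) 1) \<in> R" if "h \<in> FA" "v \<in> S" for h v c
    using tensor_scale_left[OF cl_in_U that(2), OF that(1), of c] by (simp add: env_scale_cl)
  {
    assume x: "x \<in> lcarrier L" and y: "y \<in> lcarrier L"
    show "left_mult L (x + y) f - (left_mult L x f + left_mult L y f) \<in> R"
    proof (rule lin[of "\<lambda>f. left_mult L (x + y) f - (left_mult L x f + left_mult L y f)"])
      fix h v assume h: "h \<in> FA" and v: "v \<in> S"
      have "(gen (x + y) - gen x - gen y) * h \<in> env_ideal L"
        by (rule rel[OF _ h]) (unfold env_relations_def, use x y in blast)
      then have "cl (gen (x + y) * h) = cl (gen x * h + gen y * h)"
        unfolding cl_eq_iff by (simp add: algebra_simps)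
      then show "left_mult L (x + y) (single (cl h, v) 1) - (left_mult L x (single (cl h, v) 1) + left_mult L y (single (cl h, v) 1)) \<in> R"
        using add1[of "gen x * h" "gen y * h" v] h v x y L_closed by (simp add: left_mult_single env_mult_cl FA_closed)
    qed (simp_all add: left_mult_linear pm.scale_right_distrib pm.scale_right_diff_distrib)
    show "left_mult L (lbracket L x y) f - (left_mult L x (left_mult L y f) - left_mult L y (left_mult L x f)) \<in> R"
    proof (rule lin[of "\<lambda>f. left_mult L (lbracket L x y) f - (left_mult L x (left_mult L y f) - left_mult L y (left_mult L x f))"])
      fix h v assume h: "h \<in> FA" and v: "v \<in> S"
      have "(gen x * gen y - gen y * gen x - gen (lbracket L x y)) * h \<in> env_ideal L"
        by (rule rel[OF _ h]) (unfold env_relations_def, use x y in blast)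
      then have "cl (gen x * (gen y * h)) = cl (gen (lbracket L x y) * h + gen y * (gen x * h))"
        unfolding cl_eq_iff by (simp add: algebra_simps)
      then have "single (cl (gen x * (gen y * h)), v) 1 - (single (cl (gen (lbracket L x y) * h), v) 1 + single (cl (gen y * (gen x * h)), v) 1) \<in> R"
        using add1[of "gen (lbracket L x y) * h" "gen y * (gen x * h)" v] h v x y L(3) by (simp add: FA_closed)
      from pm.subspace_neg[OF subspace_R this]
      show "left_mult L (lbracket L x y) (single (cl h, v) 1) - (left_mult L x (left_mult L y (single (cl h, v) 1)) - left_mult L y (left_mult L x (single (cl h, v) 1))) \<in> R"
        using h v x y L(3) by (simp add: left_mult_single env_mult_cl FA_closed algebra_simps)
    qed (simp_all add: left_mult_linear pm.scale_right_distrib pm.scale_right_diff_distrib)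
  }
  assume x: "x \<in> lcarrier L"
  show "left_mult L (lscale L c x) f - pscale c (left_mult L x f) \<in> R"
  proof (rule lin[of "\<lambda>f. left_mult L (lscale L c x) f - pscale c (left_mult L x f)"])
    fix h v assume h: "h \<in> FA" and v: "v \<in> S"
    have "(gen (lscale L c x) - pscale c (gen x)) * h \<in> env_ideal L"
      by (rule rel[OF _ h]) (unfold env_relations_def, use x in blast)
    then have "cl (gen (lscale L c x) * h) = cl (pscale c (gen x * h))"
      unfolding cl_eq_iff by (simp add: left_diff_distrib pscale_mult_left)
    then show "left_mult L (lscale L c x) (single (cl h, v) 1) - pscale c (left_mult L x (single (cl h, v) 1)) \<in> R"
      using sc1[of "gen x * h" v c] h v x L_closed by (simp add: left_mult_single env_mult_cl FA_closed)
  qed (simp_all add: left_mult_linear pm.scale_right_distrib pm.scale_right_diff_distrib mult.commute)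
qed

lemma induced_presented: "M.presented (induced_module L B s \<rho> S) (coset R) R"
proof -
  have "lift1 R (left_mult L x) (coset R f) = coset R (left_mult L x f)" if "x \<in> lcarrier L" for x f
    by (rule lift1_coset[OF subspace_R]) (use left_mult_R[OF that] left_mult_linear(2) in metis)
  then show ?thesis
    unfolding presents_def induced_module_def Let_def
    by (simp add: coset_eq_iff[OF subspace_R] lift2_add_coset[OF subspace_R] lift1_scale_coset[OF subspace_R])
qed

text \<open>The maps \<open>v \<mapsto> 1 \<otimes> v\<close> and \<open>u \<otimes> v \<mapsto> u v\<close>.\<close>

definition incl :: "'v \<Rightarrow> (('t word \<Rightarrow>\<^sub>0 complex) set \<times> 'v \<Rightarrow>\<^sub>0 complex)"
  where "incl v = single (cl 1, v) 1"

definition evaluation :: "(('t word \<Rightarrow>\<^sub>0 complex) set \<times> 'v \<Rightarrow>\<^sub>0 complex) \<Rightarrow> 'v"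
  where "evaluation = V.linext (\<lambda>(u, v). env_act u v)"

lemma one_U: "cl 1 \<in> U" by (intro cl_in_U FA_closed)

lemma incl_F: "v \<in> S \<Longrightarrow> incl v \<in> F"
  unfolding incl_def using single_F one_U by blast

lemma incl_add: "v \<in> S \<Longrightarrow> w \<in> S \<Longrightarrow> incl (v + w) - (incl v + incl w) \<in> R"
  unfolding incl_def using tensor_add_right[OF one_U] by (simp add: diff_diff_eq)

lemma incl_act: "f \<in> free_algebra B \<Longrightarrow> v \<in> S \<Longrightarrow> single (cl f, v) 1 - incl (free_act s \<rho> f v) \<in> R"
  unfolding incl_def using tensor_balanced[OF one_U, of f v] free_B_subset[of f] by (simp add: env_mult_cl FA_closed)

text \<open>The scalar \<open>c\<close>, as an element of the free algebra on \<open>B\<close>, moves from one tensor factor to the other.\<close>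

lemma incl_scale: "v \<in> S \<Longrightarrow> incl (s c v) - pscale c (incl v) \<in> R"
proof -
  assume v: "v \<in> S"
  have "pscale c 1 \<in> free_algebra B"
    by (intro pm.subspace_scale[OF subspace_free_algebra] free_algebra_one)
  from incl_act[OF this v] have 1: "single (cl (pscale c 1), v) 1 - incl (s c v) \<in> R" by (simp add: free_act_linear)
  have 2: "single (cl (pscale c 1), v) 1 - pscale c (incl v) \<in> R"
    using tensor_scale_left[OF one_U v, of c] by (simp add: env_scale_cl incl_def)
  from pm.subspace_diff[OF subspace_R 2 1] show ?thesis by simp
qed

lemma incl_left_mult: "x \<in> B \<Longrightarrow> v \<in> S \<Longrightarrow> left_mult L x (incl v) - incl (\<rho> x v) \<in> R"
  using incl_act[of "gen x" v] B by (auto simp: incl_def left_mult_single env_mult_cl FA_closed free_algebra_gen free_act_linear subset_iff)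

lemma evaluation_linear: "evaluation (f + g) = evaluation f + evaluation g"
  "evaluation (f - g) = evaluation f - evaluation g"
  "evaluation (pscale c f) = s c (evaluation f)" "evaluation 0 = 0"
  "h \<in> FA \<Longrightarrow> evaluation (single (cl h, v) c) = s c (free_act s \<rho> h v)"
  by (simp_all add: evaluation_def V.linext_add V.linext_diff V.linext_scale V.linext_0 V.linext_single env_act_cl)

lemma evaluation_incl: "evaluation (incl v) = v"
  by (simp add: incl_def evaluation_linear FA_closed free_act_linear)

lemma evaluation_R: "r \<in> R \<Longrightarrow> evaluation r = 0"
proof (induction rule: R_induct)
  case (balanced u f v)
  then show ?case using free_B_subset[of f]
    by (auto elim!: U_cases simp: env_mult_cl evaluation_linear FA_closed free_act_mult)
qed (auto elim!: U_cases simp: env_add_cl env_scale_cl evaluation_linear FA_closed free_act_linear free_act_vector)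

lemma evaluation_left_mult: "x \<in> lcarrier L \<Longrightarrow> f \<in> F \<Longrightarrow> evaluation (left_mult L x f) = \<rho> x (evaluation f)"
proof -
  assume x: "x \<in> lcarrier L" and "f \<in> F"
  have "\<rho> x 0 = 0" using \<rho>_scale[OF x, of 0 0] by simp
  with \<open>f \<in> F\<close> show ?thesis
  proof (induction rule: F_induct)
    case zero
    then show ?case by (simp add: left_mult_linear evaluation_linear)
  next
    case (step c h v g)
    then have "evaluation (left_mult L x (single (cl h, v) 1)) = \<rho> x (evaluation (single (cl h, v) 1))"
      using x by (simp add: left_mult_single env_mult_cl FA_closed evaluation_linear free_act_mult free_act_linear)
    with step show ?case unfolding left_mult_linear evaluation_linear \<rho>_add[OF x] \<rho>_scale[OF x] by simp
  qed
qed

text \<open>A pure tensor \<open>x\<^sub>1 \<cdots> x\<^sub>n \<otimes> v\<close> arises from \<open>1 \<otimes> v\<close> by successive left multiplications.\<close>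

lemma generated_by_incl:
  assumes W: "M.invariant W" "R \<subseteq> W" "incl ` S \<subseteq> W"
  shows "W = F"
proof -
  have W': "pm.subspace W" "W \<subseteq> F" "\<And>x f. x \<in> lcarrier L \<Longrightarrow> f \<in> W \<Longrightarrow> left_mult L x f \<in> W"
    using W(1) unfolding M.invariant_def by blast+
  have mod: "f \<in> W" if "f - g \<in> R" "g \<in> W" for f g
    using pm.subspace_add[OF W'(1), of "f - g" g] that W(2) by auto
  have word: "single (cl (single (Word xs) 1), v) 1 \<in> W" if "set xs \<subseteq> lcarrier L" "v \<in> S" for xs v
    using that(1)
  proof (induction xs)
    case Nil
    have "single (Word []) 1 = (1 :: 't word \<Rightarrow>\<^sub>0 complex)" by (simp flip: single_one add: zero_word_def)
    then show ?case using W(3) that(2) by (auto simp: incl_def)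
  next
    case (Cons x xs)
    have "gen x * single (Word xs) 1 = single (Word (x # xs)) 1" by (simp add: gen_def mult_single plus_word_def)
    then have "left_mult L x (single (cl (single (Word xs) 1), v) 1) = single (cl (single (Word (x # xs)) 1), v) 1"
      using Cons.prems by (simp add: left_mult_single env_mult_cl FA_closed free_algebra_single)
    with Cons W'(3)[of x] show ?case by fastforce
  qed
  have pure: "single (cl h, v) 1 \<in> W" if h: "h \<in> FA" and v: "v \<in> S" for h v
    using h unfolding free_algebra_eq mem_Collect_eq
  proof (induction rule: keys_subset_induct)
    case base
    have "single (cl (pscale 0 1), v) 1 - single (cl 1, v) 0 \<in> R"
      using tensor_scale_left[OF one_U v, of 0] by (simp add: env_scale_cl)
    then show ?case using W(2) by auto
  next
    case (step c k g)
    then have g: "g \<in> FA" and k: "single k 1 \<in> FA" by (auto simp: free_algebra_def)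
    have "single (cl (single k 1), v) 1 \<in> W" using word[of "letters k" v] step.hyps v by (cases k) simp
    then have "pscale c (single (cl (single k 1), v) 1) \<in> W" by (rule pm.subspace_scale[OF W'(1)])
    then have "single (cl (pscale c (single k 1)), v) 1 \<in> W"
      using mod tensor_scale_left[OF cl_in_U[OF k] v, of c] by (simp add: env_scale_cl del: pscale_single) (simp add: mod)
    then have "single (cl (pscale c (single k 1)), v) 1 + single (cl g, v) 1 \<in> W"
      using step.IH by (rule pm.subspace_add[OF W'(1)])
    then show ?case
      using mod tensor_add_left[OF cl_in_U[OF FA_closed(3)[OF k]] cl_in_U[OF g] v, of c]
      unfolding env_add_cl diff_diff_eq by blast
  qed
  have "f \<in> W" if "f \<in> F" for f
    using that
  proof (induction rule: F_induct)
    case zero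
    show ?case by (rule pm.subspace_0[OF W'(1)])
  next
    case (step c h v g)
    then show ?case using pure by (intro pm.subspace_add[OF W'(1)] pm.subspace_scale[OF W'(1)])
  qed
  with W'(2) show ?thesis by blast
qed

end

text \<open>The sets \<open>A\<close> and \<open>B\<close> may lie anywhere between the homogeneous elements and their spans, so that
  both triangular decompositions fit.\<close>

theorem induced_from_highest_component:
  assumes "irreducible_graded_rep L s \<rho> e P Z N b v\<^sub>0"
    and B: "P \<union> Z \<subseteq> B" "B \<subseteq> module.span (lscale L) (P \<union> Z)" "e \<in> B"
    and S: "P \<subseteq> A" "A \<subseteq> module.span (lscale L) P"
  shows "(\<exists>!W. irreducible_quotient_by L (induced_module L B s \<rho> (annihilated \<rho> A)) W) \<and>
    module_iso L (module_of s \<rho>) (irreducible_quotient L (induced_module L B s \<rho> (annihilated \<rho> A)))"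
proof -
  interpret lie_rep L s \<rho>
    using assms(1) by (intro lie_rep.intro) (auto simp: irreducible_graded_rep_def graded_by_def)
  interpret H: irreducible_graded_rep L s \<rho> e P Z N b v\<^sub>0 by fact
  have PZ: "P \<union> Z \<subseteq> lcarrier L" using H.V.graded' by blast
  then have spanPZ: "L.span (P \<union> Z) \<subseteq> lcarrier L" by (rule L.span_minimal[OF _ L(2)])
  have lin: "L.subspace {x\<in>lcarrier L. \<rho> x v \<in> W}" if W: "V.subspace W" for v W
    using rep V.subspace_add[OF W] V.subspace_scale[OF W] V.subspace_0[OF W] L_closed L.subspace_0[OF L(2)]
    by (intro L.subspaceI) (auto simp: lie_representation_def; metis L.scale_zero_left V.scale_zero_left)+
  have ann: "annihilated \<rho> A = annihilated \<rho> P"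
  proof
    show "annihilated \<rho> A \<subseteq> annihilated \<rho> P" using S(1) by (auto simp: annihilated_def)
    show "annihilated \<rho> P \<subseteq> annihilated \<rho> A"
    proof
      fix v assume v: "v \<in> annihilated \<rho> P"
      have "L.span P \<subseteq> {x\<in>lcarrier L. \<rho> x v \<in> {0}}"
        by (rule L.span_minimal[OF _ lin]) (use v PZ in \<open>auto simp: annihilated_def\<close>)
      with S(2) show "v \<in> annihilated \<rho> A" by (auto simp: annihilated_def)
    qed
  qed
  have subS: "V.subspace (annihilated \<rho> P)" unfolding H.highest_component by (rule H.V.subspace_E)
  have stable: "\<rho> x v \<in> annihilated \<rho> P" if x: "x \<in> B" and v: "v \<in> annihilated \<rho> P" for x v
  proof -
    have "P \<union> Z \<subseteq> {x\<in>lcarrier L. \<rho> x v \<in> annihilated \<rho> P}"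
      using PZ H.degree_0_stable v V.subspace_0[OF subS] by (auto simp: annihilated_def)
    then have "L.span (P \<union> Z) \<subseteq> {x\<in>lcarrier L. \<rho> x v \<in> annihilated \<rho> P}"
      by (rule L.span_minimal[OF _ lin[OF subS]])
    with B x show ?thesis by blast
  qed
  interpret I: induced L s \<rho> B "annihilated \<rho> P"
    by unfold_locales (use B spanPZ subS stable in auto)
  interpret M: graded_action pscale L I.F "left_mult L" I.R e P Z N
    by unfold_locales (use I.R_invariant H.grading I.left_mult_mod_R in auto)
  interpret C: highest_cover L s \<rho> e P Z N b v\<^sub>0 pscale I.F "left_mult L" I.R I.incl I.evaluation
  proof unfold_locales
    fix w x assume w: "w \<in> annihilated \<rho> P" and "x \<in> insert e (P \<union> Z)"
    then have "x \<in> B" using B by blast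
    then show "left_mult L x (I.incl w) - I.incl (\<rho> x w) \<in> I.R" using w by (rule I.incl_left_mult)
  qed (assumption | rule I.incl_F I.incl_add I.incl_scale I.evaluation_linear I.evaluation_R
      I.evaluation_left_mult I.evaluation_incl I.generated_by_incl)+
  show ?thesis unfolding ann by (rule C.unique_irreducible_quotient_of_cover[OF I.induced_presented])
qed

section \<open>Invariance of the form under automorphisms\<close>

locale lie_alg =
  fixes L :: "'g::ab_group_add lie_algebra"
  assumes lie: "is_lie_algebra L"
begin

sublocale complex_space "lscale L"
  using lie by (simp add: is_lie_algebra_def complex_space_def)

abbreviation "G \<equiv> lcarrier L"
abbreviation "br \<equiv> lbracket L"

lemma subspace_G: "subspace G"
  and br_closed: "x \<in> G \<Longrightarrow> y \<in> G \<Longrightarrow> br x y \<in> G"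
  and br_add: "x \<in> G \<Longrightarrow> y \<in> G \<Longrightarrow> z \<in> G \<Longrightarrow> br (x + y) z = br x z + br y z"
    "x \<in> G \<Longrightarrow> y \<in> G \<Longrightarrow> z \<in> G \<Longrightarrow> br z (x + y) = br z x + br z y"
  and br_scale: "x \<in> G \<Longrightarrow> y \<in> G \<Longrightarrow> br (lscale L c x) y = lscale L c (br x y)"
    "x \<in> G \<Longrightarrow> y \<in> G \<Longrightarrow> br x (lscale L c y) = lscale L c (br x y)"
  and br_self: "x \<in> G \<Longrightarrow> br x x = 0"
  using lie unfolding is_lie_algebra_def by blast+

lemma G_closed: "0 \<in> G" "x \<in> G \<Longrightarrow> y \<in> G \<Longrightarrow> x + y \<in> G" "x \<in> G \<Longrightarrow> y \<in> G \<Longrightarrow> x - y \<in> G"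
  "x \<in> G \<Longrightarrow> lscale L c x \<in> G" "x \<in> G \<Longrightarrow> - x \<in> G"
  using subspace_G by (simp_all add: subspace_0 subspace_add subspace_diff subspace_scale subspace_neg)

lemma br_zero: "x \<in> G \<Longrightarrow> br 0 x = 0" "x \<in> G \<Longrightarrow> br x 0 = 0"
  using br_scale(1)[of 0 x 0] br_scale(2)[of x 0 0] G_closed(1) by simp_all

lemma br_antisym: "x \<in> G \<Longrightarrow> y \<in> G \<Longrightarrow> br x y = - br y x"
proof -
  assume x: "x \<in> G" and y: "y \<in> G"
  have "br (x + y) (x + y) = br x x + br x y + (br y x + br y y)"
    using x y by (simp add: br_add G_closed)
  then have "br x y + br y x = 0" using x y by (simp add: br_self G_closed)
  then show ?thesis by (simp add: eq_neg_iff_add_eq_0)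
qed

lemma br_neg: "x \<in> G \<Longrightarrow> y \<in> G \<Longrightarrow> br (- x) y = - br x y" "x \<in> G \<Longrightarrow> y \<in> G \<Longrightarrow> br x (- y) = - br x y"
  using br_scale(1)[of x y "-1"] br_scale(2)[of x y "-1"] by simp_all

lemma jacobi: "x \<in> G \<Longrightarrow> y \<in> G \<Longrightarrow> z \<in> G \<Longrightarrow> br x (br y z) = br (br x y) z + br y (br x z)"
proof -
  assume x: "x \<in> G" and y: "y \<in> G" and z: "z \<in> G"
  have J: "br x (br y z) + br y (br z x) + br z (br x y) = 0"
    using lie x y z unfolding is_lie_algebra_def by blast
  have "br z (br x y) = - br (br x y) z" using br_antisym[OF z br_closed[OF x y]] .
  moreover have "br y (br z x) = - br y (br x z)"
    using br_antisym[OF z x] br_neg(2)[OF y br_closed[OF x z]] by simp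
  ultimately show ?thesis using J by (simp add: algebra_simps)
qed

lemma ad_endo: "x \<in> G \<Longrightarrow> linear_endo_on (lscale L) G (br x)"
  by (auto simp: linear_endo_on_def br_add br_scale br_closed)

text \<open>Finitely many elements of \<open>H\<close> span it, so simultaneous diagonalisation applies.\<close>

lemma toral_eigenvectors_span:
  assumes H: "subspace H" "H \<subseteq> G" "\<And>x y. x \<in> H \<Longrightarrow> y \<in> H \<Longrightarrow> br x y = 0" "\<And>h. h \<in> H \<Longrightarrow> ad_diagonalisable L h"
    and fin: "fin_dim (lscale L) G"
    and N: "subspace N" "N \<subseteq> G" "\<And>h x. h \<in> H \<Longrightarrow> x \<in> N \<Longrightarrow> br h x \<in> N"
  shows "N \<subseteq> span {x\<in>N. \<forall>h\<in>H. \<exists>c. br h x = lscale L c x}"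
proof -
  obtain D where D: "finite D" "G \<subseteq> span D" using fin unfolding fin_dim_def by blast
  obtain A where A: "A \<subseteq> H" "independent A" "H \<subseteq> span A" using maximal_independent_subset by blast
  have "A \<subseteq> span D" using A H D by blast
  then have "finite A" using independent_span_bound[OF D(1) A(2)] by blast
  have "N \<subseteq> span {x\<in>N. \<forall>h\<in>A. \<exists>c. br h x = lscale L c x}"
  proof (rule simultaneous_eigenvectors_span[OF subspace_G \<open>finite A\<close>])
    show "linear_endo_on (lscale L) G (br h)" if "h \<in> A" for h using that A H ad_endo by blast
    show "br h (br h' x) = br h' (br h x)" if "h \<in> A" "h' \<in> A" "x \<in> G" for h h' x
    proof -
      have "h \<in> G" "h' \<in> G" "br h h' = 0" using that A H by blast+
      then show ?thesis using jacobi[of h h' x] that by (simp add: br_zero)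
    qed
    show "G \<subseteq> span {x\<in>G. \<exists>c. br h x = lscale L c x}" if "h \<in> A" for h
      using H(4)[of h] A that unfolding ad_diagonalisable_def by blast
    show "br h ` N \<subseteq> N" if "h \<in> A" for h using N(3) A that by blast
  qed (use N in auto)
  also have "\<dots> \<subseteq> span {x\<in>N. \<forall>h\<in>H. \<exists>c. br h x = lscale L c x}"
  proof (rule span_mono, clarify)
    fix x h assume x: "x \<in> N" "\<forall>h\<in>A. \<exists>c. br h x = lscale L c x" and h: "h \<in> H"
    have xG: "x \<in> G" using x N by blast
    let ?U = "{h\<in>G. \<exists>c. br h x = lscale L c x}"
    have "subspace ?U"
    proof (rule subspaceI)
      show "0 \<in> ?U" using br_zero[OF xG] G_closed by (auto intro: exI[of _ 0])
    next
      fix y z assume "y \<in> ?U" "z \<in> ?U"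
      then obtain c d where "y \<in> G" "z \<in> G" "br y x = lscale L c x" "br z x = lscale L d x" by blast
      then have "br (y + z) x = lscale L (c + d) x" "y + z \<in> G"
        using xG by (simp_all add: br_add G_closed scale_left_distrib)
      then show "y + z \<in> ?U" by blast
    next
      fix y k assume "y \<in> ?U"
      then obtain c where "y \<in> G" "br y x = lscale L c x" by blast
      then have "br (lscale L k y) x = lscale L (k * c) x" "lscale L k y \<in> G"
        using xG by (simp_all add: br_scale G_closed)
      then show "lscale L k y \<in> ?U" by blast
    qed
    moreover have "A \<subseteq> ?U" using x A H by blast
    ultimately have "span A \<subseteq> ?U" by (intro span_minimal)
    then show "\<exists>c. br h x = lscale L c x" using h A by blast
  qed
  finally show ?thesis .
qed

definition trace_on :: "'g set \<Rightarrow> ('g \<Rightarrow> 'g) \<Rightarrow> complex"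
  where "trace_on A f = (\<Sum>b\<in>A. representation A (f b) b)"

definition killing :: "'g set \<Rightarrow> 'g \<Rightarrow> 'g \<Rightarrow> complex"
  where "killing A x y = trace_on A (\<lambda>z. br x (br y z))"

definition inv_form :: "('g \<Rightarrow> 'g \<Rightarrow> complex) \<Rightarrow> bool"
  where "inv_form C \<longleftrightarrow> (\<forall>x\<in>G. linear_form_on (lscale L) G (C x)) \<and>
    (\<forall>x\<in>G. \<forall>y\<in>G. C x y = C y x) \<and> (\<forall>x\<in>G. \<forall>y\<in>G. \<forall>z\<in>G. C (br x y) z = C x (br y z))"

lemma inv_formD:
  assumes "inv_form C"
  shows "x \<in> G \<Longrightarrow> y \<in> G \<Longrightarrow> z \<in> G \<Longrightarrow> C x (y + z) = C x y + C x z"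
    "x \<in> G \<Longrightarrow> y \<in> G \<Longrightarrow> C x (lscale L c y) = c * C x y"
    "x \<in> G \<Longrightarrow> y \<in> G \<Longrightarrow> z \<in> G \<Longrightarrow> C (y + z) x = C y x + C z x"
    "x \<in> G \<Longrightarrow> y \<in> G \<Longrightarrow> C (lscale L c y) x = c * C y x"
    "x \<in> G \<Longrightarrow> y \<in> G \<Longrightarrow> C x y = C y x"
    "x \<in> G \<Longrightarrow> y \<in> G \<Longrightarrow> z \<in> G \<Longrightarrow> C (br x y) z = C x (br y z)"
proof -
  note A = assms[unfolded inv_form_def linear_form_on_def]
  show 1: "x \<in> G \<Longrightarrow> y \<in> G \<Longrightarrow> z \<in> G \<Longrightarrow> C x (y + z) = C x y + C x z" for x y z using A by blast
  show 2: "x \<in> G \<Longrightarrow> y \<in> G \<Longrightarrow> C x (lscale L c y) = c * C x y" for x y using A by blast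
  show 3: "x \<in> G \<Longrightarrow> y \<in> G \<Longrightarrow> C x y = C y x" for x y using A by blast
  show "x \<in> G \<Longrightarrow> y \<in> G \<Longrightarrow> z \<in> G \<Longrightarrow> C (br x y) z = C x (br y z)" using A by blast
  show "x \<in> G \<Longrightarrow> y \<in> G \<Longrightarrow> z \<in> G \<Longrightarrow> C (y + z) x = C y x + C z x"
    using 1[of x y z] 3[of "y + z" x] 3[of y x] 3[of z x] by (simp add: G_closed)
  show "x \<in> G \<Longrightarrow> y \<in> G \<Longrightarrow> C (lscale L c y) x = c * C y x"
    using 2[of x y] 3[of "lscale L c y" x] 3[of y x] by (simp add: G_closed)
qed

context
  fixes A
  assumes A: "finite A" "independent A" "span A = G"
begin

lemma rep_linear: "x \<in> G \<Longrightarrow> y \<in> G \<Longrightarrow> representation A (x + y) b = representation A x b + representation A y b"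
  "x \<in> G \<Longrightarrow> y \<in> G \<Longrightarrow> representation A (x - y) b = representation A x b - representation A y b"
  "x \<in> G \<Longrightarrow> representation A (lscale L c x) b = c * representation A x b"
  using representation_add[OF A(2), of y x] representation_diff[OF A(2), of y x] representation_scale[OF A(2), of x c] A(3) by auto

text \<open>In coordinates both sides are \<open>\<Sum> f\<^sub>c\<^sub>b g\<^sub>b\<^sub>c\<close>.\<close>

lemma trace_on_commute:
  assumes f: "linear_endo_on (lscale L) G f" and g: "linear_endo_on (lscale L) G g"
  shows "trace_on A (\<lambda>z. f (g z)) = trace_on A (\<lambda>z. g (f z))"
proof -
  have AG: "b \<in> G" if "b \<in> A" for b using that A(3) span_base by blast
  have *: "trace_on A (\<lambda>z. f (g z)) = (\<Sum>c\<in>A. \<Sum>b\<in>A. representation A (g c) b * representation A (f b) c)"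
    if f: "linear_endo_on (lscale L) G f" and g: "linear_endo_on (lscale L) G g" for f g
    unfolding trace_on_def
  proof (rule sum.cong)
    fix c assume c: "c \<in> A"
    have gc: "g c \<in> G" using endo_mem[OF subspace_G g] AG c by blast
    have "g c = (\<Sum>b\<in>A. lscale L (representation A (g c) b) b)"
      using sum_representation_eq[OF A(2) _ A(1) order_refl, of "g c"] gc A(3) by simp
    then have "f (g c) = f (\<Sum>b\<in>A. lscale L (representation A (g c) b) b)" by simp
    also have "\<dots> = (\<Sum>b\<in>A. lscale L (representation A (g c) b) (f b))"
      using AG by (subst endo_sum[OF subspace_G f]) (auto simp: G_closed endo_scale[OF subspace_G f])
    also have "representation A \<dots> c = (\<Sum>b\<in>A. representation A (lscale L (representation A (g c) b) (f b)) c)"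
      using AG A(3) endo_mem[OF subspace_G f] by (subst representation_sum[OF A(2)]) (auto simp: G_closed)
    also have "\<dots> = (\<Sum>b\<in>A. representation A (g c) b * representation A (f b) c)"
      using AG endo_mem[OF subspace_G f] by (intro sum.cong refl rep_linear(3)) auto
    finally show "representation A (f (g c)) c = (\<Sum>b\<in>A. representation A (g c) b * representation A (f b) c)" .
  qed simp
  show ?thesis unfolding *[OF f g] *[OF g f] by (subst sum.swap) (simp add: mult.commute)
qed

lemma trace_on_cong: "(\<And>z. z \<in> G \<Longrightarrow> f z = g z) \<Longrightarrow> trace_on A f = trace_on A g"
  unfolding trace_on_def
proof (rule sum.cong)
  fix b assume fg: "\<And>z. z \<in> G \<Longrightarrow> f z = g z" and "b \<in> A"
  then have "b \<in> G" using span_base[of b A] A(3) by simp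
  then show "representation A (f b) b = representation A (g b) b" by (simp add: fg)
qed simp

lemma trace_on_linear:
  assumes "\<And>z. z \<in> G \<Longrightarrow> f z \<in> G" "\<And>z. z \<in> G \<Longrightarrow> g z \<in> G"
  shows "trace_on A (\<lambda>z. f z + g z) = trace_on A f + trace_on A g"
    "trace_on A (\<lambda>z. f z - g z) = trace_on A f - trace_on A g"
    "trace_on A (\<lambda>z. lscale L c (f z)) = c * trace_on A f"
proof -
  have AG: "b \<in> A \<Longrightarrow> b \<in> G" for b using A(3) span_base by blast
  show "trace_on A (\<lambda>z. f z + g z) = trace_on A f + trace_on A g"
    "trace_on A (\<lambda>z. f z - g z) = trace_on A f - trace_on A g"
    "trace_on A (\<lambda>z. lscale L c (f z)) = c * trace_on A f"
    unfolding trace_on_def using AG assms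
    by (auto simp: rep_linear sum.distrib sum_subtractf sum_distrib_left intro!: sum.cong)
qed

lemma endo_comp: "linear_endo_on (lscale L) G f \<Longrightarrow> linear_endo_on (lscale L) G g \<Longrightarrow> linear_endo_on (lscale L) G (\<lambda>z. f (g z))"
  unfolding linear_endo_on_def by (auto simp: image_subset_iff)

text \<open>Invariance is the identity \<open>tr (ad y ad x ad z) = tr (ad x ad z ad y)\<close>.\<close>

lemma killing_inv_form: "inv_form (killing A)"
  unfolding inv_form_def linear_form_on_def
proof (intro conjI ballI allI)
  fix x y z c
  assume x: "x \<in> G" and y: "y \<in> G"
  show "killing A x y = killing A y x"
    unfolding killing_def by (rule trace_on_commute[OF ad_endo[OF x] ad_endo[OF y]])
  show "killing A x (lscale L c y) = c * killing A x y"
    unfolding killing_def using x y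
    by (subst trace_on_linear(3)[symmetric]) (auto simp: br_closed br_scale intro!: trace_on_cong)
  assume z: "z \<in> G"
  show "killing A x (y + z) = killing A x y + killing A x z"
    unfolding killing_def using x y z
    by (subst trace_on_linear(1)[symmetric]) (auto simp: br_closed br_add intro!: trace_on_cong)
  have c: "br u w \<in> G" if "u \<in> G" "w \<in> G" for u w using br_closed that .
  have "trace_on A (\<lambda>w. br x (br z (br y w))) = trace_on A (\<lambda>w. br y (br x (br z w)))"
    by (rule trace_on_commute[OF endo_comp[OF ad_endo[OF x] ad_endo[OF z]] ad_endo[OF y]])
  moreover have "trace_on A (\<lambda>w. br (br x y) (br z w)) =
      trace_on A (\<lambda>w. br x (br y (br z w))) - trace_on A (\<lambda>w. br y (br x (br z w)))"
  proof (subst trace_on_linear(2)[symmetric])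
    have "br (br x y) (br z w) = br x (br y (br z w)) - br y (br x (br z w))" if w: "w \<in> G" for w
      using jacobi[OF x y c[OF z w]] by simp
    then show "trace_on A (\<lambda>w. br (br x y) (br z w)) = trace_on A (\<lambda>w. br x (br y (br z w)) - br y (br x (br z w)))"
      by (rule trace_on_cong)
  qed (use x y z c in auto)
  moreover have "trace_on A (\<lambda>w. br x (br (br y z) w)) =
      trace_on A (\<lambda>w. br x (br y (br z w))) - trace_on A (\<lambda>w. br x (br z (br y w)))"
  proof (subst trace_on_linear(2)[symmetric])
    have "br x (br (br y z) w) = br x (br y (br z w)) - br x (br z (br y w))" if w: "w \<in> G" for w
    proof -
      have "br x (br y (br z w)) = br x (br (br y z) w) + br x (br z (br y w))"
        using x y z w jacobi[OF y z w] by (simp add: c br_add)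
      then show ?thesis by simp
    qed
    then show "trace_on A (\<lambda>w. br x (br (br y z) w)) = trace_on A (\<lambda>w. br x (br y (br z w)) - br x (br z (br y w)))"
      by (rule trace_on_cong)
  qed (use x y z c in auto)
  ultimately show "killing A (br x y) z = killing A x (br y z)" unfolding killing_def by simp
qed

text \<open>\<open>ad (\<sigma> x)\<close> is the conjugate of \<open>ad x\<close> by \<open>\<sigma>\<close>.\<close>

lemma killing_automorphism:
  assumes \<sigma>: "lie_automorphism L \<sigma>" and x: "x \<in> G" and y: "y \<in> G"
  shows "killing A (\<sigma> x) (\<sigma> y) = killing A x y"
proof -
  let ?\<tau> = "inv_into G \<sigma>"
  have bij: "bij_betw \<sigma> G G" and hom: "\<And>x y. x \<in> G \<Longrightarrow> y \<in> G \<Longrightarrow> \<sigma> (br x y) = br (\<sigma> x) (\<sigma> y)"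
    and endo: "linear_endo_on (lscale L) G \<sigma>"
    using \<sigma> unfolding lie_automorphism_def linear_endo_on_def bij_betw_def by blast+
  have \<tau>: "?\<tau> z \<in> G" "\<sigma> (?\<tau> z) = z" if "z \<in> G" for z
    using bij that by (auto simp: bij_betw_def f_inv_into_f inv_into_into)
  have \<tau>\<sigma>: "?\<tau> (\<sigma> z) = z" if "z \<in> G" for z
    using bij that by (simp add: bij_betw_def)
  have \<sigma>G: "z \<in> G \<Longrightarrow> \<sigma> z \<in> G" for z using endo by (auto simp: linear_endo_on_def)
  have \<tau>endo: "linear_endo_on (lscale L) G ?\<tau>"
    unfolding linear_endo_on_def
  proof (intro conjI ballI allI)
    show "?\<tau> (u + w) = ?\<tau> u + ?\<tau> w" if "u \<in> G" "w \<in> G" for u w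
      using \<tau>\<sigma>[of "?\<tau> u + ?\<tau> w"] that by (simp add: endo_add[OF subspace_G endo] \<tau> G_closed)
    show "?\<tau> (lscale L c u) = lscale L c (?\<tau> u)" if "u \<in> G" for u c
      using \<tau>\<sigma>[of "lscale L c (?\<tau> u)"] that by (simp add: endo_scale[OF subspace_G endo] \<tau> G_closed)
  qed (use \<tau> in auto)
  have "killing A (\<sigma> x) (\<sigma> y) = trace_on A (\<lambda>z. \<sigma> (br x (br y (?\<tau> z))))"
    unfolding killing_def
    by (rule trace_on_cong) (use x y in \<open>simp add: hom br_closed \<tau>\<close>)
  also have "\<dots> = trace_on A (\<lambda>z. br x (br y (?\<tau> (\<sigma> z))))"
    by (rule trace_on_commute[OF endo endo_comp[OF ad_endo[OF x] endo_comp[OF ad_endo[OF y] \<tau>endo]]])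
  also have "\<dots> = killing A x y"
    unfolding killing_def by (rule trace_on_cong) (simp add: \<tau>\<sigma>)
  finally show ?thesis .
qed

lemma killing_of_eigenbasis:
  assumes h: "h \<in> G" and c: "\<And>b. b \<in> A \<Longrightarrow> br h b = lscale L (c b) b"
  shows "killing A h h = (\<Sum>b\<in>A. (c b)\<^sup>2)"
  unfolding killing_def trace_on_def
proof (rule sum.cong)
  fix b assume b: "b \<in> A"
  then have bG: "b \<in> G" using A(3) span_base by blast
  have "br h (br h b) = lscale L ((c b)\<^sup>2) b"
    using b bG h by (simp add: c br_scale power2_eq_square)
  then show "representation A (br h (br h b)) b = (c b)\<^sup>2"
    using rep_linear(3)[OF bG, of "(c b)\<^sup>2" b] representation_basis[OF A(2) b] by simp
qed simp

end

lemma funpow_ad_mem: "x \<in> G \<Longrightarrow> u \<in> G \<Longrightarrow> (br x ^^ n) u \<in> G"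
  by (induction n) (auto simp: br_closed)

lemma funpow_ad_eigenvector:
  assumes G: "p \<in> G" "x \<in> G" "u \<in> G" and x: "br p x = lscale L q x" and u: "br p u = lscale L d u"
  shows "br p ((br x ^^ n) u) = lscale L (d + of_nat n * q) ((br x ^^ n) u)"
proof (induction n)
  case (Suc n)
  let ?u = "(br x ^^ n) u"
  have uG: "?u \<in> G" by (rule funpow_ad_mem[OF G(2,3)])
  have "br p (br x ?u) = lscale L q (br x ?u) + lscale L (d + of_nat n * q) (br x ?u)"
    using jacobi[OF G(1,2) uG] br_scale(1)[OF G(2) uG] br_scale(2)[OF G(2) uG] x Suc by simp
  also have "\<dots> = lscale L (q + (d + of_nat n * q)) (br x ?u)" by (rule scale_left_distrib[symmetric])
  also have "q + (d + of_nat n * q) = d + of_nat (Suc n) * q" by (simp add: algebra_simps)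
  finally show ?case by simp
qed (simp add: u)

text \<open>Powers of \<open>ad x\<close> applied to \<open>v\<close> have distinct eigenvalues for \<open>k\<close>, of which there are finitely many.\<close>

lemma nilpotent_on_eigenvector:
  assumes fin: "fin_dim (lscale L) G" and G: "k \<in> G" "x \<in> G" "v \<in> G"
    and x: "br k x = lscale L \<beta> x" "\<beta> \<noteq> 0" and v: "br k v = lscale L c v" "v \<noteq> 0"
  obtains n where "(br x ^^ n) v \<noteq> 0" "br x ((br x ^^ n) v) = 0"
proof -
  have mem: "(br x ^^ n) v \<in> G" for n by (rule funpow_ad_mem[OF G(2,3)])
  have eig: "br k ((br x ^^ n) v) = lscale L (c + of_nat n * \<beta>) ((br x ^^ n) v)" for n
    by (rule funpow_ad_eigenvector[OF G x(1) v(1)])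
  obtain D where D: "finite D" "G \<subseteq> span D" using fin unfolding fin_dim_def by blast
  have fin: "finite {c. \<exists>v\<in>G. v \<noteq> 0 \<and> br k v = lscale L c v}"
    by (rule finite_eigenvalues[OF subspace_G ad_endo[OF G(1)] D])
  have "\<exists>n. (br x ^^ n) v = 0"
  proof (rule ccontr)
    assume "\<nexists>n. (br x ^^ n) v = 0"
    then have "range (\<lambda>n. c + of_nat n * \<beta>) \<subseteq> {c. \<exists>v\<in>G. v \<noteq> 0 \<and> br k v = lscale L c v}"
      using eig mem by blast
    then have "finite (range (\<lambda>n::nat. c + of_nat n * \<beta>))" using fin finite_subset by blast
    moreover have "inj (\<lambda>n::nat. c + of_nat n * \<beta>)" using x(2) by (auto simp: inj_def)
    ultimately show False using finite_imageD infinite_UNIV_nat by blast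
  qed
  then obtain m where m: "(br x ^^ m) v = 0" "\<And>k. k < m \<Longrightarrow> (br x ^^ k) v \<noteq> 0"
    using exists_least_iff[of "\<lambda>n. (br x ^^ n) v = 0"] by blast
  have "m \<noteq> 0" using m v(2) by (cases m) auto
  then obtain n where "m = Suc n" using not0_implies_Suc by blast
  with m show ?thesis using that[of n] by simp
qed

text \<open>The span of \<open>e\<close>, \<open>f\<close>, \<open>h\<close> is \<open>sl\<^sub>2\<close> if \<open>a \<noteq> 0\<close> and a Heisenberg algebra if \<open>a = 0\<close>, and both cases
  are treated alike. Applying \<open>e\<close> to \<open>v\<close> as often as possible gives a vector \<open>w\<close> with \<open>e w = 0\<close>, of
  eigenvalue \<open>\<mu>\<close>, say. If \<open>f\<^sup>m w\<close> is the last non-zero power, then \<open>e f\<^sup>m\<^sup>+\<^sup>1 w = 0\<close> forces \<open>\<mu> = a m / 2\<close>. The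
  element \<open>k\<close> serves to show that \<open>e\<close> and \<open>f\<close> act nilpotently.\<close>

lemma eigenvalue_real_multiple:
  assumes fin: "fin_dim (lscale L) G" and G: "e \<in> G" "f \<in> G" "h \<in> G" "k \<in> G" "v \<in> G"
    and k: "br k e = lscale L \<beta> e" "br k f = lscale L (- \<beta>) f" "\<beta> \<noteq> 0" "br k v = lscale L c v" "br h k = 0"
    and h: "br e f = h" "br h e = lscale L a e" "br h f = lscale L (- a) f"
    and v: "v \<noteq> 0" "br h v = lscale L \<gamma> v"
  shows "\<exists>r::real. \<gamma> = a * of_real r"
proof -
  note mem = funpow_ad_mem and eig = funpow_ad_eigenvector
  obtain n where n: "(br e ^^ n) v \<noteq> 0" "br e ((br e ^^ n) v) = 0"
    using nilpotent_on_eigenvector[OF fin G(4,1,5) k(1,3) k(4) v(1)] by blast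
  define w where "w = (br e ^^ n) v"
  define \<mu> where "\<mu> = \<gamma> + of_nat n * a"
  have wG: "w \<in> G" unfolding w_def by (rule mem[OF G(1,5)])
  have hw: "br h w = lscale L \<mu> w" unfolding w_def \<mu>_def by (rule eig[OF G(3,1,5) h(2) v(2)])
  have kw: "br k w = lscale L (c + of_nat n * \<beta>) w" unfolding w_def by (rule eig[OF G(4,1,5) k(1,4)])
  obtain m where m: "(br f ^^ m) w \<noteq> 0" "br f ((br f ^^ m) w) = 0"
    using nilpotent_on_eigenvector[OF fin G(4,2) wG k(2) _ kw] k(3) n(1) unfolding w_def by auto
  have "br e ((br f ^^ Suc j) w) = lscale L (of_nat (Suc j) * \<mu> - a * (of_nat j * of_nat (Suc j) / 2)) ((br f ^^ j) w)" for j
  proof (induction j)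
    case 0
    have "br e (br f w) = br h w + br f (br e w)" using jacobi[OF G(1,2) wG] h(1) by simp
    then show ?case using hw n(2) G(2) unfolding w_def[symmetric] by (simp add: br_zero)
  next
    case (Suc j)
    let ?u = "(br f ^^ Suc j) w"
    have uG: "?u \<in> G" "(br f ^^ j) w \<in> G" using mem[OF G(2) wG] by blast+
    have "br e (br f ?u) = br h ?u + br f (br e ?u)" using jacobi[OF G(1,2) uG(1)] h(1) by simp
    also have "br h ?u = lscale L (\<mu> + of_nat (Suc j) * - a) ?u" by (rule eig[OF G(3,2) wG h(3) hw])
    also have "br f (br e ?u) = lscale L (of_nat (Suc j) * \<mu> - a * (of_nat j * of_nat (Suc j) / 2)) ?u"
      unfolding Suc using br_scale(2)[OF G(2) uG(2)] by simp
    also have "lscale L (\<mu> + of_nat (Suc j) * - a) ?u + \<dots> =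
      lscale L ((\<mu> + of_nat (Suc j) * - a) + (of_nat (Suc j) * \<mu> - a * (of_nat j * of_nat (Suc j) / 2))) ?u"
      by (rule scale_left_distrib[symmetric])
    also have "(\<mu> + of_nat (Suc j) * - a) + (of_nat (Suc j) * \<mu> - a * (of_nat j * of_nat (Suc j) / 2)) =
      of_nat (Suc (Suc j)) * \<mu> - a * (of_nat (Suc j) * of_nat (Suc (Suc j)) / 2)"
      by (simp add: field_simps)
    finally show ?case by simp
  qed
  from this[of m] have "lscale L (of_nat (Suc m) * \<mu> - a * (of_nat m * of_nat (Suc m) / 2)) ((br f ^^ m) w) = 0"
    using m(2) G(1) by (simp add: br_zero)
  then have "of_nat (Suc m) * \<mu> = of_nat (Suc m) * (a * (of_nat m / 2))"
    using m(1) by (simp add: field_simps)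
  then have "\<mu> = a * (of_nat m / 2)" by (simp only: mult_cancel_left of_nat_eq_0_iff) simp
  then have "\<gamma> = a * (of_nat m / 2 - of_nat n)" unfolding \<mu>_def by (simp add: algebra_simps)
  then show ?thesis by (intro exI[of _ "real m / 2 - real n"]) simp
qed

text \<open>Let \<open>e\<close> and \<open>f\<close> be root vectors for opposite roots \<open>\<plusminus>\<alpha>\<close> with \<open>B e f \<noteq> 0\<close>, and \<open>h = [e, f]\<close>. For every
  invariant form \<open>C\<close> and every \<open>k\<close> in \<open>H\<close> one has \<open>C h k = \<alpha> k * C e f\<close>. The eigenvalues of \<open>h\<close> are real
  multiples of \<open>\<alpha> h\<close>, not all zero, so that the Killing form does not vanish at \<open>(h, h)\<close>, nor, therefore,
  at \<open>(e, f)\<close>. With \<open>c\<close> the quotient of the values of the two forms at \<open>(e, f)\<close>, the radical of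
  \<open>killing A - c B\<close> contains \<open>h\<close>; being an ideal, it is everything.\<close>

theorem killing_multiple_of_form:
  assumes simple: "simple_lie L" and fin: "fin_dim (lscale L) G"
    and form: "invariant_form L B" and H: "cartan_subalgebra L H"
  obtains A c where "finite A" "independent A" "span A = G" "c \<noteq> 0"
    "\<And>x y. x \<in> G \<Longrightarrow> y \<in> G \<Longrightarrow> killing A x y = c * B x y"
proof -
  have HG: "H \<subseteq> G" "subspace H" and ab: "\<And>x y. x \<in> H \<Longrightarrow> y \<in> H \<Longrightarrow> br x y = 0"
    and cent: "\<And>x. x \<in> G \<Longrightarrow> (\<And>h. h \<in> H \<Longrightarrow> br h x = 0) \<Longrightarrow> x \<in> H"
    and diag: "\<And>h. h \<in> H \<Longrightarrow> ad_diagonalisable L h"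
    using H unfolding cartan_subalgebra_def by blast+
  have invB: "inv_form B" and nondeg: "\<And>x. x \<in> G \<Longrightarrow> (\<And>y. y \<in> G \<Longrightarrow> B x y = 0) \<Longrightarrow> x = 0"
    using form unfolding invariant_form_def inv_form_def by blast+
  note B = inv_formD[OF invB]
  let ?E = "{x\<in>G. \<forall>h\<in>H. \<exists>c. br h x = lscale L c x}"
  have spanE: "G \<subseteq> span ?E"
    by (rule toral_eigenvectors_span[OF HG(2,1) ab diag fin subspace_G order_refl]) (use HG br_closed in auto)
  have ideals: "I = {0} \<or> I = G" if "lie_ideal L I" for I
    using simple that unfolding simple_lie_def by blast
  obtain x0 y0 where xy0: "x0 \<in> G" "y0 \<in> G" "br x0 y0 \<noteq> 0"
    using simple unfolding simple_lie_def by blast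
  have vanish: "P x" if "x \<in> G" "P 0" "\<And>x y. x \<in> G \<Longrightarrow> y \<in> G \<Longrightarrow> P x \<Longrightarrow> P y \<Longrightarrow> P (x + y)"
    "\<And>c x. x \<in> G \<Longrightarrow> P x \<Longrightarrow> P (lscale L c x)" "\<And>x. x \<in> ?E \<Longrightarrow> P x" for P x
  proof -
    have "span ?E \<subseteq> {x\<in>G. P x}"
      by (rule span_minimal) (use that in \<open>auto intro!: subspaceI simp: G_closed\<close>)
    with spanE that(1) show ?thesis by blast
  qed
  obtain e h1 where e: "e \<in> ?E" and h1: "h1 \<in> H" "br h1 e \<noteq> 0"
  proof (rule ccontr)
    assume "\<not> thesis"
    with that have z: "br h x = 0" if "x \<in> ?E" "h \<in> H" for x h using that by blast
    have "br h x = 0" if "x \<in> G" "h \<in> H" for x h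
    proof (rule vanish[OF that(1), of "\<lambda>x. br h x = 0"])
      have hG: "h \<in> G" using that(2) HG by blast
      show "br h 0 = 0" using hG by (rule br_zero)
      show "br h (y + y') = 0" if "y \<in> G" "y' \<in> G" "br h y = 0" "br h y' = 0" for y y'
        using br_add(2)[OF that(1,2) hG] that(3,4) by simp
      show "br h (lscale L c y) = 0" if "y \<in> G" "br h y = 0" for y c
        using br_scale(2)[OF hG that(1)] that(2) by simp
      show "br h y = 0" if "y \<in> ?E" for y using z[OF that \<open>h \<in> H\<close>] .
    qed
    then have "G \<subseteq> H" using cent by blast
    with xy0 ab show False by blast
  qed
  have eG: "e \<in> G" and h1G: "h1 \<in> G" using e h1 HG by auto
  have e0: "e \<noteq> 0" using h1 h1G by (auto simp: br_zero)
  obtain \<alpha> where \<alpha>: "\<And>h. h \<in> H \<Longrightarrow> br h e = lscale L (\<alpha> h) e" using e by (auto; metis)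
  have \<alpha>1: "\<alpha> h1 \<noteq> 0" using \<alpha>[OF h1(1)] h1(2) by auto
  obtain f where f: "f \<in> ?E" "B e f \<noteq> 0"
  proof (rule ccontr)
    assume "\<not> thesis"
    with that have z: "B e x = 0" if "x \<in> ?E" for x using that by blast
    have "B e x = 0" if "x \<in> G" for x
    proof (rule vanish[OF that, of "\<lambda>x. B e x = 0"])
      show "B e 0 = 0" using B(2)[OF eG G_closed(1), of 0] by simp
    qed (use z eG B in auto)
    with nondeg eG e0 show False by blast
  qed
  have fG: "f \<in> G" using f by auto
  have f\<alpha>: "br h f = lscale L (- \<alpha> h) f" if h: "h \<in> H" for h
  proof -
    have hG: "h \<in> G" using h HG by blast
    obtain d where d: "br h f = lscale L d f" using f h by blast
    have "\<alpha> h * B e f = B (br h e) f" using \<alpha>[OF h] B(4)[OF fG eG] by simp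
    also have "\<dots> = B (- br e h) f" using br_antisym[OF hG eG] by simp
    also have "\<dots> = - B (br e h) f" using B(4)[OF fG br_closed[OF eG hG], of "-1"] by simp
    also have "\<dots> = - B e (br h f)" using B(6)[OF eG hG fG] by simp
    also have "\<dots> = - (d * B e f)" using d B(2)[OF eG fG] by simp
    finally have "(\<alpha> h + d) * B e f = 0" by (simp add: algebra_simps)
    then have "d = - \<alpha> h" using f(2) by (simp add: eq_neg_iff_add_eq_0 add.commute)
    with d show ?thesis by simp
  qed
  define h where "h = br e f"
  have hG: "h \<in> G" unfolding h_def by (rule br_closed[OF eG fG])
  have hH: "h \<in> H"
  proof (rule cent[OF hG])
    fix k assume k: "k \<in> H"
    then have kG: "k \<in> G" using HG by blast
    show "br k h = 0" unfolding h_def jacobi[OF kG eG fG] \<alpha>[OF k] f\<alpha>[OF k]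
        br_scale(1)[OF eG fG] br_scale(2)[OF eG fG] by simp
  qed
  have Ch: "C h k = \<alpha> k * C e f" if C: "inv_form C" and k: "k \<in> H" for C k
  proof -
    have kG: "k \<in> G" using k HG by blast
    have "br f k = lscale L (\<alpha> k) f" using br_antisym[OF fG kG] f\<alpha>[OF k] by simp
    then show ?thesis unfolding h_def using inv_formD(6)[OF C eG fG kG] inv_formD(2)[OF C eG fG] by simp
  qed
  have h0: "h \<noteq> 0"
  proof
    assume "h = 0"
    then have "\<alpha> h1 * B e f = B (lscale L 0 0) h1" using Ch[OF invB h1(1)] by simp
    also have "\<dots> = 0" using B(4)[OF h1G G_closed(1), of 0] by simp
    finally show False using \<alpha>1 f(2) by simp
  qed
  have "\<exists>x\<in>?E. br h x \<noteq> 0"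
  proof (rule ccontr)
    assume z: "\<not> (\<exists>x\<in>?E. br h x \<noteq> 0)"
    have "br h x = 0" if "x \<in> G" for x
    proof (rule vanish[OF that, of "\<lambda>x. br h x = 0"])
      show "br h 0 = 0" using hG by (rule br_zero)
      show "br h (y + y') = 0" if "y \<in> G" "y' \<in> G" "br h y = 0" "br h y' = 0" for y y'
        using br_add(2)[OF that(1,2) hG] that(3,4) by simp
      show "br h (lscale L c y) = 0" if "y \<in> G" "br h y = 0" for y c
        using br_scale(2)[OF hG that(1)] that(2) by simp
      show "br h y = 0" if "y \<in> ?E" for y using z that by blast
    qed
    then have "h \<in> {z\<in>G. \<forall>x\<in>G. br x z = 0}" using hG br_antisym[OF _ hG] by auto
    moreover have "lie_ideal L {z\<in>G. \<forall>x\<in>G. br x z = 0}"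
      unfolding lie_ideal_def
    proof (intro conjI ballI)
      show "subspace {z\<in>G. \<forall>x\<in>G. br x z = 0}"
        by (rule subspaceI) (auto simp: G_closed br_zero br_add br_scale)
    qed (auto simp: br_zero G_closed)
    ultimately have "{z\<in>G. \<forall>x\<in>G. br x z = 0} = G" using ideals h0 by blast
    with xy0 show False by blast
  qed
  then obtain x1 where x1: "x1 \<in> ?E" "br h x1 \<noteq> 0" by blast
  obtain A where A: "A \<subseteq> ?E" "independent A" "?E \<subseteq> span A" using maximal_independent_subset by blast
  have "?E \<subseteq> G" by blast
  have spanA: "span A = G"
  proof
    show "span A \<subseteq> G" using A by (intro span_minimal subspace_G) auto
    show "G \<subseteq> span A" using spanE A(3) span_minimal[OF A(3) subspace_span] by blast
  qed
  have finA: "finite A"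
  proof -
    obtain D where D: "finite D" "G \<subseteq> span D" using fin unfolding fin_dim_def by blast
    have "A \<subseteq> span D" using A(1) D(2) by blast
    then show ?thesis using independent_span_bound[OF D(1) A(2)] by blast
  qed
  have Aprop: "finite A" "independent A" "span A = G" using finA A spanA by auto
  have invK: "inv_form (killing A)" by (rule killing_inv_form[OF Aprop])
  have "\<exists>r::real. \<forall>c. br h x = lscale L c x \<longrightarrow> c = \<alpha> h * of_real r" if x: "x \<in> A" for x
  proof -
    have xE: "x \<in> ?E" "x \<noteq> 0" using A x dependent_zero by auto
    obtain c d where cd: "br h x = lscale L c x" "br h1 x = lscale L d x" using xE(1) hH h1(1) by blast
    have xG: "x \<in> G" using xE by blast
    obtain r :: real where "c = \<alpha> h * of_real r"
      using eigenvalue_real_multiple[OF fin eG fG hG h1G xG \<alpha>[OF h1(1)] f\<alpha>[OF h1(1)] \<alpha>1 cd(2) ab[OF hH h1(1)]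
          h_def[symmetric] \<alpha>[OF hH] f\<alpha>[OF hH] xE(2) cd(1)] by blast
    moreover have "c' = c" if "br h x = lscale L c' x" for c'
      using that cd(1) xE(2) by (simp add: scale_right_imp_eq)
    ultimately show ?thesis by blast
  qed
  then obtain r :: "'g \<Rightarrow> real" where r: "\<And>x c. x \<in> A \<Longrightarrow> br h x = lscale L c x \<Longrightarrow> c = \<alpha> h * of_real (r x)" by metis
  have eigA: "br h x = lscale L (\<alpha> h * of_real (r x)) x" if x: "x \<in> A" for x
  proof -
    obtain c where "br h x = lscale L c x" using A(1) x hH by blast
    with r[OF x this] show ?thesis by simp
  qed
  have Khh: "killing A h h = (\<alpha> h)\<^sup>2 * of_real (\<Sum>x\<in>A. (r x)\<^sup>2)"
    using killing_of_eigenbasis[OF Aprop hG eigA] by (simp add: power_mult_distrib sum_distrib_left)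
  have "\<exists>x\<in>A. \<alpha> h * of_real (r x) \<noteq> 0"
  proof (rule ccontr)
    assume "\<not> ?thesis"
    then have r0: "\<alpha> h * of_real (r x) = 0" if "x \<in> A" for x using that by blast
    have z: "br h x = 0" if "x \<in> A" for x using eigA[OF that] unfolding r0[OF that] by simp
    have "span A \<subseteq> {x\<in>G. br h x = 0}"
      by (rule span_minimal) (use z A(1) hG in \<open>auto intro!: subspaceI simp: G_closed br_zero br_add br_scale\<close>)
    with x1 spanA show False by blast
  qed
  then obtain x2 where x2: "x2 \<in> A" "\<alpha> h \<noteq> 0" "r x2 \<noteq> 0" by auto
  have "(\<Sum>x\<in>A. (r x)\<^sup>2) > 0"
    by (rule sum_pos2[OF finA x2(1)]) (use x2 in auto)
  then have Knz: "killing A h h \<noteq> 0" unfolding Khh using x2 by (simp del: of_real_sum)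
  define c where "c = killing A e f / B e f"
  have c0: "c \<noteq> 0" unfolding c_def using Knz Ch[OF invK hH] f(2) by auto
  have cef: "killing A e f = c * B e f" unfolding c_def using f(2) by simp
  let ?C = "\<lambda>x y. killing A x y - c * B x y"
  have invC: "inv_form ?C"
    using invK invB unfolding inv_form_def linear_form_on_def by (auto simp: algebra_simps)
  note C = inv_formD[OF invC]
  let ?Rad = "{x\<in>G. \<forall>y\<in>G. ?C x y = 0}"
  have "lie_ideal L ?Rad"
    unfolding lie_ideal_def
  proof (intro conjI ballI)
    show "subspace ?Rad"
    proof (rule subspaceI)
      show "0 \<in> ?Rad" using C(4)[OF _ G_closed(1), of _ 0] G_closed by simp
      show "x + y \<in> ?Rad" if "x \<in> ?Rad" "y \<in> ?Rad" for x y
        using that C(3)[of _ x y] G_closed by simp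
      show "lscale L d x \<in> ?Rad" if "x \<in> ?Rad" for d x
        using that C(4)[of _ x d] G_closed by simp
    qed
    show "br x y \<in> ?Rad" if x: "x \<in> G" and y: "y \<in> ?Rad" for x y
    proof -
      have yG: "y \<in> G" using y by blast
      have "?C (br x y) z = 0" if z: "z \<in> G" for z
      proof -
        have "?C (br y x) z = ?C y (br x z)" using C(6)[OF yG x z] .
        also have "\<dots> = 0" using y br_closed[OF x z] by blast
        finally have "?C (br y x) z = 0" .
        moreover have "br x y = lscale L (-1) (br y x)" using br_antisym[OF x yG] by simp
        ultimately show ?thesis using C(4)[OF z br_closed[OF yG x], of "-1"] by simp
      qed
      then show ?thesis using br_closed[OF x yG] by simp
    qed
  qed auto
  moreover have "h \<in> ?Rad"
  proof -
    have "?C h y = 0" if "y \<in> G" for y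
    proof (rule vanish[OF that, of "\<lambda>y. ?C h y = 0"])
      show "?C h 0 = 0" using C(2)[OF hG G_closed(1), of 0] by simp
      show "?C h (x + y) = 0" if "x \<in> G" "y \<in> G" "?C h x = 0" "?C h y = 0" for x y
        using C(1)[OF hG that(1,2)] that(3,4) by simp
      show "?C h (lscale L d x) = 0" if "x \<in> G" "?C h x = 0" for d x
        using C(2)[OF hG that(1), of d] that(2) by simp
      show "?C h y = 0" if y: "y \<in> ?E" for y
      proof (cases "y \<in> H")
        case True
        then show ?thesis using Ch[OF invK True] Ch[OF invB True] cef by simp
      next
        case False
        have yG: "y \<in> G" using y by blast
        obtain k where k: "k \<in> H" "br k y \<noteq> 0" using cent[OF yG] False by blast
        then have kG: "k \<in> G" using HG by blast
        obtain d where d: "br k y = lscale L d y" using y k by blast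
        have "d * ?C h y = ?C h (br k y)" using C(2)[OF hG yG, of d] d by simp
        also have "\<dots> = ?C (br h k) y" using C(6)[OF hG kG yG] by simp
        also have "\<dots> = 0" using ab[OF hH k(1)] C(4)[OF yG G_closed(1), of 0] by simp
        finally show ?thesis using d k(2) by auto
      qed
    qed
    with hG show ?thesis by blast
  qed
  ultimately have Rad: "?Rad = G" using ideals h0 by blast
  have "killing A x y = c * B x y" if "x \<in> G" "y \<in> G" for x y
  proof -
    have "x \<in> ?Rad" using that(1) unfolding Rad .
    with that(2) show ?thesis by auto
  qed
  with Aprop c0 show ?thesis using that by blast
qed

corollary automorphism_preserves_form:
  assumes "simple_lie L" "fin_dim (lscale L) G" "invariant_form L B" "cartan_subalgebra L H"
    and \<sigma>: "lie_automorphism L \<sigma>" and x: "x \<in> G" and y: "y \<in> G"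
  shows "B (\<sigma> x) (\<sigma> y) = B x y"
proof -
  obtain A c where A: "finite A" "independent A" "span A = G" and c: "c \<noteq> 0"
    "\<And>x y. x \<in> G \<Longrightarrow> y \<in> G \<Longrightarrow> killing A x y = c * B x y"
    using killing_multiple_of_form[OF assms(1-4)] by blast
  have "\<sigma> x \<in> G" "\<sigma> y \<in> G" using \<sigma> x y unfolding lie_automorphism_def bij_betw_def by auto
  then show ?thesis using killing_automorphism[OF A \<sigma> x y] c x y by simp
qed

end

section \<open>The twisted full toroidal Lie algebra\<close>

lemma vector_space_K_scale: "vector_space K_scale"
  by unfold_locales
    (transfer; simp add: K_equiv_def K_relations_closed pm.scale_right_distrib pm.scale_left_distrib)+

interpretation ks: complex_space K_scale
  by (rule complex_space.intro) (rule vector_space_K_scale)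

lemma der_K_linear: "der_K d (z + w) = der_K d z + der_K d w" "der_K d (K_scale c z) = K_scale c (der_K d z)"
  by (transfer; simp add: K_equiv_def K_relations_closed der_symbols_add der_symbols_scale)+

lemma der_K_0: "der_K d 0 = 0" "der_K 0 z = 0"
  using der_K_linear(1)[of d 0 0] apply simp
  by (transfer; simp add: K_equiv_def K_relations_closed der_symbols_def)

lemma K_class_linear: "abs_K_space (f + g) = abs_K_space f + abs_K_space g"
  "abs_K_space (pscale c f) = K_scale c (abs_K_space f)" "abs_K_space 0 = 0"
  by (simp_all add: plus_K_space.abs_eq K_scale.abs_eq zero_K_space.abs_eq)

lemma K_class_sum: "abs_K_space (sum h A) = (\<Sum>i\<in>A. abs_K_space (h i))"
  by (induction A rule: infinite_finite_induct) (simp_all add: K_class_linear)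

lemma K_class_single: "abs_K_space (single (r, i) c) = K_scale c (K_symbol r i)"
  by (simp add: K_symbol.abs_eq K_scale.abs_eq)

lemma K_symbol_relation: "(\<Sum>i\<in>UNIV. K_scale (of_int (r i)) (K_symbol r i)) = 0"
proof -
  have "(\<Sum>i\<in>UNIV. K_scale (of_int (r i)) (K_symbol r i)) = abs_K_space (K_relation r)"
    by (simp add: K_relation_def K_class_sum K_class_single)
  also have "\<dots> = abs_K_space 0"
    by (subst K_space.abs_eq_iff) (simp add: K_equiv_def K_relations_def pm.span_base)
  finally show ?thesis by (simp add: K_class_linear)
qed

lemma der_K_symbol:
  "der_K (single (r, a) c) (K_symbol s b) = K_scale (c * of_int (s a)) (K_symbol (r + s) b) +
    (if a = b then K_scale c (\<Sum>p\<in>UNIV. K_scale (of_int (r p)) (K_symbol (r + s) p)) else 0)"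
proof (cases "c = 0")
  case True
  then show ?thesis by (simp add: der_K_0)
next
  case False
  have "der_K (single (r, a) c) (K_symbol s b) = abs_K_space (der_symbols (single (r, a) c) (single (s, b) 1))"
    by (simp add: K_symbol.abs_eq der_K.abs_eq)
  also have "der_symbols (single (r, a) c) (single (s, b) 1) = pscale c (single (r + s, b) (of_int (s a)) +
       (if a = b then \<Sum>p\<in>UNIV. single (r + s, p) (of_int (r p)) else 0))"
    using False by (simp add: der_symbols_single)
  also have "abs_K_space \<dots> = K_scale c (K_scale (of_int (s a)) (K_symbol (r + s) b)) +
    (if a = b then K_scale c (\<Sum>p\<in>UNIV. K_scale (of_int (r p)) (K_symbol (r + s) p)) else 0)"
    by (simp add: K_class_linear K_class_sum K_class_single ks.scale_right_distrib del: pscale_single)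
  finally show ?thesis by simp
qed

locale toroidal =
  fixes D :: "('n::finite, 'g::ab_group_add) toroidal_data"
  assumes datum: "toroidal_datum D"
begin

lemma datumD:
  "simple_lie (fin_alg D)" "fin_dim (lscale (fin_alg D)) (lcarrier (fin_alg D))"
  "invariant_form (fin_alg D) (form D)" "lie_automorphism (fin_alg D) (aut D i)"
  "0 < ord D i" "unity D i ^ ord D i = 1" "0 < q \<Longrightarrow> q < ord D i \<Longrightarrow> unity D i ^ q \<noteq> 1"
  "cartan_subalgebra (fixed_alg D) (csa0 D)" "cartan_subalgebra (fin_alg D) (csa D)" "csa0 D \<subseteq> csa D"
  "weights (fin_alg D) (csa0 D) = roots_en D" "positive_roots (roots_en D - {0}) (pos D)"
  using datum unfolding toroidal_datum_def Let_def by blast+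

sublocale g: lie_alg "fin_alg D"
  using datumD(1) by (simp add: lie_alg_def simple_lie_def)

lemma csa0: "csa0 D \<subseteq> graded_part D 0" "g.subspace (csa0 D)"
  "h \<in> csa0 D \<Longrightarrow> h' \<in> csa0 D \<Longrightarrow> g.br h h' = 0" "h \<in> csa0 D \<Longrightarrow> ad_diagonalisable (fin_alg D) h"
  using datumD(8-10) unfolding cartan_subalgebra_def fixed_alg_def by auto

lemma gp_subset: "graded_part D k \<subseteq> g.G"
  by (auto simp: graded_part_def)

lemma csa0_subset: "csa0 D \<subseteq> g.G"
  using csa0(1) gp_subset by blast

lemma aut_endo: "linear_endo_on (lscale (fin_alg D)) g.G (aut D i)"
  using datumD(4)[of i] unfolding lie_automorphism_def linear_endo_on_def bij_betw_def by blast

lemma subspace_gp: "g.subspace (graded_part D k)"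
proof -
  note lin = g.endo_add[OF g.subspace_G aut_endo] g.endo_scale[OF g.subspace_G aut_endo] g.endo_0[OF g.subspace_G aut_endo]
  show ?thesis
    by (rule g.subspaceI) (auto simp: graded_part_def g.G_closed lin g.scale_right_distrib mult.commute)
qed

lemma unity_nonzero: "unity D i \<noteq> 0"
  using datumD(5,6)[of i] by (metis power_0_left neq0_conv zero_neq_one)

lemma gp_bracket: "x \<in> graded_part D k \<Longrightarrow> y \<in> graded_part D l \<Longrightarrow> g.br x y \<in> graded_part D (k + l)"
  using datumD(4) unity_nonzero
  by (auto simp: graded_part_def g.br_closed lie_automorphism_def g.br_scale g.G_closed power_int_add mult.commute)

lemma unity_Gam: "r \<in> Gam D \<Longrightarrow> unity D i powi r i = 1"
proof -
  assume "r \<in> Gam D"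
  then obtain q where "r i = int (ord D i) * q" by (auto simp: Gam_def dvd_def)
  then show ?thesis using datumD(6)[of i] by (simp add: power_int_mult)
qed

lemma gp_shift: "r \<in> Gam D \<Longrightarrow> graded_part D (k + r) = graded_part D k"
  using unity_nonzero by (auto simp: graded_part_def power_int_add unity_Gam)

lemma Gam_closed: "0 \<in> Gam D" "r \<in> Gam D \<Longrightarrow> s \<in> Gam D \<Longrightarrow> r + s \<in> Gam D" "r \<in> Gam D \<Longrightarrow> - r \<in> Gam D"
  by (auto simp: Gam_def)

text \<open>By invariance under \<open>\<sigma>\<^sub>i\<close> the value of the form is multiplied by \<open>\<xi>\<^sub>i\<close> to the power \<open>k\<^sub>i + l\<^sub>i\<close>.\<close>

lemma form_degree:
  assumes x: "x \<in> graded_part D k" and y: "y \<in> graded_part D l" and nz: "form D x y \<noteq> 0"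
  shows "k + l \<in> Gam D"
proof -
  have xy: "x \<in> g.G" "y \<in> g.G" using x y gp_subset by blast+
  have lin: "form D u (lscale (fin_alg D) c v) = c * form D u v" "form D (lscale (fin_alg D) c u) v = c * form D u v"
    if "u \<in> g.G" "v \<in> g.G" for u v c
    using g.inv_formD(2)[of "form D" u v c] g.inv_formD(4)[of "form D" v u c] that datumD(3)
    unfolding invariant_form_def g.inv_form_def by blast+
  have one: "unity D i powi (k i + l i) = 1" for i
  proof -
    have "form D x y = form D (aut D i x) (aut D i y)"
      using g.automorphism_preserves_form[OF datumD(1-3,9) datumD(4) xy] by simp
    also have "\<dots> = unity D i powi k i * (unity D i powi l i * form D x y)"
      using x y xy by (simp add: graded_part_def lin g.G_closed)
    finally show ?thesis using nz unity_nonzero by (simp add: power_int_add)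
  qed
  have "int (ord D i) dvd k i + l i" for i
  proof -
    define q where "q = nat ((k i + l i) mod int (ord D i))"
    have q: "int q = (k i + l i) mod int (ord D i)" "q < ord D i"
      using datumD(5)[of i] by (auto simp: q_def nat_less_iff)
    have "unity D i powi j = unity D i ^ q" if "j = int (ord D i) * p + int q" for j p
      using unity_nonzero[of i] datumD(6)[of i] that by (simp add: power_int_add power_int_mult)
    from this[of "k i + l i" "(k i + l i) div int (ord D i)"]
    have "unity D i powi (k i + l i) = unity D i ^ q" by (simp add: q)
    then have "q = 0" using one[of i] datumD(7)[of q i] q(2) by auto
    then show ?thesis using q by (simp add: dvd_eq_mod_eq_0)
  qed
  then show ?thesis by (simp add: Gam_def)
qed

abbreviation "T \<equiv> tau D"
abbreviation "loops \<equiv> {x. \<forall>k. lookup x k \<in> graded_part D k}"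
abbreviation "KZ \<equiv> ks.span {K_symbol r i | r i. r \<in> Gam D}"
abbreviation "ders \<equiv> {d :: 'n symbols. keys d \<subseteq> Gam D \<times> UNIV}"

lemma tau_carrier: "(x, z, d) \<in> lcarrier T \<longleftrightarrow> x \<in> loops \<and> z \<in> KZ \<and> d \<in> ders"
  by (simp add: tau_def)

lemma tau_bracket: "lbracket T (x, z, d) (y, w, e) =
  (loop_bracket (fin_alg D) x y + der_loop (fin_alg D) d y - der_loop (fin_alg D) e x,
   loop_cocycle (form D) x y + der_K d w - der_K e z + der_cocycle (coc1 D) (coc2 D) d e, der_der d e)"
  by (simp add: tau_def)

lemma tau_scale: "lscale T c (x, z, d) = (Poly_Mapping.map (lscale (fin_alg D) c) x, K_scale c z, pscale c d)"
  by (simp add: tau_def)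

lemma lookup_loop_scale: "lookup (Poly_Mapping.map (lscale (fin_alg D) c) x) k = lscale (fin_alg D) c (lookup x k)"
  by (simp add: map.rep_eq when_def)

lemma loop_scale_0: "Poly_Mapping.map (lscale (fin_alg D) c) 0 = 0"
  by (rule poly_mapping_eqI) (simp add: lookup_loop_scale)

lemma vector_space_tau: "vector_space (lscale T)"
proof
  fix a b :: complex and x y :: "('n, 'g) toroidal"
  obtain x1 x2 x3 y1 y2 y3 where xy: "x = (x1, x2, x3)" "y = (y1, y2, y3)" by (metis prod_cases3)
  show "lscale T a (x + y) = lscale T a x + lscale T a y"
    unfolding xy plus_prod_def fst_conv snd_conv tau_scale
    by (auto intro!: poly_mapping_eqI simp: lookup_loop_scale lookup_add g.scale_right_distrib ks.scale_right_distrib pm.scale_right_distrib algebra_simps)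
  show "lscale T (a + b) x = lscale T a x + lscale T b x"
    unfolding xy plus_prod_def fst_conv snd_conv tau_scale
    by (auto intro!: poly_mapping_eqI simp: lookup_loop_scale lookup_add g.scale_left_distrib ks.scale_left_distrib algebra_simps)
  show "lscale T a (lscale T b x) = lscale T (a * b) x"
    unfolding xy tau_scale by (auto intro!: poly_mapping_eqI simp: lookup_loop_scale)
  show "lscale T 1 x = x"
    unfolding xy tau_scale by (auto intro!: poly_mapping_eqI simp: lookup_loop_scale)
qed

sublocale t: complex_space "lscale T"
  by (rule complex_space.intro) (rule vector_space_tau)

lemma loops_closed: "0 \<in> loops" "x \<in> loops \<Longrightarrow> y \<in> loops \<Longrightarrow> x + y \<in> loops"
  "x \<in> loops \<Longrightarrow> y \<in> loops \<Longrightarrow> x - y \<in> loops" "v \<in> graded_part D k \<Longrightarrow> single k v \<in> loops"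
  "x \<in> loops \<Longrightarrow> Poly_Mapping.map (lscale (fin_alg D) c) x \<in> loops"
  using g.subspace_0[OF subspace_gp] g.subspace_add[OF subspace_gp] g.subspace_diff[OF subspace_gp] g.subspace_scale[OF subspace_gp]
  by (auto simp: lookup_add lookup_minus lookup_single when_def lookup_loop_scale)

lemma loops_sum: "(\<And>i. i \<in> I \<Longrightarrow> h i \<in> loops) \<Longrightarrow> sum h I \<in> loops"
  by (induction I rule: infinite_finite_induct) (use loops_closed(1,2) in auto)

lemma subspace_tau: "t.subspace (lcarrier T)"
proof (rule t.subspaceI)
  show "0 \<in> lcarrier T" unfolding zero_prod_def tau_carrier using loops_closed(1) ks.span_zero by auto
next
  fix x y assume xy: "x \<in> lcarrier T" "y \<in> lcarrier T"
  obtain x1 x2 x3 y1 y2 y3 where e: "x = (x1, x2, x3)" "y = (y1, y2, y3)" by (metis prod_cases3)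
  show "x + y \<in> lcarrier T"
    using xy loops_closed(2) ks.span_add pm.subspace_add[OF subspace_keys_subset[of "Gam D \<times> UNIV"]]
    unfolding e plus_prod_def fst_conv snd_conv tau_carrier by blast
next
  fix c x assume x: "x \<in> lcarrier T"
  obtain x1 x2 x3 where e: "x = (x1, x2, x3)" by (metis prod_cases3)
  show "lscale T c x \<in> lcarrier T"
    using x loops_closed(5) ks.span_scale pm.subspace_scale[OF subspace_keys_subset[of "Gam D \<times> UNIV"]]
    unfolding e tau_scale tau_carrier by blast
qed

lemma KZ_symbol: "r \<in> Gam D \<Longrightarrow> K_symbol r i \<in> KZ"
  by (rule ks.span_base) blast

text \<open>This is where the invariance of the form under the automorphisms enters: it is only because
  of it that the brackets of loops have central components with exponents in \<open>Gam D\<close>.\<close>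

lemma tau_bracket_closed:
  assumes "X \<in> lcarrier T" "Y \<in> lcarrier T" shows "lbracket T X Y \<in> lcarrier T"
proof -
  obtain x z d y w e where e: "X = (x, z, d)" "Y = (y, w, e)" by (metis prod_cases3)
  have x: "x \<in> loops" "z \<in> KZ" "d \<in> ders" and y: "y \<in> loops" "w \<in> KZ" "e \<in> ders"
    using assms unfolding e tau_carrier by auto
  have "loop_bracket (fin_alg D) x y \<in> loops"
    unfolding loop_bracket_def by (intro loops_sum loops_closed(4) gp_bracket) (use x y in auto)
  moreover have dl: "der_loop (fin_alg D) d' x' \<in> loops" if d': "d' \<in> ders" and x': "x' \<in> loops" for d' x'
  proof -
    have "single (k + r) (lscale (fin_alg D) c (lookup x' k)) \<in> loops" if "r \<in> Gam D" for k r c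
      using g.subspace_scale[OF subspace_gp] x' gp_shift[OF that] by (intro loops_closed(4)) auto
    then show ?thesis unfolding der_loop_def split_def using d' by (intro loops_sum) auto
  qed
  ultimately have 1: "loop_bracket (fin_alg D) x y + der_loop (fin_alg D) d y - der_loop (fin_alg D) e x \<in> loops"
    using x y by (intro loops_closed(2,3))
  have "loop_cocycle (form D) x y \<in> KZ"
    unfolding loop_cocycle_def
  proof (intro ks.span_sum)
    fix k l
    show "K_scale (form D (lookup x k) (lookup y l)) (\<Sum>i\<in>UNIV. K_scale (of_int (k i)) (K_symbol (k + l) i)) \<in> KZ"
    proof (cases "form D (lookup x k) (lookup y l) = 0")
      case False
      then have "k + l \<in> Gam D" using form_degree x(1) y(1) by blast
      then show ?thesis by (intro ks.span_scale ks.span_sum KZ_symbol)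
    qed (simp add: ks.span_zero)
  qed
  moreover have dK: "der_K d' z' \<in> KZ" if d': "d' \<in> ders" and z': "z' \<in> KZ" for d' z'
    using z'
  proof (induction rule: ks.span_induct_alt)
    case base
    show ?case by (simp add: der_K_0 ks.span_zero)
  next
    case (step c u v)
    then obtain s b where s: "s \<in> Gam D" "u = K_symbol s b" by blast
    have "der_K d' u = abs_K_space (der_symbols d' (single (s, b) 1))"
      by (simp add: s K_symbol.abs_eq der_K.abs_eq)
    also have "\<dots> = (\<Sum>(r, a)\<in>keys d'. K_scale (lookup d' (r, a)) (K_scale (of_int (s a)) (K_symbol (r + s) b) +
      (if a = b then \<Sum>p\<in>UNIV. K_scale (of_int (r p)) (K_symbol (r + s) p) else 0)))"
      unfolding der_symbols_single
      by (simp add: K_class_sum K_class_linear K_class_single split_def if_distrib cong: if_cong del: pscale_single)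
    also have "\<dots> \<in> KZ"
      unfolding split_def
    proof (intro ks.span_sum ks.span_scale ks.span_add)
      fix q assume "q \<in> keys d'"
      then have q: "fst q + s \<in> Gam D" using d' s(1) by (intro Gam_closed(2)) auto
      then show "K_symbol (fst q + s) b \<in> KZ" by (rule KZ_symbol)
      show "(if snd q = b then \<Sum>p\<in>UNIV. K_scale (of_int (fst q p)) (K_symbol (fst q + s) p) else 0) \<in> KZ"
        using KZ_symbol[OF q] by (auto intro: ks.span_zero intro!: ks.span_sum ks.span_scale)
    qed
    finally have "der_K d' u \<in> KZ" .
    then show ?case unfolding der_K_linear using step.IH by (intro ks.span_add ks.span_scale)
  qed
  moreover have "der_cocycle (coc1 D) (coc2 D) d e \<in> KZ"
    unfolding der_cocycle_def split_def
  proof (intro ks.span_sum ks.span_scale)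
    fix q q' p assume "q \<in> keys d" "q' \<in> keys e"
    then show "K_symbol (fst q + fst q') p \<in> KZ" using x y by (intro KZ_symbol Gam_closed(2)) auto
  qed
  ultimately have 2: "loop_cocycle (form D) x y + der_K d w - der_K e z + der_cocycle (coc1 D) (coc2 D) d e \<in> KZ"
    using x y by (intro ks.span_add ks.span_diff)
  have single: "single (fst q + fst q', p) c \<in> ders" if "q \<in> keys d" "q' \<in> keys e" for q q' :: "'n exponent \<times> 'n option" and p c
  proof -
    have "fst q + fst q' \<in> Gam D" using that x y by (intro Gam_closed(2)) auto
    then show ?thesis by simp
  qed
  have 3: "der_der d e \<in> ders"
    unfolding der_der_def split_def
    by (intro pm.subspace_sum[OF subspace_keys_subset] pm.subspace_scale[OF subspace_keys_subset]
        pm.subspace_diff[OF subspace_keys_subset] single; assumption)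
  show ?thesis unfolding e tau_bracket tau_carrier using 1 2 3 by simp
qed

subsection \<open>Gradings\<close>

text \<open>A common form of the elements \<open>d\<^sub>i\<close>, \<open>h\<close> and \<open>d\<^sub>0 + h\<close>, whose brackets with the spanning elements
  are then computed once.\<close>

definition torus_elt :: "'g \<Rightarrow> 'n option \<Rightarrow> complex \<Rightarrow> ('n, 'g) toroidal"
  where "torus_elt h i c = (single 0 h, 0, single (0, i) c)"

lemma d_elt_eq: "d_elt i = torus_elt 0 i 1" and g_elt_eq: "g_elt h = torus_elt h i 0"
  by (simp_all add: d_elt_def g_elt_def torus_elt_def)

lemma loop_bracket_single: "h \<in> g.G \<Longrightarrow> v \<in> g.G \<Longrightarrow> loop_bracket (fin_alg D) (single k h) (single l v) = single (k + l) (g.br h v)"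
  by (simp add: loop_bracket_def g.br_zero)

lemma der_loop_single: "v \<in> g.G \<Longrightarrow> der_loop (fin_alg D) (single (r, a) c) (single k v) = single (k + r) (lscale (fin_alg D) (c * of_int (k a)) v)"
  by (simp add: der_loop_def)

lemma loop_cocycle_zero_exponent: "loop_cocycle (form D) (single 0 h) y = 0"
  by (simp add: loop_cocycle_def)

lemma loop_operations_0: "loop_bracket (fin_alg D) 0 y = 0" "loop_bracket (fin_alg D) x 0 = 0" "loop_cocycle (form D) 0 y = 0"
  "loop_cocycle (form D) x 0 = 0" "der_loop (fin_alg D) 0 y = 0" "der_loop (fin_alg D) d 0 = 0"
  "der_cocycle c1 c2 0 e = 0" "der_cocycle c1 c2 d 0 = 0" "der_der 0 e = 0" "der_der d 0 = 0"
  by (simp_all add: loop_bracket_def loop_cocycle_def der_loop_def der_cocycle_def der_der_def)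

lemma der_loop_zero_exponent: "der_loop (fin_alg D) d (single 0 h) = 0"
  by (simp add: der_loop_def split_def)

lemma der_der_single: "der_der (single (r, a) c) (single (s, b) d) =
  pscale (c * d) (single (r + s, b) (of_int (s a)) - single (r + s, a) (of_int (r b)))"
  by (simp add: der_der_def)

lemma der_cocycle_zero_exponent: "der_cocycle c1 c2 (single (0, i) c) e = 0"
  by (simp add: der_cocycle_def split_def)

lemma torus_bracket_loop: "h \<in> g.G \<Longrightarrow> v \<in> g.G \<Longrightarrow>
  lbracket T (torus_elt h i c) (single k v, 0, 0) = (single k (g.br h v + lscale (fin_alg D) (c * of_int (k i)) v), 0, 0)"
  unfolding torus_elt_def tau_bracket
  by (simp add: loop_bracket_single der_loop_single loop_cocycle_zero_exponent loop_operations_0 der_K_0 single_add)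

lemma torus_bracket_K: "lbracket T (torus_elt h i c) (0, K_symbol r p, 0) = (0, K_scale (c * of_int (r i)) (K_symbol r p), 0)"
  unfolding torus_elt_def tau_bracket
  by (simp add: loop_operations_0 der_K_0 der_K_symbol)

lemma torus_bracket_der: "lbracket T (torus_elt h i c) (0, 0, single (r, a) 1) = (0, 0, single (r, a) (c * of_int (r i)))"
  unfolding torus_elt_def tau_bracket
  by (simp add: loop_operations_0 der_K_0 der_loop_zero_exponent der_der_single der_cocycle_zero_exponent)

lemma torus_bracket_split: "lbracket T (torus_elt h i c) X = lbracket T (torus_elt h i 0) X + lbracket T (torus_elt 0 i c) X"
proof -
  obtain y w e where X: "X = (y, w, e)" by (metis prod_cases3)
  show ?thesis unfolding X torus_elt_def tau_bracket plus_prod_def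
    by (simp add: loop_operations_0 der_K_0 loop_cocycle_zero_exponent der_loop_zero_exponent der_cocycle_zero_exponent)
qed

lemma tau_mem: "v \<in> graded_part D k \<Longrightarrow> (single k v, 0, 0) \<in> lcarrier T"
  "r \<in> Gam D \<Longrightarrow> (0, K_symbol r p, 0) \<in> lcarrier T" "r \<in> Gam D \<Longrightarrow> (0, 0, single (r, a) c) \<in> lcarrier T"
  unfolding tau_carrier using loops_closed(1) loops_closed(4)[of v k] ks.span_zero KZ_symbol by auto

lemma torus_mem: "h \<in> graded_part D 0 \<Longrightarrow> torus_elt h i c \<in> lcarrier T"
  unfolding torus_elt_def tau_carrier using loops_closed(4)[of h 0] ks.span_zero Gam_closed(1) by auto

text \<open>The Lie algebra is spanned by the \<open>x \<otimes> t\<^sup>k\<close> with \<open>x\<close> in given spanning sets \<open>A k\<close>, together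
  with the \<open>t\<^sup>r K\<^sub>p\<close> and \<open>t\<^sup>r d\<^sub>a\<close>.\<close>

lemma tau_spanned:
  assumes A: "\<And>k. graded_part D k \<subseteq> g.span (A k)"
    and Q: "\<And>k v. v \<in> A k \<Longrightarrow> (single k v, 0, 0) \<in> Q"
      "\<And>r p. r \<in> Gam D \<Longrightarrow> (0, K_symbol r p, 0) \<in> Q" "\<And>r a. r \<in> Gam D \<Longrightarrow> (0, 0, single (r, a) 1) \<in> Q"
  shows "lcarrier T \<subseteq> t.span Q"
proof
  fix X assume X: "X \<in> lcarrier T"
  obtain x z d where e: "X = (x, z, d)" by (metis prod_cases3)
  have x: "x \<in> loops" "z \<in> KZ" "keys d \<subseteq> Gam D \<times> UNIV" using X unfolding e tau_carrier by auto
  have 1: "(single k v, 0, 0) \<in> t.span Q" if "v \<in> graded_part D k" for k v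
  proof -
    have "v \<in> g.span (A k)" using A that by blast
    then show ?thesis
    proof (induction rule: g.span_induct_alt)
      case base
      then show ?case using t.span_zero by (simp add: zero_prod_def)
    next
      case (step c u w)
      have "lscale T c (single k u, 0, 0) + (single k w, 0, 0) \<in> t.span Q"
        by (rule t.span_add[OF t.span_scale[OF t.span_base[OF Q(1)[OF step.hyps(1)]]] step.IH])
      moreover have "lscale T c (single k u, 0, 0) + (single k w, 0, 0) = (single k (lscale (fin_alg D) c u + w), 0, 0)"
        unfolding tau_scale plus_prod_def
        by (auto intro!: poly_mapping_eqI simp: lookup_loop_scale lookup_add lookup_single when_def)
      ultimately show ?case by simp
    qed
  qed
  have s: "(\<Sum>k\<in>I. (single k (lookup x k), 0, 0) :: ('n, 'g) toroidal) = (\<Sum>k\<in>I. single k (lookup x k), 0, 0)" if "finite I" for I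
    using that by (induction I rule: finite_induct) (auto simp: zero_prod_def plus_prod_def)
  have "(\<Sum>k\<in>keys x. single k (lookup x k)) = x"
    by (rule poly_mapping_eqI) (auto simp: lookup_sum lookup_single when_def in_keys_iff if_distrib cong: if_cong)
  with s[OF finite_keys[of x]] have "((x, 0, 0) :: ('n, 'g) toroidal) = (\<Sum>k\<in>keys x. (single k (lookup x k), 0, 0))" by simp
  also have "\<dots> \<in> t.span Q" using x(1) 1 by (intro t.span_sum) auto
  finally have a: "(x, 0, 0) \<in> t.span Q" .
  have b: "(0, z, 0) \<in> t.span Q"
    using x(2)
  proof (induction rule: ks.span_induct_alt)
    case base
    then show ?case using t.span_zero by (simp add: zero_prod_def)
  next
    case (step c u w)
    then have "(0, u, 0) \<in> Q" using Q(2) by blast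
    from t.span_add[OF t.span_scale[OF t.span_base[OF this]] step.IH]
    show ?case unfolding tau_scale plus_prod_def by (simp add: loop_scale_0)
  qed
  have c: "(0, 0, d) \<in> t.span Q"
    using x(3)
  proof (induction rule: keys_subset_induct)
    case base
    then show ?case using t.span_zero by (simp add: zero_prod_def)
  next
    case (step c k g)
    then have "(0, 0, single k 1) \<in> Q" using Q(3) by (cases k) blast
    from t.span_add[OF t.span_scale[OF t.span_base[OF this]] step.IH]
    show ?case unfolding tau_scale plus_prod_def by (simp add: loop_scale_0)
  qed
  have "(x, 0, 0) + (0, z, 0) + (0, 0, d) \<in> t.span Q" using a b c by (intro t.span_add)
  then show "X \<in> t.span Q" unfolding e plus_prod_def by simp
qed

text \<open>All degrees for \<open>d\<^sub>0\<close> are integers. This version is used to find a highest vector, as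
  the step by which a positive element raises eigenvalues is then at least one.\<close>

lemma integral_degree_grading:
  "graded_by T (d_elt None) (\<Union>q\<in>{0<..}. tau_deg D (of_int q)) (tau_zero D) (\<Union>q\<in>{..<0}. tau_deg D (of_int q))"
proof -
  let ?P = "\<Union>q\<in>{0<..}. tau_deg D (of_int q)" and ?N = "\<Union>q\<in>{..<0}. tau_deg D (of_int q)"
  have deg: "X \<in> ?P \<union> tau_zero D \<union> ?N" if "X \<in> tau_deg D (of_int q)" for X q
    using that by (cases q "0::int" rule: linorder_cases) (auto simp: tau_zero_def)
  have "lcarrier T \<subseteq> t.span (?P \<union> tau_zero D \<union> ?N)"
  proof (rule tau_spanned[of "graded_part D"])
    show "graded_part D k \<subseteq> g.span (graded_part D k)" for k by (rule g.span_superset)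
    show "(single k v, 0, 0) \<in> ?P \<union> tau_zero D \<union> ?N" if v: "v \<in> graded_part D k" for k v
    proof (rule deg)
      have vG: "v \<in> g.G" using v gp_subset by blast
      have "lbracket T (d_elt None) (single k v, 0, 0) = lscale T (of_real (of_int (k None))) (single k v, 0, 0)"
        unfolding d_elt_eq torus_bracket_loop[OF g.G_closed(1) vG] tau_scale
        by (auto intro!: poly_mapping_eqI simp: vG g.br_zero lookup_loop_scale lookup_single when_def)
      then show "(single k v, 0, 0) \<in> tau_deg D (of_int (k None))"
        unfolding tau_deg_def using tau_mem(1)[OF v] by simp
    qed
    show "(0, K_symbol r p, 0) \<in> ?P \<union> tau_zero D \<union> ?N" if r: "r \<in> Gam D" for r p
      by (rule deg[of _ "r None"]) (simp add: tau_deg_def tau_mem(2)[OF r] d_elt_eq torus_bracket_K tau_scale loop_scale_0)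
    show "(0, 0, single (r, a) 1) \<in> ?P \<union> tau_zero D \<union> ?N" if r: "r \<in> Gam D" for r a
      by (rule deg[of _ "r None"]) (simp add: tau_deg_def tau_mem(3)[OF r] d_elt_eq torus_bracket_der tau_scale loop_scale_0)
  qed
  moreover have "d_elt None \<in> lcarrier T"
    unfolding d_elt_eq by (rule torus_mem) (rule g.subspace_0[OF subspace_gp])
  ultimately show ?thesis
    unfolding graded_by_def using vector_space_tau subspace_tau tau_bracket_closed
    by (auto simp: tau_deg_def tau_zero_def intro: exI[of _ "real_of_int _"])
qed

lemma degree_grading:
  "graded_by T (d_elt None) (\<Union>q\<in>{0<..}. tau_deg D q) (tau_zero D) (\<Union>q\<in>{..<0}. tau_deg D q)"
proof -
  let ?P = "\<Union>q\<in>{0<..}. tau_deg D (of_int q)" and ?N = "\<Union>q\<in>{..<0}. tau_deg D (of_int q)"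
  have "?P \<union> tau_zero D \<union> ?N \<subseteq> (\<Union>q\<in>{0<..}. tau_deg D q) \<union> tau_zero D \<union> (\<Union>q\<in>{..<0}. tau_deg D q)"
    by fastforce
  note mono = t.span_mono[OF this]
  have "lcarrier T \<subseteq> t.span (?P \<union> tau_zero D \<union> ?N)"
    using integral_degree_grading unfolding graded_by_def by (elim conjE)
  from this mono have "lcarrier T \<subseteq> t.span ((\<Union>q\<in>{0<..}. tau_deg D q) \<union> tau_zero D \<union> (\<Union>q\<in>{..<0}. tau_deg D q))"
    by (rule order_trans)
  moreover have "d_elt None \<in> lcarrier T"
    using integral_degree_grading unfolding graded_by_def by blast
  ultimately show ?thesis
    unfolding graded_by_def using vector_space_tau subspace_tau tau_bracket_closed
    by (auto simp: tau_deg_def tau_zero_def)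
qed

lemma roots: "\<alpha> \<in> roots_en D \<Longrightarrow> linear_form_on (lscale (fin_alg D)) (csa0 D) \<alpha>"
  "\<alpha> \<in> roots_en D \<Longrightarrow> x \<notin> csa0 D \<Longrightarrow> \<alpha> x = 0"
  "\<alpha> \<in> roots_en D \<Longrightarrow> \<exists>x\<in>g.G. x \<noteq> 0 \<and> (\<forall>h\<in>csa0 D. g.br h x = lscale (fin_alg D) (\<alpha> h) x)"
  unfolding datumD(11)[symmetric] weights_def by blast+

text \<open>All simple roots take the same value on \<open>h\<close>, so that positive roots are positive on it. The
  value is so small that \<open>\<bar>\<alpha> h\<bar> < 1\<close> for all roots: then \<open>k\<^sub>0 + \<alpha> h\<close> is positive exactly for the positive
  roots \<open>\<alpha> + k\<^sub>0 \<delta>\<^sub>0\<close> of the affine root system.\<close>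

lemma small_dominant_element:
  obtains h q where "h \<in> csa0 D" "\<And>\<alpha>. \<alpha> \<in> roots_en D \<Longrightarrow> \<alpha> h = of_real (q \<alpha>)" "\<And>\<alpha>. \<alpha> \<in> roots_en D \<Longrightarrow> \<bar>q \<alpha>\<bar> < 1"
    "\<And>\<alpha>. \<alpha> \<in> pos D \<Longrightarrow> \<alpha> \<in> roots_en D \<and> q \<alpha> > 0" "\<And>\<alpha>. \<alpha> \<in> roots_en D \<Longrightarrow> \<alpha> \<noteq> 0 \<Longrightarrow> \<alpha> \<notin> pos D \<Longrightarrow> q \<alpha> < 0"
proof -
  obtain \<Pi> where \<Pi>: "finite \<Pi>" "\<Pi> \<subseteq> roots_en D - {0}"
    and indep: "\<And>c. (\<Sum>\<beta>\<in>\<Pi>. (\<lambda>x. c \<beta> * \<beta> x)) = 0 \<Longrightarrow> \<forall>\<beta>\<in>\<Pi>. c \<beta> = (0::complex)"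
    and cases: "\<And>\<alpha>. \<alpha> \<in> roots_en D - {0} \<Longrightarrow> \<alpha> \<in> nat_comb \<Pi> \<or> - \<alpha> \<in> nat_comb \<Pi>"
    and pos: "pos D = (roots_en D - {0}) \<inter> nat_comb \<Pi>"
    using datumD(12) unfolding positive_roots_def by blast
  have "\<exists>h\<in>csa0 D. \<forall>\<beta>\<in>\<Pi>. \<beta> h = 1"
  proof (rule g.prescribe_values_of_independent_forms[OF csa0(2) \<Pi>(1)])
    show "linear_form_on (lscale (fin_alg D)) (csa0 D) \<beta>" if "\<beta> \<in> \<Pi>" for \<beta>
      using roots(1)[of \<beta>] \<Pi>(2) that by auto
    fix c assume c: "\<And>h. h \<in> csa0 D \<Longrightarrow> (\<Sum>\<beta>\<in>\<Pi>. c \<beta> * \<beta> h) = 0"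
    have off: "(\<Sum>\<beta>\<in>\<Pi>. c \<beta> * \<beta> h) = 0" for h
    proof (cases "h \<in> csa0 D")
      case False
      have "c \<beta> * \<beta> h = 0" if "\<beta> \<in> \<Pi>" for \<beta> using roots(2)[OF _ False, of \<beta>] \<Pi>(2) that by auto
      then show ?thesis by (intro sum.neutral ballI)
    qed (rule c)
    have "(\<Sum>\<beta>\<in>\<Pi>. (\<lambda>x. c \<beta> * \<beta> x)) y = (\<Sum>\<beta>\<in>\<Pi>. c \<beta> * \<beta> y)" for y
      using \<Pi>(1) by (induction \<Pi> rule: finite_induct) simp_all
    then show "\<forall>\<beta>\<in>\<Pi>. c \<beta> = 0" using off by (intro indep ext) simp
  qed
  then obtain h0 where h0: "h0 \<in> csa0 D" "\<And>\<beta>. \<beta> \<in> \<Pi> \<Longrightarrow> \<beta> h0 = 1" by blast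
  have ht: "\<exists>n::nat. \<alpha> h0 = of_nat n \<and> (\<alpha> \<noteq> 0 \<longrightarrow> n > 0)" if \<alpha>: "\<alpha> \<in> nat_comb \<Pi>" for \<alpha>
  proof -
    obtain c :: "_ \<Rightarrow> nat" where c: "\<alpha> = (\<lambda>x. \<Sum>\<beta>\<in>\<Pi>. of_nat (c \<beta>) * \<beta> x)" using \<alpha> unfolding nat_comb_def by blast
    have "(\<Sum>\<beta>\<in>\<Pi>. of_nat (c \<beta>) * \<beta> h0) = (\<Sum>\<beta>\<in>\<Pi>. of_nat (c \<beta>) * 1 :: complex)"
      by (intro sum.cong refl arg_cong2[where f = "(*)"] h0(2))
    then have 1: "\<alpha> h0 = of_nat (sum c \<Pi>)" unfolding c by simp
    have "sum c \<Pi> > 0" if "\<alpha> \<noteq> 0"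
    proof (rule ccontr)
      assume "\<not> sum c \<Pi> > 0"
      then have "\<forall>\<beta>\<in>\<Pi>. c \<beta> = 0" using \<Pi>(1) by simp
      then have "\<alpha> = 0" unfolding c by (auto simp: fun_eq_iff)
      with that show False by simp
    qed
    with 1 show ?thesis by blast
  qed
  define n where "n \<alpha> = Re (\<alpha> h0)" for \<alpha>
  have root0: "\<alpha> h0 = of_real (n \<alpha>) \<and> (\<alpha> \<in> pos D \<longrightarrow> n \<alpha> > 0) \<and> (\<alpha> \<noteq> 0 \<longrightarrow> \<alpha> \<notin> pos D \<longrightarrow> n \<alpha> < 0)"
    if \<alpha>: "\<alpha> \<in> roots_en D" for \<alpha>
  proof (cases "\<alpha> = 0")
    case True
    then show ?thesis using pos by (simp add: n_def)
  next
    case False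
    show ?thesis
    proof (cases "\<alpha> \<in> nat_comb \<Pi>")
      case True
      then have "\<alpha> \<in> pos D" using False \<alpha> pos by blast
      moreover obtain m :: nat where "\<alpha> h0 = of_nat m" "m > 0" using ht[OF True] False by blast
      ultimately show ?thesis by (simp add: n_def)
    next
      case neg: False
      then have "- \<alpha> \<in> nat_comb \<Pi>" using cases \<alpha> False by blast
      then obtain m :: nat where "(- \<alpha>) h0 = of_nat m" "m > 0" using ht False by force
      then have "\<alpha> h0 = - of_nat m" "m > 0" by (simp_all add: minus_equation_iff)
      moreover have "\<alpha> \<notin> pos D" using neg pos by blast
      ultimately show ?thesis using False by (simp add: n_def)
    qed
  qed
  have h0G: "h0 \<in> g.G" using h0(1) csa0_subset by blast
  obtain B where B: "finite B" "g.G \<subseteq> g.span B" using datumD(2) unfolding fin_dim_def by blast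
  have "(\<lambda>\<alpha>. \<alpha> h0) ` roots_en D \<subseteq> {c. \<exists>v\<in>g.G. v \<noteq> 0 \<and> g.br h0 v = lscale (fin_alg D) c v}"
    using roots(3) h0(1) by blast
  then have "finite ((\<lambda>\<alpha>. \<alpha> h0) ` roots_en D)"
    using g.finite_eigenvalues[OF g.subspace_G g.ad_endo[OF h0G] B] finite_subset by blast
  then have "finite ((\<lambda>\<alpha>. \<bar>n \<alpha>\<bar>) ` roots_en D)"
    unfolding n_def by (rule finite_surj[where f = "\<lambda>c. \<bar>Re c\<bar>"]) auto
  then obtain K where K: "\<And>\<alpha>. \<alpha> \<in> roots_en D \<Longrightarrow> \<bar>n \<alpha>\<bar> \<le> K" by (metis bdd_above_def bdd_above_finite imageI)
  define m where "m = \<bar>K\<bar> + 1"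
  have m: "m > 0" "\<And>\<alpha>. \<alpha> \<in> roots_en D \<Longrightarrow> \<bar>n \<alpha>\<bar> < m" using K unfolding m_def by fastforce+
  let ?h = "lscale (fin_alg D) (of_real (1 / m)) h0"
  show ?thesis
  proof (rule that[of ?h "\<lambda>\<alpha>. n \<alpha> / m"])
    show "?h \<in> csa0 D" by (rule g.subspace_scale[OF csa0(2) h0(1)])
    show "\<alpha> ?h = of_real (n \<alpha> / m)" if \<alpha>: "\<alpha> \<in> roots_en D" for \<alpha>
    proof -
      have "\<alpha> ?h = of_real (1 / m) * \<alpha> h0" using roots(1)[OF \<alpha>] h0(1) unfolding linear_form_on_def by blast
      then show ?thesis using root0[OF \<alpha>] by simp
    qed
    show "\<bar>n \<alpha> / m\<bar> < 1" if "\<alpha> \<in> roots_en D" for \<alpha> using m(2)[OF that] m(1) by (simp add: abs_divide)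
    show "\<alpha> \<in> roots_en D \<and> n \<alpha> / m > 0" if "\<alpha> \<in> pos D" for \<alpha>
      using root0[of \<alpha>] that pos m(1) by auto
    show "n \<alpha> / m < 0" if "\<alpha> \<in> roots_en D" "\<alpha> \<noteq> 0" "\<alpha> \<notin> pos D" for \<alpha>
      using root0[of \<alpha>] that m(1) by (simp add: divide_neg_pos)
  qed
qed

definition positive_part :: "('n, 'g) toroidal set" where
  "positive_part = \<Union>{root_space D \<alpha> k | \<alpha> k. \<alpha> \<in> roots_en D \<and> (0 < k None \<or> k None = 0 \<and> \<alpha> \<in> pos D)}"

definition middle_part :: "('n, 'g) toroidal set" where
  "middle_part = \<Union>{root_space D 0 k | k. k None = 0}"

definition negative_part :: "('n, 'g) toroidal set" where
  "negative_part = \<Union>{root_space D \<alpha> k | \<alpha> k. \<alpha> \<in> roots_en D \<and> (k None < 0 \<or> k None = 0 \<and> \<alpha> \<noteq> 0 \<and> \<alpha> \<notin> pos D)}"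

lemma zero_root: "0 \<in> roots_en D"
  by (simp add: roots_en_def)

lemma root_vector_cases:
  assumes X: "X \<in> root_space D \<alpha> k" and \<alpha>: "\<alpha> \<in> roots_en D"
  shows "X \<in> positive_part \<union> middle_part \<union> negative_part"
proof (cases "0 < k None \<or> k None = 0 \<and> \<alpha> \<in> pos D")
  case True
  then have "X \<in> positive_part" unfolding positive_part_def using X \<alpha> by blast
  then show ?thesis by blast
next
  case not_pos: False
  show ?thesis
  proof (cases "k None = 0 \<and> \<alpha> = 0")
    case True
    then have "X \<in> middle_part" unfolding middle_part_def using X by blast
    then show ?thesis by blast
  next
    case False
    with not_pos have "k None < 0 \<or> k None = 0 \<and> \<alpha> \<noteq> 0 \<and> \<alpha> \<notin> pos D" by auto
    then have "X \<in> negative_part" unfolding negative_part_def using X \<alpha> by blast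
    then show ?thesis by blast
  qed
qed

text \<open>Every graded part is stable under the Cartan subalgebra, so it is spanned by weight vectors.\<close>

lemma tau_spanned_by_root_vectors: "lcarrier T \<subseteq> t.span (positive_part \<union> middle_part \<union> negative_part)"
proof (rule tau_spanned[of "\<lambda>k. {x\<in>graded_part D k. \<forall>h\<in>csa0 D. \<exists>c. g.br h x = lscale (fin_alg D) c x}"])
  show "graded_part D k \<subseteq> g.span {x\<in>graded_part D k. \<forall>h\<in>csa0 D. \<exists>c. g.br h x = lscale (fin_alg D) c x}" for k
  proof (rule g.toral_eigenvectors_span[OF csa0(2) csa0_subset csa0(3,4) datumD(2) subspace_gp gp_subset])
    show "g.br h x \<in> graded_part D k" if "h \<in> csa0 D" "x \<in> graded_part D k" for h x
      using gp_bracket[of h 0 x k] csa0(1) that by auto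
  qed
next
  fix k v assume v: "v \<in> {x\<in>graded_part D k. \<forall>h\<in>csa0 D. \<exists>c. g.br h x = lscale (fin_alg D) c x}"
  then have vG: "v \<in> g.G" "v \<in> graded_part D k" using gp_subset by auto
  show "(single k v, 0, 0) \<in> positive_part \<union> middle_part \<union> negative_part"
  proof (cases "v = 0")
    case True
    have "(0 :: ('n, 'g) toroidal) \<in> root_space D 0 0"
      using t.subspace_0[OF subspace_tau] unfolding root_space_def zero_prod_def
      by (auto simp: g_elt_def d_elt_def tau_bracket tau_scale loop_operations_0 der_K_0 loop_scale_0
          der_loop_zero_exponent der_cocycle_zero_exponent zero_prod_def)
    then show ?thesis using root_vector_cases[OF _ zero_root] True by (simp add: zero_prod_def)
  next
    case False
    from v obtain c where c: "\<And>h. h \<in> csa0 D \<Longrightarrow> g.br h v = lscale (fin_alg D) (c h) v" by (auto; metis)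
    define \<alpha> where "\<alpha> h = (if h \<in> csa0 D then c h else 0)" for h
    have eq: "c1 = c2" if "lscale (fin_alg D) c1 v = lscale (fin_alg D) c2 v" for c1 c2
      using that False by (simp add: g.scale_right_imp_eq)
    have "linear_form_on (lscale (fin_alg D)) (csa0 D) \<alpha>"
      unfolding linear_form_on_def
    proof (intro conjI ballI allI)
      fix x y d assume x: "x \<in> csa0 D"
      then have xG: "x \<in> g.G" using csa0_subset by blast
      have "lscale (fin_alg D) d x \<in> csa0 D" using g.subspace_scale[OF csa0(2) x] .
      moreover from this have "c (lscale (fin_alg D) d x) = d * c x"
        by (intro eq) (simp flip: c add: x g.br_scale xG vG flip: g.scale_scale)
      ultimately show "\<alpha> (lscale (fin_alg D) d x) = d * \<alpha> x" using x by (simp add: \<alpha>_def)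
      assume y: "y \<in> csa0 D"
      then have yG: "y \<in> g.G" using csa0_subset by blast
      have "x + y \<in> csa0 D" using g.subspace_add[OF csa0(2) x y] .
      moreover from this have "c (x + y) = c x + c y"
        by (intro eq) (simp flip: c add: x y g.br_add xG yG vG g.scale_left_distrib)
      ultimately show "\<alpha> (x + y) = \<alpha> x + \<alpha> y" using x y by (simp add: \<alpha>_def)
    qed
    then have "\<alpha> \<in> weights (fin_alg D) (csa0 D)"
      unfolding weights_def using False vG(1) c by (auto simp: \<alpha>_def)
    then have \<alpha>: "\<alpha> \<in> roots_en D" unfolding datumD(11) .
    have "(single k v, 0, 0) \<in> root_space D \<alpha> k"
      unfolding root_space_def
    proof (intro CollectI conjI ballI allI)
      show "(single k v, 0, 0) \<in> lcarrier T" by (rule tau_mem(1)[OF vG(2)])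
      show "lbracket T (g_elt h) (single k v, 0, 0) = lscale T (\<alpha> h) (single k v, 0, 0)" if h: "h \<in> csa0 D" for h
      proof -
        have hG: "h \<in> g.G" using h csa0_subset by blast
        show ?thesis unfolding g_elt_eq[of h None] torus_bracket_loop[OF hG vG(1)] tau_scale
          using c[OF h] h by (auto intro!: poly_mapping_eqI simp: \<alpha>_def lookup_loop_scale lookup_single when_def)
      qed
      show "lbracket T (d_elt i) (single k v, 0, 0) = lscale T (of_int (k i)) (single k v, 0, 0)" for i
        unfolding d_elt_eq torus_bracket_loop[OF g.G_closed(1) vG(1)] tau_scale
        by (auto intro!: poly_mapping_eqI simp: vG g.br_zero lookup_loop_scale lookup_single when_def)
    qed
    then show ?thesis by (rule root_vector_cases[OF _ \<alpha>])
  qed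
next
  fix r p assume r: "r \<in> Gam D"
  have "(0, K_symbol r p, 0) \<in> root_space D 0 r"
    unfolding root_space_def
    by (simp add: tau_mem(2)[OF r] d_elt_eq g_elt_eq[of _ None] torus_bracket_K tau_scale loop_scale_0 zero_prod_def)
  then show "(0, K_symbol r p, 0) \<in> positive_part \<union> middle_part \<union> negative_part"
    by (rule root_vector_cases[OF _ zero_root])
next
  fix r a assume r: "r \<in> Gam D"
  have "(0, 0, single (r, a) 1) \<in> root_space D 0 r"
    unfolding root_space_def
    by (simp add: tau_mem(3)[OF r] d_elt_eq g_elt_eq[of _ None] torus_bracket_der tau_scale loop_scale_0 zero_prod_def)
  then show "(0, 0, single (r, a) 1) \<in> positive_part \<union> middle_part \<union> negative_part"
    by (rule root_vector_cases[OF _ zero_root])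
qed

lemma torus_elt_in_middle: "h \<in> csa0 D \<Longrightarrow> torus_elt h i c \<in> middle_part"
proof -
  assume h: "h \<in> csa0 D"
  then have hG: "h \<in> g.G" "h \<in> graded_part D 0" using csa0 csa0_subset by blast+
  have "torus_elt h i c \<in> root_space D 0 0"
    unfolding root_space_def
  proof (intro CollectI conjI ballI allI)
    show "torus_elt h i c \<in> lcarrier T" by (rule torus_mem[OF hG(2)])
    show "lbracket T (g_elt k) (torus_elt h i c) = lscale T (0 k) (torus_elt h i c)" if k: "k \<in> csa0 D" for k
    proof -
      have "k \<in> g.G" using k csa0_subset by blast
      then show ?thesis unfolding g_elt_def torus_elt_def tau_bracket
        using csa0(3)[OF k h] hG by (simp add: loop_bracket_single loop_operations_0 der_K_0 loop_cocycle_zero_exponent der_loop_zero_exponent zero_prod_def)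
    qed
    show "lbracket T (d_elt j) (torus_elt h i c) = lscale T (of_int (0 j)) (torus_elt h i c)" for j
      unfolding d_elt_def torus_elt_def tau_bracket
      by (simp add: loop_operations_0 der_K_0 der_loop_zero_exponent der_cocycle_zero_exponent der_der_single zero_prod_def)
  qed
  moreover have "(0 :: 'n exponent) None = 0" by simp
  ultimately show ?thesis unfolding middle_part_def by blast
qed

lemma root_grading:
  obtains h where "h \<in> csa0 D" "graded_by T (torus_elt h None 1) positive_part middle_part negative_part"
    "\<And>\<alpha>. \<alpha> \<in> pos D \<Longrightarrow> Re (\<alpha> h) > 0"
proof -
  obtain h q where h: "h \<in> csa0 D" "\<And>\<alpha>. \<alpha> \<in> roots_en D \<Longrightarrow> \<alpha> h = of_real (q \<alpha>)" "\<And>\<alpha>. \<alpha> \<in> roots_en D \<Longrightarrow> \<bar>q \<alpha>\<bar> < 1"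
    and pos: "\<And>\<alpha>. \<alpha> \<in> pos D \<Longrightarrow> \<alpha> \<in> roots_en D \<and> q \<alpha> > 0"
    and neg: "\<And>\<alpha>. \<alpha> \<in> roots_en D \<Longrightarrow> \<alpha> \<noteq> 0 \<Longrightarrow> \<alpha> \<notin> pos D \<Longrightarrow> q \<alpha> < 0"
    using small_dominant_element by metis
  have q0: "q 0 = 0" using h(2)[OF zero_root] by simp
  have deg: "lbracket T (torus_elt h None 1) X = lscale T (of_real (of_int (k None) + q \<alpha>)) X"
    if X: "X \<in> root_space D \<alpha> k" and \<alpha>: "\<alpha> \<in> roots_en D" for X \<alpha> k
  proof -
    have "lbracket T (torus_elt h None 1) X = lbracket T (g_elt h) X + lbracket T (d_elt None) X"
      unfolding torus_bracket_split[of h None 1] g_elt_eq[of h None] d_elt_eq ..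
    also have "\<dots> = lscale T (of_real (q \<alpha>)) X + lscale T (of_int (k None)) X"
      using X h(1) unfolding root_space_def h(2)[OF \<alpha>, symmetric] by simp
    also have "\<dots> = lscale T (of_real (q \<alpha>) + of_int (k None)) X" by (rule t.scale_left_distrib[symmetric])
    finally show ?thesis by (simp add: add.commute)
  qed
  have "graded_by T (torus_elt h None 1) positive_part middle_part negative_part"
    unfolding graded_by_def
  proof (intro conjI ballI)
    show "torus_elt h None 1 \<in> lcarrier T" using h(1) csa0(1) by (intro torus_mem) blast
    show "positive_part \<union> middle_part \<union> negative_part \<subseteq> lcarrier T"
      unfolding positive_part_def middle_part_def negative_part_def root_space_def by blast
    fix X
    {
      assume "X \<in> positive_part"
      then obtain \<alpha> k where X: "X \<in> root_space D \<alpha> k" "\<alpha> \<in> roots_en D" "0 < k None \<or> k None = 0 \<and> \<alpha> \<in> pos D"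
        unfolding positive_part_def by blast
      have "of_int (k None) + q \<alpha> > 0"
      proof (cases "k None = 0")
        case False
        then have "real_of_int (k None) \<ge> 1" using X(3) by linarith
        then show ?thesis using h(3)[OF X(2)] by linarith
      qed (use X(3) pos in auto)
      then show "\<exists>q>0. lbracket T (torus_elt h None 1) X = lscale T (of_real q) X" using deg[OF X(1,2)] by blast
    next
      assume "X \<in> middle_part"
      then obtain k where X: "X \<in> root_space D 0 k" "k None = 0" unfolding middle_part_def by blast
      show "lbracket T (torus_elt h None 1) X = lscale T (of_real 0) X" using deg[OF X(1) zero_root] X(2) q0 by simp
    next
      assume "X \<in> negative_part"
      then obtain \<alpha> k where X: "X \<in> root_space D \<alpha> k" "\<alpha> \<in> roots_en D" "k None < 0 \<or> k None = 0 \<and> \<alpha> \<noteq> 0 \<and> \<alpha> \<notin> pos D"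
        unfolding negative_part_def by blast
      have "of_int (k None) + q \<alpha> < 0"
      proof (cases "k None = 0")
        case False
        then have "real_of_int (k None) \<le> -1" using X(3) by linarith
        then show ?thesis using h(3)[OF X(2)] by linarith
      qed (use X neg in auto)
      then show "\<exists>q<0. lbracket T (torus_elt h None 1) X = lscale T (of_real q) X" using deg[OF X(1,2)] by blast
    }
  qed (use vector_space_tau subspace_tau tau_bracket_closed tau_spanned_by_root_vectors in auto)
  moreover have "Re (\<alpha> h) > 0" if \<alpha>: "\<alpha> \<in> pos D" for \<alpha> using h(2)[of \<alpha>] pos[OF \<alpha>] by simp
  ultimately show ?thesis using that h(1) by blast
qed

end

section \<open>Highest weight vectors\<close>

text \<open>In the application \<open>z\<close> is \<open>t\<^sup>r K\<^sub>0\<close> and \<open>y\<close> is \<open>t\<^sup>-\<^sup>r d\<^sub>a\<close>, whose commutator is a multiple of the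
  scalar \<open>C\<^sub>0\<close>.\<close>

locale weyl_pair = complex_space scale
  for scale :: "complex \<Rightarrow> 'v::ab_group_add \<Rightarrow> 'v" (infixr "*s" 75) +
  fixes y z :: "'v \<Rightarrow> 'v" and c :: complex
  assumes y: "linear_endo_on (*s) UNIV y" and z: "linear_endo_on (*s) UNIV z"
    and commutator: "y (z v) - z (y v) = c *s v" and c: "c \<noteq> 0"
    and nilpotent: "\<exists>p. (z ^^ p) v = 0"
begin

text \<open>Let \<open>p\<close> be the least number with \<open>z\<^sup>p x = 0\<close> and apply \<open>y z\<^sup>p = z\<^sup>p y + p c z\<^sup>p\<^sup>-\<^sup>1\<close> to \<open>x\<close>: the first two terms vanish,
  the last one does not.\<close>

lemma kernel_image_trivial:
  assumes "z (y x) = 0" shows "x = 0"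
proof (rule ccontr)
  assume x: "x \<noteq> 0"
  note z0 = endo_0[OF subspace_UNIV z] and ys = endo_scale[OF subspace_UNIV y]
    and zs = endo_scale[OF subspace_UNIV z] and za = endo_add[OF subspace_UNIV z]
  have comm: "y (z v) = z (y v) + c *s v" for v using commutator[of v] by (simp add: algebra_simps)
  have power: "y ((z ^^ p) v) = (z ^^ p) (y v) + (of_nat p * c) *s (z ^^ (p - 1)) v" for p v
  proof (induction p)
    case (Suc p)
    have "y ((z ^^ Suc p) v) = z (y ((z ^^ p) v)) + c *s (z ^^ p) v" using comm by simp
    also have "z (y ((z ^^ p) v)) = (z ^^ Suc p) (y v) + (of_nat p * c) *s (z ^^ p) v"
      unfolding Suc za[OF UNIV_I UNIV_I] zs[OF UNIV_I] by (cases p) simp_all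
    finally show ?case by (simp add: algebra_simps)
  qed simp
  obtain p where p: "(z ^^ p) x = 0" "\<And>q. q < p \<Longrightarrow> (z ^^ q) x \<noteq> 0"
    using nilpotent exists_least_iff[of "\<lambda>p. (z ^^ p) x = 0"] by blast
  have "p \<noteq> 0" using p(1) x by (cases p) auto
  then obtain q where q: "p = Suc q" using not0_implies_Suc by blast
  have "(z ^^ n) 0 = 0" for n by (induction n) (simp_all add: z0)
  then have "(z ^^ p) (y x) = 0" unfolding q funpow_Suc_right using assms by simp
  moreover have "y 0 = 0" by (rule endo_0[OF subspace_UNIV y])
  ultimately have "(of_nat p * c) *s (z ^^ q) x = 0" using power[of p x] p(1) q by simp
  moreover have "(z ^^ q) x \<noteq> 0" using p(2) q by simp
  ultimately show False using c q by (simp del: of_nat_Suc)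
qed

lemma y_injective: "y x = 0 \<Longrightarrow> x = 0"
  using kernel_image_trivial[of x] endo_0[OF subspace_UNIV z] by simp

end

locale toroidal_module = toroidal D
  for D :: "('n::finite, 'g::ab_group_add) toroidal_data" +
  fixes \<psi> :: "('n, 'g) toroidal \<Rightarrow> complex" and s :: "complex \<Rightarrow> 'v::ab_group_add \<Rightarrow> 'v"
    and \<rho> :: "('n, 'g) toroidal \<Rightarrow> 'v \<Rightarrow> 'v" and C\<^sub>0 :: complex
  assumes category: "in_category_B D \<psi> s \<rho>"
    and irr: "irreducible_module T (module_of s \<rho>)"
    and K\<^sub>0: "\<rho> (K_elt None) v = s C\<^sub>0 v" and C\<^sub>0: "C\<^sub>0 \<noteq> 0"
begin

lemma rep: "lie_representation T s \<rho>"
  using category by (simp add: in_category_B_def)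

sublocale V: complex_space s
  using rep by (simp add: lie_representation_def complex_space_def)

lemma \<rho>_endo: "X \<in> lcarrier T \<Longrightarrow> linear_endo_on s UNIV (\<rho> X)"
  using rep by (simp add: lie_representation_def Vector_Spaces.linear_iff linear_endo_on_def)

lemma \<rho>_add: "X \<in> lcarrier T \<Longrightarrow> \<rho> X (u + w) = \<rho> X u + \<rho> X w"
  and \<rho>_scale: "X \<in> lcarrier T \<Longrightarrow> \<rho> X (s c w) = s c (\<rho> X w)"
  using rep unfolding lie_representation_def Vector_Spaces.linear_iff by blast+

lemma \<rho>_0: "X \<in> lcarrier T \<Longrightarrow> \<rho> X 0 = 0"
  using \<rho>_scale[of X 0 0] by simp

lemma \<rho>_sum: "X \<in> lcarrier T \<Longrightarrow> \<rho> X (sum h I) = (\<Sum>i\<in>I. \<rho> X (h i))"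
  by (rule V.endo_sum[OF V.subspace_UNIV \<rho>_endo]) auto

lemma \<rho>_scale_elt: "X \<in> lcarrier T \<Longrightarrow> \<rho> (lscale T c X) v = s c (\<rho> X v)"
  using rep by (simp add: lie_representation_def)

lemma \<rho>_add_elt: "X \<in> lcarrier T \<Longrightarrow> Y \<in> lcarrier T \<Longrightarrow> \<rho> (X + Y) v = \<rho> X v + \<rho> Y v"
  using rep by (simp add: lie_representation_def)

lemma \<rho>_bracket: "X \<in> lcarrier T \<Longrightarrow> Y \<in> lcarrier T \<Longrightarrow> \<rho> X (\<rho> Y v) = \<rho> Y (\<rho> X v) + \<rho> (lbracket T X Y) v"
  using rep by (simp add: lie_representation_def)

lemma \<rho>_zero_elt: "\<rho> 0 v = 0"
  using \<rho>_scale_elt[OF t.subspace_0[OF subspace_tau], of 0 v] by simp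

subsection \<open>Weight spaces\<close>

abbreviation "VW \<equiv> d_weight_space s \<rho>"

definition shift :: "('n option \<Rightarrow> complex) \<Rightarrow> 'n exponent \<Rightarrow> 'n option \<Rightarrow> complex"
  where "shift \<mu> k = (\<lambda>i. \<mu> i + of_int (k i))"

definition homogeneous :: "('n, 'g) toroidal \<Rightarrow> 'n exponent \<Rightarrow> bool"
  where "homogeneous X k \<longleftrightarrow> X \<in> lcarrier T \<and> (\<forall>i. lbracket T (d_elt i) X = lscale T (of_int (k i)) X)"

lemma shift_add: "shift (shift \<mu> k) l = shift \<mu> (k + l)"
  by (simp add: shift_def fun_eq_iff)

lemma shift_0: "shift \<mu> 0 = \<mu>"
  by (simp add: shift_def fun_eq_iff)

lemma d_elt_mem: "d_elt i \<in> lcarrier T"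
  unfolding d_elt_eq by (rule torus_mem) (rule g.subspace_0[OF subspace_gp])

lemma subspace_VW: "V.subspace (VW \<mu>)"
  by (rule V.subspaceI) (auto simp: d_weight_space_def \<rho>_0 \<rho>_add \<rho>_scale d_elt_mem V.scale_right_distrib mult.commute)

lemma fin_VW: obtains B where "finite B" "VW \<mu> \<subseteq> V.span B"
  using category unfolding in_category_B_def fin_dim_def by blast

lemma homogeneous_act: "homogeneous X k \<Longrightarrow> v \<in> VW \<mu> \<Longrightarrow> \<rho> X v \<in> VW (shift \<mu> k)"
  unfolding homogeneous_def d_weight_space_def mem_Collect_eq shift_def
proof (intro allI)
  fix i assume X: "X \<in> lcarrier T \<and> (\<forall>i. lbracket T (d_elt i) X = lscale T (of_int (k i)) X)"
    and v: "\<forall>i. \<rho> (d_elt i) v = s (\<mu> i) v"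
  have "\<rho> (d_elt i) (\<rho> X v) = \<rho> X (s (\<mu> i) v) + \<rho> (lscale T (of_int (k i)) X) v"
    using \<rho>_bracket[OF d_elt_mem, of X i v] X v by simp
  then show "\<rho> (d_elt i) (\<rho> X v) = s (\<mu> i + of_int (k i)) (\<rho> X v)"
    using X by (simp add: \<rho>_scale \<rho>_scale_elt V.scale_left_distrib)
qed

definition K_vec :: "'n exponent \<Rightarrow> 'n option \<Rightarrow> ('n, 'g) toroidal"
  where "K_vec r p = (0, K_symbol r p, 0)"

definition d_vec :: "'n exponent \<Rightarrow> 'n option \<Rightarrow> ('n, 'g) toroidal"
  where "d_vec r a = (0, 0, single (r, a) 1)"

lemma K_vec_mem: "r \<in> Gam D \<Longrightarrow> K_vec r p \<in> lcarrier T" and d_vec_mem: "r \<in> Gam D \<Longrightarrow> d_vec r a \<in> lcarrier T"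
  unfolding K_vec_def d_vec_def by (rule tau_mem; assumption)+

lemma K_vec_homogeneous: "r \<in> Gam D \<Longrightarrow> homogeneous (K_vec r p) r"
  unfolding homogeneous_def using K_vec_mem[of r p]
  by (simp add: K_vec_def d_elt_eq torus_bracket_K tau_scale loop_scale_0)

lemma d_vec_homogeneous: "r \<in> Gam D \<Longrightarrow> homogeneous (d_vec r a) r"
  unfolding homogeneous_def using d_vec_mem[of r a]
  by (simp add: d_vec_def d_elt_eq torus_bracket_der tau_scale loop_scale_0)

lemma bracket_d_K: "lbracket T (d_vec r a) (0, w, 0) = (0, der_K (single (r, a) 1) w, 0)"
  unfolding d_vec_def tau_bracket by (simp add: loop_operations_0 der_K_0)

lemma bracket_with_K: "lbracket T (x, z, d) (0, w, 0) = (0, der_K d w, 0)"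
  unfolding tau_bracket by (simp add: loop_operations_0 der_K_0)

lemma K_commute:
  assumes "(0, z, 0) \<in> lcarrier T" "(0, w, 0) \<in> lcarrier T"
  shows "\<rho> (0, z, 0) (\<rho> (0, w, 0) v) = \<rho> (0, w, 0) (\<rho> (0, z, 0) v)"
proof -
  have "lbracket T (0, z, 0) (0, w, 0) = 0" unfolding bracket_with_K by (simp add: der_K_0 zero_prod_def)
  then show ?thesis using \<rho>_bracket[OF assms] by (simp add: \<rho>_zero_elt)
qed

text \<open>The commutator of \<open>z\<close> with any element again commutes with \<open>z\<close>. So the vectors killed by some power
  of \<open>z\<close> form a submodule, and this is everything as soon as \<open>z\<close> is not injective.\<close>

lemma locally_nilpotent:
  assumes z: "(0, w, 0) \<in> lcarrier T" and v: "v \<noteq> 0" "\<rho> (0, w, 0) v = 0"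
  shows "\<exists>p. (\<rho> (0, w, 0) ^^ p) u = 0"
proof -
  let ?z = "\<rho> (0, w, 0)"
  let ?N = "{u. \<exists>p. (?z ^^ p) u = 0}"
  have lin: "linear_endo_on s UNIV (?z ^^ p)" for p
    by (rule V.funpow_endo[OF V.subspace_UNIV \<rho>_endo[OF z]])
  note zadd = V.endo_add[OF V.subspace_UNIV lin] and zscale = V.endo_scale[OF V.subspace_UNIV lin]
    and z0 = V.endo_0[OF V.subspace_UNIV lin] and zdiff = V.endo_diff[OF V.subspace_UNIV lin]
  have more: "(?z ^^ (p + q)) u = 0" if "(?z ^^ p) u = 0" for p q u
    using that by (simp add: funpow_add add.commute[of p q] z0)
  have act: "(?z ^^ Suc p) (\<rho> X u) = 0" if X: "X \<in> lcarrier T" and "(?z ^^ p) u = 0" for X p u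
    using that(2)
  proof (induction p arbitrary: u)
    case 0
    then show ?case using \<rho>_0 X z by simp
  next
    case (Suc p)
    obtain x1 x2 x3 where X': "X = (x1, x2, x3)" by (metis prod_cases3)
    define Y where "Y = lbracket T X (0, w, 0)"
    have Y: "Y \<in> lcarrier T" "Y = (0, der_K x3 w, 0)"
      using tau_bracket_closed[OF X z] unfolding Y_def X' bracket_with_K by auto
    have comm: "?z (\<rho> Y u) = \<rho> Y (?z u)" for u using K_commute[OF z, of "der_K x3 w"] Y by simp
    have powcomm: "(?z ^^ q) (\<rho> Y u) = \<rho> Y ((?z ^^ q) u)" for q u
      by (induction q) (simp_all add: comm)
    have "?z (\<rho> X u) = \<rho> X (?z u) - \<rho> Y u" using \<rho>_bracket[OF X z, of u] unfolding Y_def by simp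
    then have "(?z ^^ Suc (Suc p)) (\<rho> X u) = (?z ^^ Suc p) (\<rho> X (?z u)) - \<rho> Y ((?z ^^ Suc p) u)"
      unfolding funpow_Suc_right[of "Suc p"] by (simp add: zdiff powcomm del: funpow.simps)
    also have "(?z ^^ Suc p) (\<rho> X (?z u)) = 0"
      by (rule Suc.IH) (use Suc.prems in \<open>simp add: funpow_swap1\<close>)
    finally show ?case using Suc.prems \<rho>_0[OF Y(1)] by (simp del: funpow.simps)
  qed
  have "lie_submodule T (module_of s \<rho>) ?N"
    unfolding lie_submodule_def module_of_def lie_module.simps
  proof (intro conjI ballI allI)
    show "0 \<in> ?N" using z0[of 0] by blast
    show "u + u' \<in> ?N" if uu: "u \<in> ?N" "u' \<in> ?N" for u u'
    proof -
      obtain p q where "(?z ^^ p) u = 0" "(?z ^^ q) u' = 0" using uu by blast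
      then have "(?z ^^ (p + q)) (u + u') = 0"
        using more[of p u q] more[of q u' p] by (simp add: zadd add.commute)
      then show ?thesis by blast
    qed
    show "s k u \<in> ?N" if "u \<in> ?N" for k u using that zscale by auto
    show "\<rho> X u \<in> ?N" if "X \<in> lcarrier T" "u \<in> ?N" for X u using that act by blast
  qed simp
  then have "?N = {0} \<or> ?N = UNIV" using irr unfolding irreducible_module_def module_of_def by simp
  moreover have "(?z ^^ 1) v = 0" using v by simp
  then have "v \<in> ?N" by blast
  ultimately have "?N = UNIV" using v(1) by blast
  then show ?thesis by blast
qed

subsection \<open>Exponents along one coordinate axis\<close>

definition axis :: "'n \<Rightarrow> int \<Rightarrow> 'n exponent"
  where "axis a j = (\<lambda>i. if i = Some a then int (ord D (Some a)) * j else 0)"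

lemma axis_Gam: "axis a j \<in> Gam D" "- axis a j \<in> Gam D"
  by (auto simp: axis_def Gam_def)

lemma axis_add: "axis a i + axis a j = axis a (i + j)" "- axis a j = axis a (- j)" "axis a j None = 0"
  by (auto simp: axis_def fun_eq_iff algebra_simps)

lemma axis_0: "axis a 0 = 0" and shift_axis_0: "shift \<mu> (axis a 0) = \<mu>"
  by (auto simp: axis_def shift_def fun_eq_iff)

text \<open>The operators \<open>t\<^sup>r K\<^sub>0\<close> and \<open>t\<^sup>-\<^sup>r d\<^sub>a\<close> for the \<open>j\<close>-th multiple \<open>r\<close> of the period on the \<open>a\<close>-axis. Their
  commutator is a multiple of \<open>K\<^sub>0\<close>.\<close>

definition z_op :: "'n \<Rightarrow> int \<Rightarrow> 'v \<Rightarrow> 'v" where "z_op a j = \<rho> (K_vec (axis a j) None)"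
definition y_op :: "'n \<Rightarrow> int \<Rightarrow> 'v \<Rightarrow> 'v" where "y_op a j = \<rho> (d_vec (axis a (- j)) (Some a))"

lemma z_op_weight: "v \<in> VW \<mu> \<Longrightarrow> z_op a j v \<in> VW (shift \<mu> (axis a j))"
  unfolding z_op_def by (intro homogeneous_act K_vec_homogeneous axis_Gam)

lemma y_op_weight: "v \<in> VW \<mu> \<Longrightarrow> y_op a j v \<in> VW (shift \<mu> (axis a (- j)))"
  unfolding y_op_def by (intro homogeneous_act d_vec_homogeneous axis_Gam)

lemma funpow_weight:
  assumes "\<And>\<mu> v. v \<in> VW \<mu> \<Longrightarrow> f v \<in> VW (shift \<mu> (axis a j))" "v \<in> VW \<mu>"
  shows "(f ^^ n) v \<in> VW (shift \<mu> (axis a (int n * j)))"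
proof (induction n)
  case 0
  then show ?case using assms(2) by (simp add: shift_axis_0)
next
  case (Suc n)
  have "(f ^^ Suc n) v \<in> VW (shift (shift \<mu> (axis a (int n * j))) (axis a j))" using assms(1)[OF Suc] by simp
  moreover have "int n * j + j = int (Suc n) * j" by (simp add: algebra_simps)
  ultimately show ?case by (simp only: shift_add axis_add)
qed

lemma z_endo: "linear_endo_on s UNIV (z_op a j)" and y_endo: "linear_endo_on s UNIV (y_op a j)"
  unfolding z_op_def y_op_def by (intro \<rho>_endo K_vec_mem d_vec_mem axis_Gam)+

lemma z_commute: "z_op a i (z_op a' j v) = z_op a' j (z_op a i v)"
  unfolding z_op_def K_vec_def by (rule K_commute) (use K_vec_mem[OF axis_Gam(1), unfolded K_vec_def] in auto)

lemma funpow_commute: "(\<And>v. f (g v) = g (f v)) \<Longrightarrow> f ((g ^^ n) v) = (g ^^ n) (f v)"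
  by (induction n) simp_all

lemma y_z_commutator: "y_op a j (z_op a j v) - z_op a j (y_op a j v) = s (of_int (int (ord D (Some a)) * j) * C\<^sub>0) v"
proof -
  have "lbracket T (d_vec (axis a (- j)) (Some a)) (K_vec (axis a j) None) =
      lscale T (of_int (int (ord D (Some a)) * j)) (K_elt None)"
    unfolding K_vec_def bracket_d_K der_K_symbol K_elt_def tau_scale
    by (simp add: loop_scale_0 axis_add axis_0) (simp add: axis_def)
  moreover have "K_elt None \<in> lcarrier T" using K_vec_mem[OF Gam_closed(1), of None] by (simp add: K_vec_def K_elt_def)
  ultimately show ?thesis
    using \<rho>_bracket[OF d_vec_mem[OF axis_Gam(1)[of a "- j"], of "Some a"] K_vec_mem[OF axis_Gam(1)[of a j], of None], of v]
    by (simp add: z_op_def y_op_def \<rho>_scale_elt K\<^sub>0)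
qed

lemma z_locally_nilpotent: "v \<noteq> 0 \<Longrightarrow> z_op a j v = 0 \<Longrightarrow> \<exists>p. (z_op a j ^^ p) u = 0"
  unfolding z_op_def K_vec_def
  by (rule locally_nilpotent) (use K_vec_mem[OF axis_Gam(1), unfolded K_vec_def] in auto)

lemma least_power:
  assumes "\<exists>p. (f ^^ p) u = 0" "u \<noteq> (0::'v)"
  obtains q where "(f ^^ q) u \<noteq> 0" "f ((f ^^ q) u) = 0"
proof -
  obtain p where p: "(f ^^ p) u = 0" "\<And>q. q < p \<Longrightarrow> (f ^^ q) u \<noteq> 0"
    using assms(1) exists_least_iff[of "\<lambda>p. (f ^^ p) u = 0"] by blast
  have "p \<noteq> 0" using p(1) assms(2) by (cases p) auto
  then obtain q where "p = Suc q" using not0_implies_Suc by blast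
  with p that[of q] show ?thesis by simp
qed

context
  fixes a :: 'n and j :: int and v :: 'v
  assumes j: "j \<noteq> 0" and v: "v \<noteq> 0" "z_op a j v = 0"
begin

interpretation weyl_pair s "y_op a j" "z_op a j" "of_int (int (ord D (Some a)) * j) * C\<^sub>0"
proof
  show "linear_endo_on s UNIV (y_op a j)" "linear_endo_on s UNIV (z_op a j)" by (rule y_endo z_endo)+
  show "y_op a j (z_op a j u) - z_op a j (y_op a j u) = s (of_int (int (ord D (Some a)) * j) * C\<^sub>0) u" for u
    by (rule y_z_commutator)
  show "of_int (int (ord D (Some a)) * j) * C\<^sub>0 \<noteq> 0" using j C\<^sub>0 datumD(5)[of "Some a"] by simp
  show "\<exists>p. (z_op a j ^^ p) u = 0" for u using z_locally_nilpotent[OF v] .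
qed

lemma y_inj: "y_op a j x = 0 \<Longrightarrow> x = 0" by (rule y_injective)

lemma y_pow_inj: "(y_op a j ^^ n) x = 0 \<Longrightarrow> x = 0"
  by (induction n) (auto dest: y_inj)

text \<open>Otherwise the composition of \<open>f\<close> with a power of \<open>y\<close> would be an injective, hence surjective, operator
  on a finite-dimensional weight space that meets the kernel of \<open>z\<close>; but the images of \<open>y\<close> and the kernel
  of \<open>z\<close> have trivial intersection.\<close>

lemma raising_operator_not_injective:
  assumes f: "linear_endo_on s UNIV f" "\<And>\<mu> v. v \<in> VW \<mu> \<Longrightarrow> f v \<in> VW (shift \<mu> (axis a (int (Suc n) * j)))"
    and u: "u \<in> VW \<mu>" "u \<noteq> 0"
  shows "\<exists>w. w \<noteq> 0 \<and> f w = 0"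
proof (rule ccontr)
  assume "\<nexists>w. w \<noteq> 0 \<and> f w = 0"
  then have finj: "f w = 0 \<Longrightarrow> w = 0" for w by blast
  obtain q where q: "(z_op a j ^^ q) u \<noteq> 0" "z_op a j ((z_op a j ^^ q) u) = 0"
    using least_power[OF nilpotent u(2)] by blast
  define \<nu> where "\<nu> = shift \<mu> (axis a (int q * j))"
  let ?v = "(z_op a j ^^ q) u"
  have v: "?v \<in> VW \<nu>" unfolding \<nu>_def by (rule funpow_weight[OF z_op_weight u(1)])
  let ?G = "\<lambda>w. (y_op a j ^^ Suc n) (f w)"
  have ylin: "linear_endo_on s UNIV (y_op a j ^^ Suc n)"
    by (rule V.funpow_endo[OF V.subspace_UNIV y_endo])
  have Gendo: "linear_endo_on s (VW \<nu>) ?G"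
    unfolding linear_endo_on_def
  proof (intro conjI ballI allI)
    show "?G ` VW \<nu> \<subseteq> VW \<nu>"
    proof clarify
      fix w assume "w \<in> VW \<nu>"
      then have "?G w \<in> VW (shift (shift \<nu> (axis a (int (Suc n) * j))) (axis a (int (Suc n) * - j)))"
        by (intro funpow_weight y_op_weight f(2))
      then show "?G w \<in> VW \<nu>" by (simp add: shift_add axis_add shift_axis_0)
    qed
    show "?G (w + w') = ?G w + ?G w'" for w w'
      by (simp only: V.endo_add[OF V.subspace_UNIV f(1)] V.endo_add[OF V.subspace_UNIV ylin] UNIV_I)
    show "?G (s k w) = s k (?G w)" for k w
      by (simp only: V.endo_scale[OF V.subspace_UNIV f(1)] V.endo_scale[OF V.subspace_UNIV ylin] UNIV_I)
  qed
  obtain B where B: "finite B" "VW \<nu> \<subseteq> V.span B" by (rule fin_VW)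
  have "?G ` VW \<nu> = VW \<nu>"
    by (rule V.injective_endo_surjective[OF subspace_VW Gendo B]) (use finj y_pow_inj in blast)
  then obtain w where "?v = ?G w" using v by blast
  then have "z_op a j (y_op a j ((y_op a j ^^ n) (f w))) = 0" using q(2) by simp
  then have "(y_op a j ^^ n) (f w) = 0" by (rule kernel_image_trivial)
  then have "?G w = 0" using V.endo_0[OF V.subspace_UNIV y_endo] by simp
  with q(1) \<open>?v = ?G w\<close> show False by simp
qed

text \<open>If \<open>t\<^sup>-\<^sup>r K\<^sub>0\<close> were not injective, then it would be locally nilpotent too, and its partner \<open>t\<^sup>r d\<^sub>a\<close> would
  be an injective raising operator.\<close>

lemma opposite_injective:
  assumes u: "u \<in> VW \<mu>" "u \<noteq> 0" and "z_op a (- j) x = 0"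
  shows "x = 0"
proof (rule ccontr)
  assume x: "x \<noteq> 0"
  interpret opp: weyl_pair s "y_op a (- j)" "z_op a (- j)" "of_int (int (ord D (Some a)) * (- j)) * C\<^sub>0"
  proof
    show "linear_endo_on s UNIV (y_op a (- j))" "linear_endo_on s UNIV (z_op a (- j))" by (rule y_endo z_endo)+
    show "y_op a (- j) (z_op a (- j) u) - z_op a (- j) (y_op a (- j) u) = s (of_int (int (ord D (Some a)) * (- j)) * C\<^sub>0) u" for u
      by (rule y_z_commutator)
    show "of_int (int (ord D (Some a)) * (- j)) * C\<^sub>0 \<noteq> 0" using j C\<^sub>0 datumD(5)[of "Some a"] by simp
    show "\<exists>p. (z_op a (- j) ^^ p) u = 0" for u using z_locally_nilpotent[OF x assms(3)] .
  qed
  have "\<exists>w. w \<noteq> 0 \<and> y_op a (- j) w = 0"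
    by (rule raising_operator_not_injective[OF y_endo _ u, where n = 0]) (use y_op_weight[of _ _ a "- j"] in simp)
  with opp.y_injective show False by blast
qed

lemma multiples_locally_nilpotent:
  assumes u: "u \<in> VW \<mu>" "u \<noteq> 0" and "n > 0"
  shows "\<exists>p. (z_op a (int n * j) ^^ p) w = 0"
proof -
  obtain m where m: "n = Suc m" using \<open>n > 0\<close> gr0_implies_Suc by blast
  have "\<exists>x. x \<noteq> 0 \<and> z_op a (int (Suc m) * j) x = 0"
    by (rule raising_operator_not_injective[OF z_endo z_op_weight u])
  then obtain x where "x \<noteq> 0" "z_op a (int n * j) x = 0" unfolding m by blast
  then show ?thesis by (rule z_locally_nilpotent)
qed

text \<open>The operators \<open>t\<^sup>i\<^sup>r K\<^sub>0\<close> with \<open>i > 0\<close> are locally nilpotent and commute, so finitely many of them have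
  a common kernel vector.\<close>

lemma vacuum_vector:
  assumes u: "u \<in> VW \<mu>" "u \<noteq> 0"
  shows "\<exists>w N. w \<noteq> 0 \<and> w \<in> VW (shift \<mu> (axis a (int N * j))) \<and> (\<forall>i\<in>{1..n}. z_op a (int i * j) w = 0)"
proof (induction n)
  case 0
  then show ?case using u by (intro exI[of _ u] exI[of _ 0]) (simp add: shift_axis_0)
next
  case (Suc n)
  then obtain w N where w: "w \<noteq> 0" "w \<in> VW (shift \<mu> (axis a (int N * j)))" "\<And>i. i \<in> {1..n} \<Longrightarrow> z_op a (int i * j) w = 0"
    by blast
  let ?z = "z_op a (int (Suc n) * j)"
  have nil: "\<exists>p. (?z ^^ p) w = 0" by (rule multiples_locally_nilpotent[OF u]) simp
  obtain q where q: "(?z ^^ q) w \<noteq> 0" "?z ((?z ^^ q) w) = 0"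
    using least_power[OF nil w(1)] by blast
  have "(?z ^^ q) w \<in> VW (shift (shift \<mu> (axis a (int N * j))) (axis a (int q * (int (Suc n) * j))))"
    by (rule funpow_weight[OF z_op_weight w(2)])
  moreover have "int N * j + int q * (int (Suc n) * j) = int (N + q * Suc n) * j" by (simp add: algebra_simps)
  ultimately have "(?z ^^ q) w \<in> VW (shift \<mu> (axis a (int (N + q * Suc n) * j)))"
    by (simp only: shift_add axis_add)
  moreover have "z_op a (int i * j) ((?z ^^ q) w) = 0" if i: "i \<in> {1..Suc n}" for i
  proof (cases "i = Suc n")
    case True
    then show ?thesis using q(2) by simp
  next
    case False
    have "z_op a (int i * j) ((?z ^^ q) w) = (?z ^^ q) (z_op a (int i * j) w)"
      by (rule funpow_commute) (rule z_commute)
    also have "z_op a (int i * j) w = 0" using False i by (intro w(3)) auto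
    also have "(?z ^^ q) 0 = 0" by (rule V.endo_0[OF V.subspace_UNIV V.funpow_endo[OF V.subspace_UNIV z_endo]])
    finally show ?thesis .
  qed
  ultimately show ?case using q(1) by blast
qed

end

subsection \<open>The top of the module\<close>

text \<open>The condition concerns all eigenvectors of \<open>d\<^sub>0\<close> with the eigenvalue given by the weight, since the
  weight spaces that differ from it in the other directions have to be treated together with it.\<close>

definition highest :: "('n option \<Rightarrow> complex) \<Rightarrow> bool"
  where "highest \<kappa> \<longleftrightarrow> VW \<kappa> \<noteq> {0} \<and> (\<forall>w X (q::int). \<rho> (d_elt None) w = s (\<kappa> None) w \<longrightarrow> 0 < q \<longrightarrow>
    X \<in> lcarrier T \<longrightarrow> lbracket T (d_elt None) X = lscale T (of_int q) X \<longrightarrow> \<rho> X w = 0)"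

text \<open>A weight with \<open>d\<^sub>0\<close>-eigenvalue within distance one of the supremum of the real parts will do.\<close>

lemma highest_exists: obtains \<kappa> where "highest \<kappa>"
proof -
  obtain b where b: "\<And>c v. v \<noteq> 0 \<Longrightarrow> \<rho> (d_elt None) v = s c v \<Longrightarrow> Re c \<le> b"
    using category unfolding in_category_B_def by blast
  let ?A = "{Re (\<mu> None) | \<mu>. VW \<mu> \<noteq> {0}}"
  have nz: "\<exists>v\<in>VW \<mu>. v \<noteq> 0" if "VW \<mu> \<noteq> {0}" for \<mu>
    using that V.subspace_0[OF subspace_VW] by blast
  let ?E = "{Re c | c v. v \<noteq> 0 \<and> \<rho> (d_elt None) v = s c v}"
  have sub: "?A \<subseteq> ?E" using nz by (auto simp: d_weight_space_def)
  have bdd: "bdd_above ?E" using b by (auto simp: bdd_above_def)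
  have "\<exists>\<mu>. VW \<mu> \<noteq> {0}"
  proof (rule ccontr)
    assume "\<nexists>\<mu>. VW \<mu> \<noteq> {0}"
    then have "(\<Union>\<mu>. VW \<mu>) = {0}" by auto
    then have "V.span {0} = UNIV" using category unfolding in_category_B_def by simp
    then show False using irr unfolding irreducible_module_def module_of_def by simp
  qed
  then have ne: "?A \<noteq> {}" by blast
  have bddA: "bdd_above ?A" by (rule bdd_above_mono[OF bdd sub])
  obtain \<kappa> where \<kappa>: "VW \<kappa> \<noteq> {0}" "Sup ?A - 1 < Re (\<kappa> None)"
    using less_cSup_iff[OF ne bddA, of "Sup ?A - 1"] by auto
  have wt: "Re c \<le> Sup ?A" if w: "w \<noteq> 0" "\<rho> (d_elt None) w = s c w" for c w
  proof -
    let ?Q = "\<Union>d\<in>{\<mu> None | \<mu>. VW \<mu> \<noteq> {0}}. eig s UNIV {0} (\<rho> (d_elt None)) d"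
    have "VW \<mu> \<subseteq> insert 0 ?Q" for \<mu>
    proof (cases "VW \<mu> = {0}")
      case False
      then have "eig s UNIV {0} (\<rho> (d_elt None)) (\<mu> None) \<subseteq> ?Q" by blast
      then show ?thesis by (auto simp: eig_def d_weight_space_def)
    qed simp
    then have "(\<Union>\<mu>. VW \<mu>) \<subseteq> insert 0 ?Q" by blast
    from V.span_mono[OF this] have "w \<in> V.span (insert 0 ?Q)"
      using category unfolding in_category_B_def by blast
    then have "w \<in> V.span ?Q" by (simp only: V.span_insert_0)
    then have "c \<in> {\<mu> None | \<mu>. VW \<mu> \<noteq> {0}}"
      by (rule V.eigenvalue_of_span[OF V.subspace_UNIV \<rho>_endo[OF d_elt_mem] _ w])
    then show ?thesis using bddA by (auto intro!: cSup_upper)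
  qed
  have "highest \<kappa>"
    unfolding highest_def
  proof (intro conjI allI impI)
    fix w X and q :: int
    assume w: "\<rho> (d_elt None) w = s (\<kappa> None) w" and q: "0 < q" and X: "X \<in> lcarrier T" "lbracket T (d_elt None) X = lscale T (of_int q) X"
    have "\<rho> (d_elt None) (\<rho> X w) = s (\<kappa> None + of_int q) (\<rho> X w)"
      using \<rho>_bracket[OF d_elt_mem X(1), of None w] X w by (simp add: \<rho>_scale \<rho>_scale_elt V.scale_left_distrib)
    moreover have "\<not> Re (\<kappa> None + of_int q) \<le> Sup ?A" using \<kappa>(2) q by simp
    ultimately show "\<rho> X w = 0" using wt by blast
  qed (rule \<kappa>(1))
  then show ?thesis by (rule that)
qed

lemma highest_killed:
  assumes "highest \<kappa>" "homogeneous X k" "0 < k None" "w \<in> VW (shift \<kappa> l)" "l None = 0"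
  shows "\<rho> X w = 0"
proof -
  have "\<rho> (d_elt None) w = s (\<kappa> None) w" using assms(4,5) by (simp add: d_weight_space_def shift_def)
  then show ?thesis using assms(1-3) unfolding highest_def homogeneous_def by blast
qed

text \<open>Suppose the contrary, and let \<open>w\<close> be a common kernel vector of \<open>d\<close> of the operators \<open>t\<^sup>i\<^sup>r K\<^sub>0\<close>, in a top
  weight space. Let \<open>W i\<close> be the images of \<open>w\<close> under the powers of the injective operator \<open>t\<^sup>-\<^sup>r K\<^sub>0\<close>, and
  let \<open>E i\<close> be the \<open>t\<^sub>0\<^sup>-\<^sup>m t\<^sup>i\<^sup>r K\<^sub>a\<close>. The \<open>d + 1\<close> vectors \<open>E i (W i)\<close> lie in one weight space, which a
  power of the injective operator \<open>y\<close> maps into a fixed one. If \<open>d\<close> bounds the dimension of the latter,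
  then there is a linear relation between them. It contradicts the formula \<open>[F l, E i] = m t\<^sup>(\<^sup>i\<^sup>-\<^sup>l\<^sup>)\<^sup>r K\<^sub>0\<close> for
  \<open>F l = t\<^sub>0\<^sup>m t\<^sup>-\<^sup>l\<^sup>r d\<^sub>a\<close>: apply \<open>F l\<close> for the least index \<open>l\<close> in the relation. It kills the top, the
  terms with \<open>i > l\<close> vanish by the choice of \<open>w\<close>, and the term with \<open>i = l\<close> is a non-zero multiple of
  \<open>C\<^sub>0 W l\<close>.\<close>

theorem z_injective:
  assumes j: "j \<noteq> 0" and x: "z_op a j x = 0"
  shows "x = 0"
proof (rule ccontr)
  assume "x \<noteq> 0"
  note ctx = j \<open>x \<noteq> 0\<close> x
  obtain \<kappa> where \<kappa>: "highest \<kappa>" by (rule highest_exists)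
  obtain u where u: "u \<in> VW \<kappa>" "u \<noteq> 0"
    using \<kappa> V.subspace_0[OF subspace_VW] unfolding highest_def by blast
  define m where "m = int (ord D None)"
  \<comment> \<open>The exponents \<open>m k\<close> of \<open>t\<^sub>0\<close> alone.\<close>
  define e0 :: "int \<Rightarrow> 'n exponent" where "e0 k = (\<lambda>i. if i = None then m * k else 0)" for k
  have e0: "e0 k \<in> Gam D" "e0 k None = m * k" "e0 k (Some b) = 0" "e0 1 + e0 (-1) = 0" for k b
    by (auto simp: e0_def m_def Gam_def fun_eq_iff)
  have m: "m > 0" using datumD(5)[of None] by (simp add: m_def)
  obtain B where B: "finite B" "VW (shift \<kappa> (e0 (-1))) \<subseteq> V.span B" by (rule fin_VW)
  let ?d = "card B"
  obtain w N where w: "w \<noteq> 0" "w \<in> VW (shift \<kappa> (axis a (int N * j)))" "\<And>i. i \<in> {1..?d} \<Longrightarrow> z_op a (int i * j) w = 0"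
    using vacuum_vector[OF ctx u] by blast
  define W where "W i = (z_op a (- j) ^^ i) w" for i
  define E where "E i = K_vec (e0 (-1) + axis a (int i * j)) (Some a)" for i :: nat
  define F where "F l = d_vec (e0 1 + axis a (- (int l * j))) (Some a)" for l :: nat
  have W0: "W i \<noteq> 0" for i
  proof (induction i)
    case 0
    then show ?case using w by (simp add: W_def)
  next
    case (Suc i)
    then show ?case using opposite_injective[OF ctx u, of "W i"] by (auto simp: W_def)
  qed
  have Wwt: "W i \<in> VW (shift \<kappa> (axis a (int N * j - int i * j)))" for i
  proof -
    have "W i \<in> VW (shift (shift \<kappa> (axis a (int N * j))) (axis a (int i * - j)))"
      unfolding W_def by (rule funpow_weight[OF z_op_weight w(2)])
    then show ?thesis by (simp add: shift_add axis_add)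
  qed
  have Wvac: "z_op a (int k * j) (W i) = 0" if "k \<in> {1..?d}" for k i
  proof (induction i)
    case 0
    then show ?case using w(3)[OF that] by (simp add: W_def)
  next
    case (Suc i)
    have "z_op a (int k * j) (W (Suc i)) = z_op a (- j) (z_op a (int k * j) (W i))"
      unfolding W_def funpow.simps o_apply by (rule z_commute)
    then show ?case using Suc V.endo_0[OF V.subspace_UNIV z_endo] by simp
  qed
  have E: "homogeneous (E i) (e0 (-1) + axis a (int i * j))" for i
    unfolding E_def by (intro K_vec_homogeneous Gam_closed e0 axis_Gam)
  have F: "homogeneous (F l) (e0 1 + axis a (- (int l * j)))" for l
    unfolding F_def by (intro d_vec_homogeneous Gam_closed e0 axis_Gam)
  have EL: "E i \<in> lcarrier T" and FL: "F l \<in> lcarrier T" for i l using E F by (auto simp: homogeneous_def)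
  let ?X = "\<lambda>i. \<rho> (E i) (W i)"
  have "(y_op a j ^^ N) (?X i) \<in> VW (shift \<kappa> (e0 (-1)))" for i
  proof -
    have "(y_op a j ^^ N) (?X i) \<in> VW (shift (shift (shift \<kappa> (axis a (int N * j - int i * j))) (e0 (-1) + axis a (int i * j))) (axis a (int N * - j)))"
      by (intro funpow_weight[OF y_op_weight] homogeneous_act[OF E] Wwt)
    moreover have "axis a (int N * j - int i * j) + (e0 (-1) + axis a (int i * j)) + axis a (int N * - j) = e0 (-1)"
      by (auto simp: axis_def fun_eq_iff algebra_simps)
    ultimately show ?thesis by (simp only: shift_add)
  qed
  then have "(y_op a j ^^ N) (?X i) \<in> V.span B" for i using B(2) by blast
  then obtain c where c: "\<exists>i\<le>?d. c i \<noteq> 0" "(\<Sum>i\<le>?d. s (c i) ((y_op a j ^^ N) (?X i))) = 0"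
    using V.linearly_dependent_family[OF B(1), of "\<lambda>i. (y_op a j ^^ N) (?X i)"] by blast
  have ylin: "linear_endo_on s UNIV (y_op a j ^^ N)" by (rule V.funpow_endo[OF V.subspace_UNIV y_endo])
  have "(y_op a j ^^ N) (\<Sum>i\<le>?d. s (c i) (?X i)) = 0"
    using c(2) by (simp add: V.endo_sum[OF V.subspace_UNIV ylin] V.endo_scale[OF V.subspace_UNIV ylin])
  then have dep: "(\<Sum>i\<le>?d. s (c i) (?X i)) = 0" by (rule y_pow_inj[OF ctx])
  obtain l where l: "l \<le> ?d" "c l \<noteq> 0" "\<And>i. i < l \<Longrightarrow> c i = 0"
    using c(1) exists_least_iff[of "\<lambda>i. i \<le> ?d \<and> c i \<noteq> 0"] by (metis less_le_trans less_imp_le)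
  have FE: "\<rho> (F l) (?X i) = s (of_int m) (z_op a ((int i - int l) * j) (W i))" for i
  proof -
    let ?r = "e0 1 + axis a (- (int l * j))" and ?t = "e0 (-1) + axis a (int i * j)"
    have rt: "?r + ?t = axis a ((int i - int l) * j)"
      by (auto simp: e0_def axis_def fun_eq_iff algebra_simps)
    have two: "(\<Sum>p\<in>UNIV. h p) = h None + h (Some a)" if "\<And>b. b \<noteq> a \<Longrightarrow> h (Some b) = 0" for h :: "'n option \<Rightarrow> 'n K_space"
    proof -
      have "sum h UNIV = sum h {None, Some a}"
      proof (rule sum.mono_neutral_right)
        show "\<forall>p\<in>UNIV - {None, Some a}. h p = 0"
        proof
          fix p assume "p \<in> UNIV - {None, Some a}"
          then obtain b where "p = Some b" "b \<noteq> a" by (cases p) auto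
          then show "h p = 0" by (simp add: that)
        qed
      qed simp_all
      then show ?thesis by simp
    qed
    let ?q = "axis a ((int i - int l) * j)"
    have rel: "K_scale (of_int (?q (Some a))) (K_symbol ?q (Some a)) = 0"
      using K_symbol_relation[of ?q] two[of "\<lambda>p. K_scale (of_int (?q p)) (K_symbol ?q p)"] by (simp add: axis_def)
    have "der_K (single (?r, Some a) 1) (K_symbol ?t (Some a)) =
      K_scale (of_int (?t (Some a))) (K_symbol ?q (Some a)) + (\<Sum>p\<in>UNIV. K_scale (of_int (?r p)) (K_symbol ?q p))"
      unfolding der_K_symbol rt by simp
    also have "(\<Sum>p\<in>UNIV. K_scale (of_int (?r p)) (K_symbol ?q p)) =
      K_scale (of_int m) (K_symbol ?q None) + K_scale (of_int (?r (Some a))) (K_symbol ?q (Some a))"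
      by (subst two) (simp_all add: e0 axis_def)
    also have "K_scale (of_int (?t (Some a))) (K_symbol ?q (Some a)) + \<dots> =
      K_scale (of_int m) (K_symbol ?q None) + K_scale (of_int ((?r + ?t) (Some a))) (K_symbol ?q (Some a))"
      by (simp add: ks.scale_left_distrib algebra_simps)
    also have "\<dots> = K_scale (of_int m) (K_symbol ?q None)" unfolding rt using rel by simp
    finally have e: "der_K (single (?r, Some a) 1) (K_symbol ?t (Some a)) = K_scale (of_int m) (K_symbol ?q None)" .
    have "lbracket T (F l) (E i) = lscale T (of_int m) (K_vec ?q None)"
      unfolding F_def E_def K_vec_def bracket_d_K tau_scale e loop_scale_0 pm.scale_zero_right ..
    moreover have "\<rho> (F l) (W i) = 0"
      by (rule highest_killed[OF \<kappa> F _ Wwt]) (use m in \<open>simp_all add: e0 axis_add\<close>)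
    ultimately show ?thesis
      using \<rho>_bracket[OF FL EL, of l i "W i"] \<rho>_0[OF EL] \<rho>_scale_elt[OF K_vec_mem[OF axis_Gam(1)]] by (simp add: z_op_def)
  qed
  have "0 = \<rho> (F l) (\<Sum>i\<le>?d. s (c i) (?X i))" unfolding dep using \<rho>_0[OF FL] by simp
  also have "\<dots> = (\<Sum>i\<le>?d. s (c i) (s (of_int m) (z_op a ((int i - int l) * j) (W i))))"
    by (simp add: \<rho>_sum[OF FL] \<rho>_scale[OF FL] FE)
  also have "\<dots> = (\<Sum>i\<le>?d. if i = l then s (c l * of_int m * C\<^sub>0) (W l) else 0)"
  proof (rule sum.cong)
    fix i assume i: "i \<in> {..?d}"
    consider "i < l" | "i = l" | "i > l" by linarith
    then show "s (c i) (s (of_int m) (z_op a ((int i - int l) * j) (W i))) = (if i = l then s (c l * of_int m * C\<^sub>0) (W l) else 0)"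
    proof cases
      case 1
      then show ?thesis using l(3) by simp
    next
      case 2
      have "K_vec (axis a 0) None = K_elt None" by (simp add: K_vec_def K_elt_def axis_0)
      then show ?thesis using 2 K\<^sub>0 by (simp add: z_op_def)
    next
      case 3
      then have "z_op a (int (i - l) * j) (W i) = 0" using i by (intro Wvac) auto
      then show ?thesis using 3 by (simp add: of_nat_diff)
    qed
  qed simp
  also have "\<dots> = s (c l * of_int m * C\<^sub>0) (W l)" using l(1) by simp
  finally have "s (c l * of_int m * C\<^sub>0) (W l) = 0" by simp
  then show False using l(2) m C\<^sub>0 W0[of l] by simp
qed

text \<open>The operators \<open>z_op a j\<close> commute with \<open>h\<close> and are injective, so they carry eigenvectors of \<open>h\<close> to
  eigenvectors with the same eigenvalue. Hence the sets of eigenvalues are periodic, and a box of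
  representatives accounts for all of them.\<close>

lemma top_eigenvalues_finite:
  assumes h: "h \<in> csa0 D" and \<kappa>: "highest \<kappa>"
  defines "Ev \<equiv> \<lambda>k. {c. \<exists>v\<in>VW (shift \<kappa> k). v \<noteq> 0 \<and> \<rho> (g_elt h) v = s c v}"
  shows "finite (\<Union>k\<in>{k. k None = 0}. Ev k)" "Ev 0 \<noteq> {}"
proof -
  have hG: "h \<in> graded_part D 0" "h \<in> g.G" using h csa0 csa0_subset by blast+
  have hT: "g_elt h \<in> lcarrier T" unfolding g_elt_eq[of h None] by (rule torus_mem[OF hG(1)])
  have hom: "homogeneous (g_elt h) 0"
    unfolding homogeneous_def
  proof (intro conjI allI)
    fix i
    show "lbracket T (d_elt i) (g_elt h) = lscale T (of_int (0 i)) (g_elt h)"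
      unfolding d_elt_eq g_elt_def torus_bracket_loop[OF g.G_closed(1) hG(2)] tau_scale
      by (auto intro!: poly_mapping_eqI simp: hG g.br_zero lookup_loop_scale)
  qed (rule hT)
  have endo: "linear_endo_on s (VW \<mu>) (\<rho> (g_elt h))" for \<mu>
    using homogeneous_act[OF hom, of _ \<mu>] V.linear_endo_on_subset[OF \<rho>_endo[OF hT], of "VW \<mu>"] by (auto simp: shift_0)
  have fin: "finite (Ev k)" for k
  proof -
    obtain B where B: "finite B" "VW (shift \<kappa> k) \<subseteq> V.span B" by (rule fin_VW)
    show ?thesis unfolding Ev_def by (rule V.finite_eigenvalues[OF subspace_VW endo B])
  qed
  have sub: "Ev k \<subseteq> Ev (k + axis a j)" for k a j
  proof (cases "j = 0")
    case False
    show ?thesis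
    proof
      fix c assume "c \<in> Ev k"
      then obtain v where v: "v \<in> VW (shift \<kappa> k)" "v \<noteq> 0" "\<rho> (g_elt h) v = s c v" unfolding Ev_def by blast
      have zT: "K_vec (axis a j) None \<in> lcarrier T" by (rule K_vec_mem[OF axis_Gam(1)])
      have "lbracket T (g_elt h) (K_vec (axis a j) None) = 0"
        unfolding g_elt_eq[of h None] K_vec_def torus_bracket_K by (simp add: zero_prod_def)
      then have "\<rho> (g_elt h) (z_op a j v) = s c (z_op a j v)"
        using \<rho>_bracket[OF hT zT, of v] v(3) by (simp add: z_op_def \<rho>_zero_elt \<rho>_scale[OF zT])
      moreover have "z_op a j v \<noteq> 0" using z_injective[OF False] v(2) by blast
      moreover have "z_op a j v \<in> VW (shift \<kappa> (k + axis a j))" using z_op_weight[OF v(1)] by (simp add: shift_add)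
      ultimately show "c \<in> Ev (k + axis a j)" unfolding Ev_def by blast
    qed
  qed (simp add: axis_0)
  have eq: "Ev (k + axis a j) = Ev k" for k a j
    using sub[of k a j] sub[of "k + axis a j" a "- j"] by (auto simp: add.assoc axis_add axis_0)
  let ?box = "{k :: 'n exponent. \<forall>i. k i \<in> (case i of None \<Rightarrow> {0} | Some a \<Rightarrow> {0..<int (ord D (Some a))})}"
  have "finite ?box"
  proof -
    let ?I = "\<lambda>i. case i of None \<Rightarrow> {0} | Some a \<Rightarrow> {0..<int (ord D (Some a))}"
    have "finite (\<Union>i. ?I i)" by (intro finite_UN_I) (auto split: option.split)
    then have "finite {k :: 'n exponent. \<forall>i. (i \<in> UNIV \<longrightarrow> k i \<in> (\<Union>i. ?I i)) \<and> (i \<notin> UNIV \<longrightarrow> k i = 0)}"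
      by (intro finite_set_of_finite_funs) simp_all
    then show ?thesis by (rule finite_subset[rotated]) blast
  qed
  have red: "\<exists>k'. Ev k' = Ev k \<and> k' None = 0 \<and> (\<forall>a\<in>A. k' (Some a) \<in> {0..<int (ord D (Some a))})"
    if "k None = 0" "finite A" for k A
    using that(2)
  proof (induction A rule: finite_induct)
    case empty
    then show ?case using that(1) by blast
  next
    case (insert a A)
    then obtain k' where k': "Ev k' = Ev k" "k' None = 0" "\<forall>a\<in>A. k' (Some a) \<in> {0..<int (ord D (Some a))}" by blast
    let ?m = "int (ord D (Some a))"
    let ?k = "k' + axis a (- (k' (Some a) div ?m))"
    have "?k (Some a) = k' (Some a) mod ?m" by (simp add: axis_def minus_mult_div_eq_mod)
    then have "?k (Some a) \<in> {0..<?m}" using datumD(5)[of "Some a"] by simp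
    moreover have "?k (Some b) = k' (Some b)" if "b \<noteq> a" for b using that by (simp add: axis_def)
    ultimately have "?k (Some b) \<in> {0..<int (ord D (Some b))}" if "b \<in> insert a A" for b
      using k'(3) that by (cases "b = a") simp_all
    moreover have "Ev ?k = Ev k" unfolding eq by (rule k'(1))
    moreover have "?k None = 0" using k'(2) by (simp add: axis_add)
    ultimately show ?case by blast
  qed
  have "(\<Union>k\<in>{k. k None = 0}. Ev k) \<subseteq> (\<Union>k\<in>?box. Ev k)"
  proof clarify
    fix c k assume "k None = (0::int)" "c \<in> Ev k"
    then obtain k' where "c \<in> Ev k'" "k' None = 0" "\<And>a. k' (Some a) \<in> {0..<int (ord D (Some a))}"
      using red[of k UNIV] by auto
    moreover from this have "k' \<in> ?box" by (auto split: option.split)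
    ultimately show "c \<in> (\<Union>k\<in>?box. Ev k)" by blast
  qed
  then show "finite (\<Union>k\<in>{k. k None = 0}. Ev k)"
    using \<open>finite ?box\<close> fin by (meson finite_UN_I finite_subset)
  obtain u where u: "u \<in> VW \<kappa>" "u \<noteq> 0"
    using \<kappa> V.subspace_0[OF subspace_VW] unfolding highest_def by blast
  obtain B where B: "finite B" "VW \<kappa> \<subseteq> V.span B" by (rule fin_VW)
  obtain c v where "v \<in> VW \<kappa>" "v \<noteq> 0" "\<rho> (g_elt h) v = s c v"
    by (rule V.eigenvector_exists[OF subspace_VW endo B u])
  then show "Ev 0 \<noteq> {}" unfolding Ev_def shift_0 by blast
qed

text \<open>An eigenvector of \<open>h\<close> in a top weight space whose eigenvalue has maximal real part: a root vector for a
  positive root \<open>\<alpha>\<close> of the finite root system would increase the real part by \<open>Re (\<alpha> h)\<close>.\<close>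

theorem positive_part_annihilates:
  assumes h: "h \<in> csa0 D" "\<And>\<alpha>. \<alpha> \<in> pos D \<Longrightarrow> Re (\<alpha> h) > 0"
  obtains v b where "v \<noteq> 0" "v \<in> annihilated \<rho> positive_part" "\<rho> (torus_elt h None 1) v = s b v"
proof -
  obtain \<kappa> where \<kappa>: "highest \<kappa>" by (rule highest_exists)
  define Ev where "Ev k = {c. \<exists>v\<in>VW (shift \<kappa> k). v \<noteq> 0 \<and> \<rho> (g_elt h) v = s c v}" for k
  note fin = top_eigenvalues_finite[OF h(1) \<kappa>, folded Ev_def]
  have "\<exists>c\<in>(\<Union>k\<in>{k. k None = 0}. Ev k). \<forall>c'\<in>(\<Union>k\<in>{k. k None = 0}. Ev k). Re c' \<le> Re c"
  proof -
    let ?R = "Re ` (\<Union>k\<in>{k. k None = 0}. Ev k)"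
    have "finite ?R" using fin(1) by blast
    moreover have "?R \<noteq> {}" using fin(2) by force
    ultimately have "Max ?R \<in> ?R" and le: "\<And>x. x \<in> ?R \<Longrightarrow> x \<le> Max ?R" by simp_all
    from this(1) obtain c where c: "Max ?R = Re c" "c \<in> (\<Union>k\<in>{k. k None = 0}. Ev k)" by (rule imageE)
    show ?thesis
      by (rule bexI[OF _ c(2)], rule ballI, fold c(1), rule le, rule imageI)
  qed
  then obtain c k where k: "k None = 0" "c \<in> Ev k" and max: "\<And>c' k'. k' None = 0 \<Longrightarrow> c' \<in> Ev k' \<Longrightarrow> Re c' \<le> Re c"
    by blast
  from k(2) obtain v where v: "v \<in> VW (shift \<kappa> k)" "v \<noteq> 0" "\<rho> (g_elt h) v = s c v" unfolding Ev_def by blast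
  have hT: "g_elt h \<in> lcarrier T" unfolding g_elt_eq[of h None] using h(1) csa0(1) by (intro torus_mem) blast
  have kill: "\<rho> X v = 0" if "X \<in> root_space D \<alpha> l" "0 < l None \<or> l None = 0 \<and> \<alpha> \<in> pos D" for X \<alpha> l
  proof -
    have X: "homogeneous X l" "X \<in> lcarrier T" "lbracket T (g_elt h) X = lscale T (\<alpha> h) X"
      using that(1) h(1) unfolding root_space_def homogeneous_def by blast+
    show ?thesis
    proof (cases "0 < l None")
      case True
      then show ?thesis by (rule highest_killed[OF \<kappa> X(1) _ v(1) k(1)])
    next
      case False
      with that(2) have l: "l None = 0" "\<alpha> \<in> pos D" by auto
      have wt: "\<rho> X v \<in> VW (shift \<kappa> (k + l))" using homogeneous_act[OF X(1) v(1)] by (simp add: shift_add)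
      have "\<rho> (g_elt h) (\<rho> X v) = s (c + \<alpha> h) (\<rho> X v)"
        using \<rho>_bracket[OF hT X(2), of v] v(3) X by (simp add: \<rho>_scale \<rho>_scale_elt V.scale_left_distrib)
      then have ev: "c + \<alpha> h \<in> Ev (k + l)" if "\<rho> X v \<noteq> 0" unfolding Ev_def using wt that by blast
      have "Re (c + \<alpha> h) \<le> Re c" if "\<rho> X v \<noteq> 0"
        by (rule max[OF _ ev[OF that]]) (use k(1) l(1) in simp)
      then show ?thesis using h(2)[OF l(2)] by auto
    qed
  qed
  have "v \<in> annihilated \<rho> positive_part"
    unfolding annihilated_def positive_part_def using kill by blast
  moreover have "\<rho> (torus_elt h None 1) v = s (c + \<kappa> None) v"
  proof -
    have "torus_elt h None 1 = g_elt h + d_elt None"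
      by (simp add: torus_elt_def g_elt_def d_elt_def plus_prod_def)
    moreover have "\<rho> (d_elt None) v = s (\<kappa> None) v" using v(1) k(1) by (simp add: d_weight_space_def shift_def)
    ultimately show ?thesis using v(3) by (simp add: \<rho>_add_elt[OF hT d_elt_mem] V.scale_left_distrib)
  qed
  ultimately show ?thesis using that v(2) by blast
qed

subsection \<open>The two induced modules\<close>

text \<open>A vector of highest weight is first seen to be killed by the elements of positive integral degree.
  Then all eigenvalues of \<open>d\<^sub>0\<close> lie below that of the vector, so it is killed by all elements of positive
  real degree, as they occur in \<open>tau_plus\<close>.\<close>

lemma degree_rep:
  obtains v b where "irreducible_graded_rep T s \<rho> (d_elt None) (\<Union>q\<in>{0<..}. tau_deg D q) (tau_zero D) (\<Union>q\<in>{..<0}. tau_deg D q) b v"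
proof -
  obtain \<kappa> where \<kappa>: "highest \<kappa>" by (rule highest_exists)
  obtain v where v: "v \<in> VW \<kappa>" "v \<noteq> 0"
    using \<kappa> V.subspace_0[OF subspace_VW] unfolding highest_def by blast
  have dv: "\<rho> (d_elt None) v = s (\<kappa> None) v" using v by (simp add: d_weight_space_def)
  interpret I: irreducible_graded_rep T s \<rho> "d_elt None" "\<Union>q\<in>{0<..}. tau_deg D (of_int q)" "tau_zero D"
    "\<Union>q\<in>{..<0}. tau_deg D (of_int q)" "\<kappa> None" v
  proof (rule irreducible_graded_rep.intro[OF integral_degree_grading rep irr v(2) _ dv])
    show "v \<in> annihilated \<rho> (\<Union>q\<in>{0<..}. tau_deg D (of_int q))"
      using \<kappa> dv unfolding highest_def annihilated_def tau_deg_def by auto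
  qed
  have "\<rho> X v = 0" if X: "X \<in> tau_deg D q" and q: "q > 0" for X q
  proof (rule ccontr)
    assume n: "\<rho> X v \<noteq> 0"
    have "\<rho> X v \<in> I.V.E (\<kappa> None + of_real q)"
      using X dv by (intro I.V.act_shifts_eigenvalue) (auto simp: tau_deg_def eig_def)
    moreover have "v \<in> I.V.E (\<kappa> None)" using dv by (simp add: eig_def)
    ultimately obtain p where "p \<le> 0" "\<kappa> None + of_real q = \<kappa> None + of_real p"
      using I.eigenvalue_below_highest[OF I.v\<^sub>0(1,2) _ n] by blast
    with q show False by simp
  qed
  then have "v \<in> annihilated \<rho> (\<Union>q\<in>{0<..}. tau_deg D q)" by (auto simp: annihilated_def)
  then show ?thesis using that irreducible_graded_rep.intro[OF degree_grading rep irr v(2) _ dv] by blast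
qed

lemma subspace_sum_bounds:
  assumes "P \<subseteq> A" "A \<subseteq> t.span P" "Z \<subseteq> C" "C \<subseteq> t.span Z" "0 \<in> A" "0 \<in> C"
  shows "P \<union> Z \<subseteq> subspace_sum A C" "subspace_sum A C \<subseteq> t.span (P \<union> Z)"
proof -
  have "x + 0 \<in> subspace_sum A C" if "x \<in> P" for x using that assms unfolding subspace_sum_def by blast
  moreover have "0 + x \<in> subspace_sum A C" if "x \<in> Z" for x using that assms unfolding subspace_sum_def by blast
  ultimately show "P \<union> Z \<subseteq> subspace_sum A C" by auto
  show "subspace_sum A C \<subseteq> t.span (P \<union> Z)"
  proof
    fix X assume "X \<in> subspace_sum A C"
    then obtain x y where "X = x + y" "x \<in> A" "y \<in> C" unfolding subspace_sum_def by blast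
    moreover have "t.span P \<subseteq> t.span (P \<union> Z)" "t.span Z \<subseteq> t.span (P \<union> Z)" by (rule t.span_mono; blast)+
    ultimately show "X \<in> t.span (P \<union> Z)" using assms(2,4) t.span_add by blast
  qed
qed

theorem induced_from_degree:
  defines "M \<equiv> induced_module T (subspace_sum (tau_plus D) (tau_zero D)) s \<rho> (annihilated \<rho> (tau_plus D))"
  shows "(\<exists>!N. irreducible_quotient_by T M N) \<and> module_iso T (module_of s \<rho>) (irreducible_quotient T M)"
proof -
  let ?P = "\<Union>q\<in>{0<..}. tau_deg D q"
  obtain v b where rep: "irreducible_graded_rep T s \<rho> (d_elt None) ?P (tau_zero D) (\<Union>q\<in>{..<0}. tau_deg D q) b v"
    by (rule degree_rep)
  have d: "lbracket T (d_elt None) (d_elt None) = 0"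
    unfolding d_elt_def tau_bracket
    by (simp add: loop_operations_0 der_K_0 der_cocycle_zero_exponent der_der_single zero_prod_def)
  have 0: "lbracket T (d_elt None) 0 = 0"
    unfolding d_elt_def zero_prod_def tau_bracket by (simp add: loop_operations_0 der_K_0)
  have z: "0 \<in> tau_zero D" "d_elt None \<in> tau_zero D"
    using d 0 d_elt_mem t.subspace_0[OF subspace_tau] by (auto simp: tau_zero_def tau_deg_def)
  have P: "?P \<subseteq> tau_plus D" "tau_plus D \<subseteq> t.span ?P" "0 \<in> tau_plus D"
    unfolding tau_plus_def using t.span_superset t.span_zero by auto
  note B = subspace_sum_bounds[OF P(1,2) order_refl t.span_superset P(3) z(1)]
  show ?thesis unfolding M_def
    by (rule induced_from_highest_component[OF rep B _ P(1,2)]) (use B z in blast)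
qed

theorem induced_from_root:
  defines "M \<equiv> induced_module T (subspace_sum (tau_up D) (tau_mid D)) s \<rho> (annihilated \<rho> (tau_up D))"
  shows "(\<exists>!N. irreducible_quotient_by T M N) \<and> module_iso T (module_of s \<rho>) (irreducible_quotient T M)"
proof -
  obtain h where h: "h \<in> csa0 D" "graded_by T (torus_elt h None 1) positive_part middle_part negative_part"
    "\<And>\<alpha>. \<alpha> \<in> pos D \<Longrightarrow> Re (\<alpha> h) > 0"
    using root_grading by blast
  obtain v b where v: "v \<noteq> 0" "v \<in> annihilated \<rho> positive_part" "\<rho> (torus_elt h None 1) v = s b v"
  proof (rule positive_part_annihilates[OF h(1)])
    show "Re (\<alpha> h) > 0" if "\<alpha> \<in> pos D" for \<alpha> using that by (rule h(3))
  qed (rule that)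
  note rep = irreducible_graded_rep.intro[OF h(2) rep irr v]
  have up: "tau_up D = t.span positive_part" and mid: "tau_mid D = t.span middle_part"
    unfolding tau_up_def tau_mid_def positive_part_def middle_part_def by (rule refl)+
  note B = subspace_sum_bounds[OF t.span_superset order_refl t.span_superset order_refl t.span_zero t.span_zero, of positive_part middle_part]
  show ?thesis unfolding M_def up mid
    by (rule induced_from_highest_component[OF rep B _ t.span_superset order_refl]) (use B(1) torus_elt_in_middle[OF h(1)] in blast)
qed

end

section \<open>The irreducible quotients\<close>

lemma module_iso_from_common:
  assumes "module_iso L (module_of s \<rho>) X" "module_iso L (module_of s \<rho>) Y"
  shows "module_iso L X Y"
proof -
  obtain f where f: "bij_betw f UNIV (mcarrier X)" "\<And>v w. f (v + w) = madd X (f v) (f w)"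
    "\<And>c v. f (s c v) = mscale X c (f v)" "\<And>x v. x \<in> lcarrier L \<Longrightarrow> f (\<rho> x v) = mact X x (f v)"
    using assms(1) unfolding module_iso_def module_of_def by auto
  obtain g where g: "bij_betw g UNIV (mcarrier Y)" "\<And>v w. g (v + w) = madd Y (g v) (g w)"
    "\<And>c v. g (s c v) = mscale Y c (g v)" "\<And>x v. x \<in> lcarrier L \<Longrightarrow> g (\<rho> x v) = mact Y x (g v)"
    using assms(2) unfolding module_iso_def module_of_def by auto
  let ?i = "inv_into UNIV f"
  have i: "?i (f v) = v" for v using f(1) by (simp add: bij_betw_def)
  have onto: "\<exists>v. m = f v" if "m \<in> mcarrier X" for m using f(1) that by (auto simp: bij_betw_def)
  have "bij_betw (g \<circ> ?i) (mcarrier X) (mcarrier Y)"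
    using bij_betw_trans[OF bij_betw_inv_into[OF f(1)] g(1)] .
  then show ?thesis
    unfolding module_iso_def
    by (intro exI[of _ "g \<circ> ?i"])
      (auto dest!: onto simp: i g(2-4) simp flip: f(2-4))
qed

theorem theorem5p6:
  fixes D :: "('n::finite, 'g::ab_group_add) toroidal_data"
    and \<psi> :: "('n, 'g) toroidal \<Rightarrow> complex"
    and s :: "complex \<Rightarrow> 'v::ab_group_add \<Rightarrow> 'v"
    and \<rho> :: "('n, 'g) toroidal \<Rightarrow> 'v \<Rightarrow> 'v"
    and C\<^sub>0 :: complex
    and S T :: "'v set"
  defines "S \<equiv> annihilated \<rho> (tau_plus D)"
    and "T \<equiv> annihilated \<rho> (tau_up D)"
    and "M' \<equiv> induced_module (tau D) (subspace_sum (tau_plus D) (tau_zero D)) s \<rho> S"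
    and "M \<equiv> induced_module (tau D) (subspace_sum (tau_up D) (tau_mid D)) s \<rho> T"
  assumes "toroidal_datum D"
    and "linear_form_on (lscale (tau D)) (lie_centre (tau D)) \<psi>"
    and "in_category_B D \<psi> s \<rho>"
    and "irreducible_module (tau D) (module_of s \<rho>)"
    and "\<forall>v. \<rho> (K_elt None) v = s C\<^sub>0 v"
    and "C\<^sub>0 \<noteq> 0"
  shows "(\<exists>!N. irreducible_quotient_by (tau D) M' N) \<and>
    (\<exists>!N. irreducible_quotient_by (tau D) M N) \<and>
    module_iso (tau D) (module_of s \<rho>) (irreducible_quotient (tau D) M') \<and>
    module_iso (tau D) (irreducible_quotient (tau D) M') (irreducible_quotient (tau D) M)"
proof -
  interpret toroidal_module D \<psi> s \<rho> C\<^sub>0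
    by unfold_locales (use assms(5-) in auto)
  note 1 = induced_from_degree and 2 = induced_from_root
  show ?thesis
    unfolding M'_def M_def S_def T_def
    using 1 2 module_iso_from_common[OF conjunct2[OF 1] conjunct2[OF 2]] by blast
qed

end
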